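(* Let $X$ be a Banach space. (1) Let $\mathcal H$ be a D-family of subspaces of $X$. Suppose that $X$ is $\mathcal H$-tight and that $\mathcal H$ is invariant under isomorphism. Then $X$ is ergodic. (2) Let $d$ be a degree. Suppose that $X$ is $d$-tight. Then $X$ is ergodic.
   Context: All Banach spaces are real. "Banach space" means infinite-dimensional Banach space and "subspace" means infinite-dimensional closed linear subspace, unless finite dimension is explicitly allowed. D-families. $\mathrm{Sub}(X)$ is the set of all closed linear subspaces of $X$, finite- or infinite-dimensional. For $Y\in\mathrm{Sub}(X)$, $F\subseteq Y$ finite-dimensional and $\varepsilon>0$, let $[F,Y]_\varepsilon$ be the set of $Z\in\mathrm{Sub}(X)$ for which there exist $Z'\in\mathrm{Sub}(X)$ with $F\subseteq Z'\subseteq Y$ and an isomorphism $T\colon Z'\to Z$ with $\|T-\mathrm{Id}_{Z'}\|<\varepsilon$. These sets form a basis of a topology on $\mathrm{Sub}(X)$, the Ellentuck topology. A D-family of subspaces of $X$ is a set $\mathcal H$ of infinite-dimensional closed subspaces of $X$ that is $G_\delta$ in $\mathrm{Sub}(X)$ for the Ellentuck topology and such that for every infinite-dimensional closed subspace $Y$ and every finite-dimensional subspace $F$ of $X$, $Y\in\mathcal H\iff Y+F\in\mathcal H$. $\mathcal H$ is invariant under isomorphism if for all isomorphic infinite-dimensional closed subspaces $Y,Z$ of $X$, $Y\in\mathcal H\iff Z\in\mathcal H$. Tightness. An FDD of a Banach space $X$ is a sequence $(F_n)_{n\in\mathbb N}$ of nonzero finite-dimensional subspaces of $X$ such that every $x\in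 X$ can be written uniquely as $x=\sum_n x_n$, $x_n\in F_n$. $[F_n\mid n\in B]$ is the closed linear span of the $F_n$, $n\in B$. A Banach space $Z$ is tight in $(F_n)$ if there is an infinite sequence of nonempty intervals of integers $I_0<I_1<\cdots$ (each entirely to the left of the next) such that for every infinite $A\subseteq\mathbb N$, $Z$ does not embed isomorphically into $[F_n\mid n\notin\bigcup_{i\in A}I_i]$. $X$ is $\mathcal H$-tight if $X\in\mathcal H$ and $X$ has an FDD in which every element of $\mathcal H$ is tight. Degrees. An approximation pair is a pair $(X,F)$ where $X$ is a finite- or infinite-dimensional Banach space and $F$ is a finite-dimensional subspace of $X$. A morphism from $(X,F)$ to $(Y,G)$ is a pair $\varphi=(S,T)$ of bounded linear operators $S\colon G\to F$, $T\colon X\to Y$ such that $T(S(g))=g$ for all $g\in G$; its norm is $\|\varphi\|=\|S\|\cdot\|T\|$ if $G\neq\{0\}$ and $\|\varphi\|=1$ if $G=\{0\}$. A degree is a map $d$ assigning to every approximation pair $(X,F)$ a number $d(X,F)\in[0,\infty)$, for which there is $K_d\colon[1,\infty)\times[0,\infty)\to[0,\infty)$, non-decreasing in both variables, with $\lim_{s\to1}K_d(s,t)=t$ for all $t\ge 0$, such that $d(Y,G)\le K_d(\|\varphi\|,d(X,F))$ for every morphism $\varphi\colon(X,F)\to(Y,G)$. A space $X$ is $d$-small if $\sup_F d(X,F)<\infty$ over all finite-dimensional subspaces $F$ of $X$, and $d$-large otherwise. The $d$-large subspaces of $X$ form a D-family; $X$ is $d$-tight if it is $\mathcal H$-tight for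 this family $\mathcal H$ (equivalently, $X$ is $d$-large and has an FDD in which every $d$-large Banach space is tight). Ergodicity. For separable $X$, $\mathrm{Sub}(X)$ carries the Effros Borel structure, i.e. the $\sigma$-algebra generated by the sets $\{Y\mid Y\cap U\neq\varnothing\}$, $U\subseteq X$ open; it is a standard Borel space. $\mathbf E_0$ is the relation of eventual equality on $\{0,1\}^{\mathbb N}$. A separable Banach space $X$ is ergodic if there is a Borel map $f\colon\{0,1\}^{\mathbb N}\to\mathrm{Sub}(X)$ such that for all $x,y$: $x\,\mathbf E_0\,y$ iff $f(x)$ and $f(y)$ are linearly isomorphic. *)

theory Defs
  imports "HOL-Analysis.Analysis"
begin

section \<open>Banach spaces on carrier sets\<close>

text \<open>
  The space \<open>X\<close> of the theorem is a type of class \<open>banach\<close>. Degrees, however, take all Banach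
  spaces as arguments and compare spaces carrying unrelated norms. An arbitrary Banach space is
  therefore given by a carrier \<open>V\<close>, which is a linear subspace of some real vector space, and a
  complete norm \<open>N\<close> on \<open>V\<close>; values of \<open>N\<close> outside \<open>V\<close> are irrelevant. Closed subspaces of \<open>X\<close> are
  the spaces \<open>(Y, norm)\<close>.
\<close>

definition banach_on :: "'v::real_vector set \<Rightarrow> ('v \<Rightarrow> real) \<Rightarrow> bool" where
  "banach_on V N \<longleftrightarrow>
     subspace V \<and>
     (\<forall>x\<in>V. 0 \<le> N x \<and> (N x = 0 \<longleftrightarrow> x = 0)) \<and>
     (\<forall>x\<in>V. \<forall>c. N (c *\<^sub>R x) = \<bar>c\<bar> * N x) \<and>
     (\<forall>x\<in>V. \<forall>y\<in>V. N (x + y) \<le> N x + N y) \<and>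
     (\<forall>\<sigma> :: nat \<Rightarrow> 'v. (\<forall>n. \<sigma> n \<in> V) \<and> (\<forall>e>0. \<exists>n0. \<forall>m\<ge>n0. \<forall>n\<ge>n0. N (\<sigma> m - \<sigma> n) < e)
        \<longrightarrow> (\<exists>x\<in>V. (\<lambda>n. N (\<sigma> n - x)) \<longlonglongrightarrow> 0))"

definition fin_dim :: "'v::real_vector set \<Rightarrow> bool" where
  "fin_dim F \<longleftrightarrow> (\<exists>B. finite B \<and> F = span B)"

definition bounded_linear_on ::
  "'v::real_vector set \<Rightarrow> ('v \<Rightarrow> real) \<Rightarrow> 'w::real_vector set \<Rightarrow> ('w \<Rightarrow> real) \<Rightarrow> ('v \<Rightarrow> 'w) \<Rightarrow> bool"
where
  "bounded_linear_on V N W M T \<longleftrightarrow>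
     T ` V \<subseteq> W \<and>
     (\<forall>x\<in>V. \<forall>y\<in>V. T (x + y) = T x + T y) \<and>
     (\<forall>x\<in>V. \<forall>c. T (c *\<^sub>R x) = c *\<^sub>R T x) \<and>
     (\<exists>K. \<forall>x\<in>V. M (T x) \<le> K * N x)"

text \<open>The operator norm, in the form of \<^const>\<open>onorm\<close> (the quotient is \<open>0\<close> at \<open>x = 0\<close>).\<close>

definition opnorm_on ::
  "'v::real_vector set \<Rightarrow> ('v \<Rightarrow> real) \<Rightarrow> ('w::real_vector \<Rightarrow> real) \<Rightarrow> ('v \<Rightarrow> 'w) \<Rightarrow> real"
where
  "opnorm_on V N M T = (SUP x\<in>V. M (T x) / N x)"

definition isomorphism_on ::
  "'v::real_vector set \<Rightarrow> ('v \<Rightarrow> real) \<Rightarrow> 'w::real_vector set \<Rightarrow> ('w \<Rightarrow> real) \<Rightarrow> ('v \<Rightarrow> 'w) \<Rightarrow> bool"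
where
  "isomorphism_on V N W M T \<longleftrightarrow>
     bij_betw T V W \<and> bounded_linear_on V N W M T \<and>
     bounded_linear_on W M V N (the_inv_into V T)"

section \<open>Subspaces of \<open>X\<close> and D-families\<close>

definition Sub :: "'a::banach set set" where
  "Sub = {Y. subspace Y \<and> closed Y}"

definition Sub_inf :: "'a::banach set set" where
  "Sub_inf = {Y \<in> Sub. \<not> fin_dim Y}"

definition isomorphic :: "'a::banach set \<Rightarrow> 'a set \<Rightarrow> bool" where
  "isomorphic Y Z \<longleftrightarrow> (\<exists>T. isomorphism_on Y norm Z norm T)"

definition embeds :: "'a::banach set \<Rightarrow> 'a set \<Rightarrow> bool" where
  "embeds Z W \<longleftrightarrow> (\<exists>T. T ` Z \<subseteq> W \<and> isomorphism_on Z norm (T ` Z) norm T)"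

definition ellentuck_nbhd :: "'a::banach set \<Rightarrow> 'a set \<Rightarrow> real \<Rightarrow> 'a set set" where
  "ellentuck_nbhd F Y \<epsilon> =
     {Z \<in> Sub. \<exists>Z'\<in>Sub. F \<subseteq> Z' \<and> Z' \<subseteq> Y \<and>
        (\<exists>T. isomorphism_on Z' norm Z norm T \<and> opnorm_on Z' norm norm (\<lambda>z. T z - z) < \<epsilon>)}"

definition ellentuck :: "'a::banach set topology" where
  "ellentuck = topology_generated_by
     {ellentuck_nbhd F Y \<epsilon> | F Y \<epsilon>. Y \<in> Sub \<and> fin_dim F \<and> F \<subseteq> Y \<and> 0 < \<epsilon>}"

definition D_family :: "'a::banach set set \<Rightarrow> bool" where
  "D_family H \<longleftrightarrow>
     H \<subseteq> Sub_inf \<and> gdelta_in ellentuck H \<and>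
     (\<forall>Y\<in>Sub_inf. \<forall>F. fin_dim F \<longrightarrow> (Y \<in> H \<longleftrightarrow> {y + f | y f. y \<in> Y \<and> f \<in> F} \<in> H))"

definition iso_invariant :: "'a::banach set set \<Rightarrow> bool" where
  "iso_invariant H \<longleftrightarrow>
     (\<forall>Y\<in>Sub_inf. \<forall>Z\<in>Sub_inf. isomorphic Y Z \<longrightarrow> (Y \<in> H \<longleftrightarrow> Z \<in> H))"

section \<open>Tightness\<close>

definition is_FDD :: "(nat \<Rightarrow> 'a::banach set) \<Rightarrow> bool" where
  "is_FDD F \<longleftrightarrow>
     (\<forall>n. fin_dim (F n) \<and> F n \<noteq> {0}) \<and>
     (\<forall>x. \<exists>!xs. (\<forall>n. xs n \<in> F n) \<and> xs sums x)"

definition closed_span :: "(nat \<Rightarrow> 'a::banach set) \<Rightarrow> nat set \<Rightarrow> 'a set" where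
  "closed_span F B = closure (span (\<Union>n\<in>B. F n))"

definition tight_in :: "'a::banach set \<Rightarrow> (nat \<Rightarrow> 'a set) \<Rightarrow> bool" where
  "tight_in Z F \<longleftrightarrow>
     (\<exists>I :: nat \<Rightarrow> nat set.
        (\<forall>i. \<exists>a b. a \<le> b \<and> I i = {a..b}) \<and>
        (\<forall>i. \<forall>m\<in>I i. \<forall>n\<in>I (Suc i). m < n) \<and>
        (\<forall>A. infinite A \<longrightarrow> \<not> embeds Z (closed_span F (- (\<Union>i\<in>A. I i)))))"

text \<open>\<open>X\<close>, i.e. the whole type \<open>'a\<close>, is \<open>H\<close>-tight.\<close>

definition H_tight :: "'a::banach set set \<Rightarrow> bool" where
  "H_tight H \<longleftrightarrow> UNIV \<in> H \<and> (\<exists>F. is_FDD F \<and> (\<forall>Z\<in>H. tight_in Z F))"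

section \<open>Degrees\<close>

text \<open>
  The approximation pair \<open>((V, N), F)\<close>. As HOL has no quantification over types, a degree is a
  function on the approximation pairs whose spaces are carried by linear subspaces of one real
  vector space \<open>'v\<close>, with no restriction on the norms. In the theorem \<open>'v\<close> is the vector space
  underlying \<open>X\<close>. Since \<open>X\<close> is infinite-dimensional, its algebraic dimension is at least that of
  every separable Banach space, so every separable Banach space has an isometric copy among these
  spaces; and the closed subspaces of \<open>X\<close> are themselves among them. A degree on the class of all
  Banach spaces restricts to a degree in this sense, with the same function \<open>K\<close>.
\<close>

definition approx_pair :: "'v::real_vector set \<Rightarrow> ('v \<Rightarrow> real) \<Rightarrow> 'v set \<Rightarrow> bool" where
  "approx_pair V N F \<longleftrightarrow> banach_on V N \<and> fin_dim F \<and> F \<subseteq> V"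

definition morphism ::
  "'v::real_vector set \<Rightarrow> ('v \<Rightarrow> real) \<Rightarrow> 'v set \<Rightarrow> 'v set \<Rightarrow> ('v \<Rightarrow> real) \<Rightarrow> 'v set \<Rightarrow>
   ('v \<Rightarrow> 'v) \<Rightarrow> ('v \<Rightarrow> 'v) \<Rightarrow> bool"
where
  "morphism V N F W M G S T \<longleftrightarrow>
     bounded_linear_on G M F N S \<and> bounded_linear_on V N W M T \<and> (\<forall>g\<in>G. T (S g) = g)"

definition morphism_norm ::
  "'v::real_vector set \<Rightarrow> ('v \<Rightarrow> real) \<Rightarrow> ('v \<Rightarrow> real) \<Rightarrow> 'v set \<Rightarrow> ('v \<Rightarrow> 'v) \<Rightarrow> ('v \<Rightarrow> 'v) \<Rightarrow> real"
where
  "morphism_norm V N M G S T = (if G = {0} then 1 else opnorm_on G M N S * opnorm_on V N M T)"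

definition is_degree :: "('v::real_vector set \<Rightarrow> ('v \<Rightarrow> real) \<Rightarrow> 'v set \<Rightarrow> real) \<Rightarrow> bool" where
  "is_degree d \<longleftrightarrow>
     (\<forall>V N F. approx_pair V N F \<longrightarrow> 0 \<le> d V N F) \<and>
     (\<exists>K :: real \<Rightarrow> real \<Rightarrow> real.
        (\<forall>s\<ge>1. \<forall>t\<ge>0. 0 \<le> K s t) \<and>
        (\<forall>s s' t t'. 1 \<le> s \<and> s \<le> s' \<and> 0 \<le> t \<and> t \<le> t' \<longrightarrow> K s t \<le> K s' t') \<and>
        (\<forall>t\<ge>0. ((\<lambda>s. K s t) \<longlongrightarrow> t) (at_right 1)) \<and>
        (\<forall>V N F W M G S T.
           approx_pair V N F \<and> approx_pair W M G \<and> morphism V N F W M G S T \<longrightarrow>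
           d W M G \<le> K (morphism_norm V N M G S T) (d V N F)))"

definition d_small ::
  "('v::real_vector set \<Rightarrow> ('v \<Rightarrow> real) \<Rightarrow> 'v set \<Rightarrow> real) \<Rightarrow> 'v set \<Rightarrow> ('v \<Rightarrow> real) \<Rightarrow> bool"
where
  "d_small d V N \<longleftrightarrow> bdd_above {d V N F | F. fin_dim F \<and> F \<subseteq> V}"

definition d_large_subspaces ::
  "('a::banach set \<Rightarrow> ('a \<Rightarrow> real) \<Rightarrow> 'a set \<Rightarrow> real) \<Rightarrow> 'a set set"
where
  "d_large_subspaces d = {Y \<in> Sub_inf. \<not> d_small d Y norm}"

definition d_tight :: "('a::banach set \<Rightarrow> ('a \<Rightarrow> real) \<Rightarrow> 'a set \<Rightarrow> real) \<Rightarrow> bool" where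
  "d_tight d \<longleftrightarrow> H_tight (d_large_subspaces d)"

section \<open>Ergodicity\<close>

definition effros :: "'a::banach set measure" where
  "effros = sigma Sub {{Y \<in> Sub. Y \<inter> U \<noteq> {}} | U. open U}"

definition E0 :: "(nat \<Rightarrow> bool) \<Rightarrow> (nat \<Rightarrow> bool) \<Rightarrow> bool" where
  "E0 x y \<longleftrightarrow> (\<exists>n. \<forall>m\<ge>n. x m = y m)"

text \<open>
  The product \<open>\<sigma>\<close>-algebra on \<open>nat \<Rightarrow> bool\<close> is the Borel \<open>\<sigma>\<close>-algebra of the Cantor space, as the
  index set is countable and the factors are finite and discrete.
\<close>

definition ergodic :: "'a::banach itself \<Rightarrow> bool" where
  "ergodic (_ :: 'a itself) \<longleftrightarrow>
     separable_space (euclidean :: 'a topology) \<and>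
     (\<exists>f :: (nat \<Rightarrow> bool) \<Rightarrow> 'a set.
        f \<in> measurable (Pi\<^sub>M UNIV (\<lambda>_. count_space UNIV)) effros \<and>
        (\<forall>x y. E0 x y \<longleftrightarrow> isomorphic (f x) (f y)))"

end

theory Submission
  imports Defs
begin

text \<open>
  Let \<open>X\<close> be tight for the D-family \<open>H\<close>, with FDD \<open>F\<close>. Bases of the blocks \<open>F n\<close> merge into one sequence \<open>e\<close>
  with continuous coordinate functionals, and each set \<open>A\<close> of indices gives a closed subspace \<open>Y A\<close>, the
  closed span of the \<open>e j\<close> with \<open>j \<in> A\<close>. The proof finds a copy of \<open>E0\<close> inside the Cantor space of all
  \<open>A\<close>, by a category argument on the relation ``\<open>Y A\<close> embeds into \<open>Y B\<close>''.

  Most \<open>Y A\<close> belong to \<open>H\<close>. If \<open>A\<close> is cofinite then \<open>Y A\<close> has finite codimension, hence lies in \<open>H\<close>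
  with \<open>X\<close>. An Ellentuck-open set that contains \<open>Y A\<close> also contains \<open>Y B\<close> for all \<open>B \<subseteq> A\<close> which agree
  with \<open>A\<close> far enough, because a finite-dimensional subspace of \<open>Y A\<close> can be moved by a small perturbation
  of the identity into the span of finitely many \<open>e j\<close>. As \<open>H\<close> is a \<open>G\<^sub>\<delta>\<close> set, \<open>Y A \<in> H\<close> for comeagrely
  many \<open>A\<close> (\<open>D_family_residual\<close>).

  For \<open>Y A \<in> H\<close> tightness says that \<open>Y A\<close> does not embed into \<open>Y B\<close> as soon as \<open>B\<close> misses infinitely many
  members of a sequence of disjoint finite sets, which is the generic behaviour of \<open>B\<close>
  (\<open>tight_imp_meagre\<close>). So the embedding relation has meagre sections over comeagrely many points. To
  conclude that it is meagre (\<open>embeds_meagre\<close>) one needs it to have the Baire property, which it has since it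
  arises from closed sets by the Souslin operation: an embedding is coded by ever better approximations of
  its values at the \<open>e j\<close> (\<open>emb_tree_limit\<close>).

  A meagre relation on the Cantor space is avoided by a map that concatenates, according to the bits of the
  argument, one of two finite strings at each stage (\<open>meagre_E0_antihomomorphism\<close>). Inequivalent points are
  mapped outside the relation, so their spaces are not isomorphic. The two strings of a stage have the same
  number of ones, so equivalent points give index sets that differ by a finite exchange of equally many
  elements, and exchanging finitely many basis vectors is an isomorphism (\<open>isomorphic_of_finite_change\<close>).
  This proves \<open>D_family_tight_imp_ergodic\<close>.

  For a degree \<open>d\<close> it remains to see that the \<open>d\<close>-large subspaces form a D-family (\<open>D_family_d_large\<close>). The
  condition \<open>d Y F > k\<close> survives small perturbations of \<open>F\<close> and shrinking of \<open>Y\<close>, because \<open>K s k\<close> tends to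
  \<open>k\<close> as \<open>s\<close> tends to \<open>1\<close>. Adding a vector to \<open>Y\<close> does not change smallness, since the new direction can be
  simulated inside \<open>Y\<close> by a vector far from the finite-dimensional subspace in question.
\<close>

section \<open>The Hahn-Banach theorem and its finite-dimensional consequences\<close>

definition sublinear :: "('a::real_vector \<Rightarrow> real) \<Rightarrow> bool" where
  "sublinear p \<longleftrightarrow> (\<forall>x y. p (x + y) \<le> p x + p y) \<and> (\<forall>c\<ge>0. \<forall>x. p (c *\<^sub>R x) = c * p x)"

lemma sublinear_add: "sublinear p \<Longrightarrow> p (x + y) \<le> p x + p y"
  and sublinear_scale: "sublinear p \<Longrightarrow> 0 \<le> c \<Longrightarrow> p (c *\<^sub>R x) = c * p x"
  by (auto simp: sublinear_def)

lemma sublinear_zero: "sublinear p \<Longrightarrow> p 0 = 0"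
  using sublinear_scale[of p 0 0] by simp

lemma sublinear_minus: "sublinear p \<Longrightarrow> - p (- x) \<le> p x"
  using sublinear_add[of p x "- x"] sublinear_zero[of p] by simp

lemma sublinear_le_imp_ge:
  assumes "sublinear q" "\<And>x. q x \<le> p x"
  shows "- p (- x) \<le> q x"
  using sublinear_minus[OF assms(1), of x] assms(2)[of "- x"] by linarith

lemma sublinearI:
  assumes add: "\<And>x y. p (x + y) \<le> p x + p y" and zero: "p 0 = 0"
    and scale: "\<And>c x. c > 0 \<Longrightarrow> p (c *\<^sub>R x) \<le> c * p x"
  shows "sublinear p"
proof -
  have "p (c *\<^sub>R x) = c * p x" if c: "c > 0" for c x
    using scale[OF c, of x] scale[of "inverse c" "c *\<^sub>R x"] c by (simp add: field_simps)
  then have "p (c *\<^sub>R x) = c * p x" if "c \<ge> 0" for c x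
    using that zero by (cases "c = 0") auto
  then show ?thesis using add by (auto simp: sublinear_def)
qed

text \<open>
  The functional \<open>x \<mapsto> INF t\<ge>0. q (x + t y) - t q y\<close> is the largest sublinear functional below \<open>q\<close>
  with value \<open>- q y\<close> at \<open>- y\<close>. When \<open>q\<close> is minimal it must coincide with \<open>q\<close>, and the second inequality then
  reads \<open>q x + q y \<le> q (x + y)\<close>.
\<close>

lemma sublinear_collapse:
  assumes q: "sublinear q"
  shows "\<exists>r. sublinear r \<and> (\<forall>x. r x \<le> q x) \<and> (\<forall>x. r x \<le> q (x + y) - q y)"
proof -
  define h where "h x t = q (x + t *\<^sub>R y) - t * q y" for x t
  define r where "r x = (INF t\<in>{0..}. h x t)" for x
  have lb: "- q (- x) \<le> h x t" if "t \<ge> 0" for x t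
    using sublinear_add[OF q, of "x + t *\<^sub>R y" "- x"] sublinear_scale[OF q that, of y]
    by (simp add: h_def)
  have bdd: "bdd_below (h x ` {0..})" for x
    using lb by (intro bdd_belowI2[of _ "- q (- x)"]) auto
  have r_le: "r x \<le> h x t" if "t \<ge> 0" for x t
    unfolding r_def using that by (intro cINF_lower bdd) auto
  have r_ge: "c \<le> r x" if "\<And>t. t \<ge> 0 \<Longrightarrow> c \<le> h x t" for c x
    unfolding r_def using that by (intro cINF_greatest) auto
  have add: "r (x + x') \<le> r x + r x'" for x x'
  proof -
    have *: "r (x + x') \<le> h x s + h x' t" if "s \<ge> 0" "t \<ge> 0" for s t
    proof -
      have "r (x + x') \<le> h (x + x') (s + t)" using that by (intro r_le) auto
      also have "\<dots> \<le> h x s + h x' t"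
        using sublinear_add[OF q, of "x + s *\<^sub>R y" "x' + t *\<^sub>R y"]
        by (simp add: h_def algebra_simps)
      finally show ?thesis .
    qed
    have "r (x + x') - h x s \<le> r x'" if "s \<ge> 0" for s
      using *[OF that] by (intro r_ge) (simp add: algebra_simps)
    then have "r (x + x') - r x' \<le> r x" by (intro r_ge) (simp add: algebra_simps)
    then show ?thesis by simp
  qed
  have scale_le: "r (c *\<^sub>R x) \<le> c * r x" if c: "c > 0" for c x
  proof -
    have "r (c *\<^sub>R x) / c \<le> r x"
    proof (rule r_ge)
      fix t :: real assume t: "t \<ge> 0"
      have "r (c *\<^sub>R x) \<le> h (c *\<^sub>R x) (c * t)" using t c by (intro r_le) auto
      also have "\<dots> = c * h x t"
        using sublinear_scale[OF q, of c "x + t *\<^sub>R y"] c by (simp add: h_def algebra_simps)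
      finally show "r (c *\<^sub>R x) / c \<le> h x t" using c by (simp add: field_simps)
    qed
    then show ?thesis using c by (simp add: field_simps)
  qed
  have zero: "r 0 = 0"
  proof (rule antisym)
    show "r 0 \<le> 0" using r_le[of 0 0] sublinear_zero[OF q] by (simp add: h_def)
    show "0 \<le> r 0" using lb[of _ 0] sublinear_zero[OF q] by (intro r_ge) auto
  qed
  have "sublinear r" using add zero scale_le by (rule sublinearI)
  moreover have "r x \<le> q x" for x using r_le[of 0 x] by (simp add: h_def)
  moreover have "r x \<le> q (x + y) - q y" for x using r_le[of 1 x] by (simp add: h_def)
  ultimately show ?thesis by blast
qed

text \<open>
  Zorn's lemma applies downwards: the pointwise infimum of a chain is sublinear, and it is finite because
  every sublinear \<open>q \<le> p\<close> satisfies \<open>- p (- x) \<le> q x\<close>.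
\<close>

lemma minimal_sublinear:
  assumes p: "sublinear p"
  shows "\<exists>q. sublinear q \<and> (\<forall>x. q x \<le> p x) \<and>
             (\<forall>r. sublinear r \<and> (\<forall>x. r x \<le> q x) \<longrightarrow> r = q)"
proof -
  define A where "A = {q. sublinear q \<and> (\<forall>x. q x \<le> p x)}"
  define P :: "('a \<Rightarrow> real) \<Rightarrow> ('a \<Rightarrow> real) \<Rightarrow> bool" where "P q r \<longleftrightarrow> (\<forall>x. r x \<le> q x)" for q r
  have "\<exists>m\<in>A. \<forall>a\<in>A. P m a \<longrightarrow> a = m"
  proof (rule predicate_Zorn)
    show "partial_order_on A (relation_of P A)"
    proof (rule partial_order_on_relation_ofI)
      show "P a a" for a by (simp add: P_def)
      show "P a c" if "P a b" "P b c" for a b c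
        using that unfolding P_def by (meson order_trans)
      show "a = b" if "P a b" "P b a" for a b
        using that unfolding P_def by (intro ext antisym) auto
    qed
  next
    fix C assume "C \<in> Chains (relation_of P A)"
    then have CA: "C \<subseteq> A" and ch: "\<And>q r. q \<in> C \<Longrightarrow> r \<in> C \<Longrightarrow> P q r \<or> P r q"
      by (auto simp: Chains_def relation_of_def)
    show "\<exists>u\<in>A. \<forall>a\<in>C. P a u"
    proof (cases "C = {}")
      case True
      then show ?thesis using p by (auto simp: A_def)
    next
      case False
      define u where "u x = (INF q\<in>C. q x)" for x
      have sub: "sublinear q" if "q \<in> C" for q using CA that by (auto simp: A_def)
      have lb: "- p (- x) \<le> q x" if "q \<in> C" for q x
        using sublinear_le_imp_ge[of q p] CA that by (auto simp: A_def)
      have bdd: "bdd_below ((\<lambda>q. q x) ` C)" for x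
        using lb by (intro bdd_belowI2[of _ "- p (- x)"]) auto
      have u_le: "u x \<le> q x" if "q \<in> C" for x q
        unfolding u_def using that by (intro cINF_lower bdd) auto
      have u_ge: "c \<le> u x" if "\<And>q. q \<in> C \<Longrightarrow> c \<le> q x" for c x
        unfolding u_def using that False by (intro cINF_greatest) auto
      have add: "u (x + y) \<le> u x + u y" for x y
      proof -
        have *: "u (x + y) \<le> q x + r y" if q: "q \<in> C" and r: "r \<in> C" for q r
        proof -
          have "r x \<le> q x \<or> q y \<le> r y" using ch[OF q r] by (auto simp: P_def)
          then show ?thesis
            using u_le[OF q, of "x + y"] u_le[OF r, of "x + y"]
              sublinear_add[OF sub[OF q], of x y] sublinear_add[OF sub[OF r], of x y] by linarith
        qed
        have "u (x + y) - q x \<le> u y" if "q \<in> C" for q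
          using *[OF that] by (intro u_ge) (simp add: algebra_simps)
        then have "u (x + y) - u y \<le> u x" by (intro u_ge) (simp add: algebra_simps)
        then show ?thesis by simp
      qed
      obtain q where q: "q \<in> C" using False by blast
      have zero: "u 0 = 0"
      proof (rule antisym)
        show "u 0 \<le> 0" using u_le[OF q, of 0] sublinear_zero[OF sub[OF q]] by simp
        show "0 \<le> u 0" by (rule u_ge) (simp add: sublinear_zero[OF sub])
      qed
      have scale: "u (c *\<^sub>R x) \<le> c * u x" if c: "c > 0" for c x
      proof -
        have "u (c *\<^sub>R x) / c \<le> u x"
        proof (rule u_ge)
          fix q assume q: "q \<in> C"
          show "u (c *\<^sub>R x) / c \<le> q x"
            using u_le[OF q, of "c *\<^sub>R x"] sublinear_scale[OF sub[OF q] less_imp_le[OF c], of x] c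
            by (simp add: field_simps)
        qed
        then show ?thesis using c by (simp add: field_simps)
      qed
      have "q x \<le> p x" for x using CA q by (auto simp: A_def)
      then have "u x \<le> p x" for x using u_le[OF q, of x] by (meson order_trans)
      then have "u \<in> A" using sublinearI[of u] add zero scale by (simp add: A_def)
      then show ?thesis using u_le by (auto simp: P_def)
    qed
  qed
  then obtain m where m: "m \<in> A" "\<And>a. a \<in> A \<Longrightarrow> P m a \<Longrightarrow> a = m" by blast
  have mp: "sublinear m" "\<And>x. m x \<le> p x" using m(1) by (auto simp: A_def)
  have "r = m" if "sublinear r" "\<And>x. r x \<le> m x" for r
    using that mp(2) by (intro m(2)) (auto simp: A_def P_def intro: order_trans)
  then show ?thesis using mp by blast
qed

text \<open>
  Minimal sublinear functionals are linear. Collapsing \<open>p\<close> at \<open>a\<close> before minimising keeps the value \<open>p a\<close>.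
\<close>

theorem hahn_banach:
  fixes p :: "'a::real_vector \<Rightarrow> real"
  assumes p: "sublinear p"
  shows "\<exists>f. linear f \<and> (\<forall>x. f x \<le> p x) \<and> f a = p a"
proof -
  obtain p' where p': "sublinear p'" "\<And>x. p' x \<le> p x" "\<And>x. p' x \<le> p (x + a) - p a"
    using sublinear_collapse[OF p, of a] by blast
  obtain f where f: "sublinear f" "\<And>x. f x \<le> p' x"
    and min: "\<And>r. sublinear r \<Longrightarrow> (\<And>x. r x \<le> f x) \<Longrightarrow> r = f"
    using minimal_sublinear[OF p'(1)] by blast
  have add: "f (x + y) = f x + f y" for x y
  proof -
    obtain r where "sublinear r" "\<And>x. r x \<le> f x" and r: "\<And>x. r x \<le> f (x + y) - f y"
      using sublinear_collapse[OF f(1), of y] by blast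
    then have "r = f" by (intro min)
    then show ?thesis using r[of x] sublinear_add[OF f(1), of x y] by simp
  qed
  have neg: "f (- x) = - f x" for x using add[of x "- x"] sublinear_zero[OF f(1)] by simp
  have scale: "f (c *\<^sub>R x) = c *\<^sub>R f x" for c x
  proof (cases "c \<ge> 0")
    case True then show ?thesis using sublinear_scale[OF f(1)] by simp
  next
    case False
    then have "f ((- c) *\<^sub>R x) = (- c) * f x" using sublinear_scale[OF f(1), of "- c" x] by simp
    then show ?thesis using neg[of "c *\<^sub>R x"] by simp
  qed
  have "linear f" by (rule linearI) (use add scale in auto)
  moreover have "f x \<le> p x" for x using f(2)[of x] p'(2)[of x] by linarith
  moreover have "f a \<ge> p a"
    using f(2)[of "- a"] p'(3)[of "- a"] neg[of a] sublinear_zero[OF p] by simp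
  ultimately show ?thesis by (meson antisym)
qed

lemma infdist_sublinear:
  fixes M :: "'a::real_normed_vector set"
  assumes M: "subspace M"
  shows "sublinear (\<lambda>x. infdist x M)"
proof -
  have ne: "M \<noteq> {}" using subspace_0[OF M] by blast
  have ge: "c \<le> infdist x M" if "\<And>m. m \<in> M \<Longrightarrow> c \<le> dist x m" for c x
    unfolding infdist_notempty[OF ne] using that ne by (intro cINF_greatest)
  have add: "infdist (x + y) M \<le> infdist x M + infdist y M" for x y
  proof -
    have *: "infdist (x + y) M \<le> dist x m + dist y n" if "m \<in> M" "n \<in> M" for m n
      using infdist_le[OF subspace_add[OF M that], of "x + y"] dist_triangle_add[of x y m n] by linarith
    have "infdist (x + y) M - dist x m \<le> infdist y M" if "m \<in> M" for m
      using *[OF that] by (intro ge) (simp add: algebra_simps)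
    then have "infdist (x + y) M - infdist y M \<le> infdist x M"
      by (intro ge) (simp add: algebra_simps)
    then show ?thesis by simp
  qed
  have scale_le: "infdist (c *\<^sub>R x) M \<le> c * infdist x M" if c: "c > 0" for c x
  proof -
    have "infdist (c *\<^sub>R x) M / c \<le> infdist x M"
    proof (rule ge)
      fix m assume "m \<in> M"
      then have "infdist (c *\<^sub>R x) M \<le> dist (c *\<^sub>R x) (c *\<^sub>R m)"
        by (intro infdist_le subspace_scale[OF M])
      then show "infdist (c *\<^sub>R x) M / c \<le> dist x m"
        using c by (simp add: dist_norm flip: scaleR_diff_right) (simp add: field_simps)
    qed
    then show ?thesis using c by (simp add: field_simps)
  qed
  show ?thesis using subspace_0[OF M] by (intro sublinearI add scale_le) auto
qed

lemma functional_attaining_distance: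
  fixes M :: "'a::real_normed_vector set"
  assumes M: "subspace M"
  obtains f :: "'a \<Rightarrow> real" where "bounded_linear f" "\<And>x. \<bar>f x\<bar> \<le> norm x"
    "\<And>x. x \<in> M \<Longrightarrow> f x = 0" "f a = infdist a M"
proof -
  obtain f :: "'a \<Rightarrow> real" where lin: "linear f" and le: "\<And>x. f x \<le> infdist x M" and a: "f a = infdist a M"
    using hahn_banach[OF infdist_sublinear[OF M], of a] by blast
  have neg: "f (- x) = - f x" for x using linear_neg[OF lin] .
  have inf: "infdist x M \<le> norm x" for x
    using infdist_le[OF subspace_0[OF M], of x] by simp
  have bd: "\<bar>f x\<bar> \<le> norm x" for x
    using le[of x] le[of "- x"] inf[of x] inf[of "- x"] by (simp add: neg)
  have "f x = 0" if "x \<in> M" for x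
    using le[of x] le[of "- x"] subspace_neg[OF M that] that by (simp add: neg)
  moreover have "bounded_linear f"
    using lin bd by (intro bounded_linear.intro) (auto simp: bounded_linear_axioms_def intro!: exI[of _ 1])
  ultimately show ?thesis using that bd a by blast
qed

text \<open>
  The same functional, normalised at \<open>v\<close>; the distance of \<open>v\<close> to the closed subspace \<open>M\<close> is positive.
\<close>

lemma separating_functional:
  fixes M :: "'a::real_normed_vector set"
  assumes M: "subspace M" "closed M" and v: "v \<notin> M"
  obtains f :: "'a \<Rightarrow> real" where "bounded_linear f" "\<And>x. x \<in> M \<Longrightarrow> f x = 0" "f v = 1"
proof -
  obtain f :: "'a \<Rightarrow> real" where f: "bounded_linear f" "\<And>x. x \<in> M \<Longrightarrow> f x = 0" "f v = infdist v M"
    using functional_attaining_distance[OF M(1), of v] by metis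
  have pos: "infdist v M > 0"
    using infdist_pos_not_in_closed[OF M(2) _ v] subspace_0[OF M(1)] by blast
  have "bounded_linear (\<lambda>x. f x / infdist v M)"
    by (rule bounded_linear_compose[OF bounded_linear_divide f(1)])
  then show ?thesis
    by (rule that) (use f pos in simp_all)
qed

text \<open>
  With \<open>f\<close> vanishing on \<open>M\<close> and \<open>f v = 1\<close>, the span is the preimage of \<open>M\<close> under the continuous map
  \<open>x \<mapsto> x - f x v\<close>.
\<close>

lemma closed_span_insert:
  fixes M :: "'a::real_normed_vector set"
  assumes M: "subspace M" "closed M"
  shows "closed (span (insert v M))"
proof (cases "v \<in> M")
  case True
  then show ?thesis using M by (simp add: insert_absorb span_eq_iff[THEN iffD2])
next
  case False
  obtain f :: "'a \<Rightarrow> real" where f: "bounded_linear f" "\<And>x. x \<in> M \<Longrightarrow> f x = 0" "f v = 1"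
    using separating_functional[OF M False] by metis
  interpret f: bounded_linear f by (rule f(1))
  have "span (insert v M) = (\<lambda>x. x - f x *\<^sub>R v) -` M"
  proof (intro set_eqI iffI)
    fix x assume "x \<in> span (insert v M)"
    then obtain k where k: "x - k *\<^sub>R v \<in> M"
      using span_breakdown_eq[of x v M] M(1) by (auto simp: span_eq_iff[THEN iffD2])
    then have "f (x - k *\<^sub>R v) = 0" by (rule f(2))
    then have "f x = k" by (simp add: f.diff f.scaleR f(3))
    then show "x \<in> (\<lambda>x. x - f x *\<^sub>R v) -` M" using k by simp
  next
    fix x assume "x \<in> (\<lambda>x. x - f x *\<^sub>R v) -` M"
    then show "x \<in> span (insert v M)"
      using span_breakdown_eq[of x v M] M(1) by (auto simp: span_eq_iff[THEN iffD2])
  qed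
  moreover have "continuous_on UNIV (\<lambda>x. x - f x *\<^sub>R v)"
    by (intro continuous_intros f.continuous_on)
  ultimately show ?thesis using closed_vimage[OF M(2)] by simp
qed

lemma closed_span_finite:
  fixes B :: "'a::real_normed_vector set"
  assumes "finite B"
  shows "closed (span B)"
  using assms
proof (induction B)
  case (insert v B)
  have "span (insert v (span B)) = span (insert v B)"
    by (simp add: span_insert span_span)
  then show ?case using closed_span_insert[OF subspace_span insert.IH, of v] by simp
qed simp

lemma fin_dim_closed: "fin_dim F \<Longrightarrow> closed (F :: 'a::real_normed_vector set)"
  using closed_span_finite by (auto simp: fin_dim_def)

lemma fin_dim_subspace: "fin_dim F \<Longrightarrow> subspace F"
  by (auto simp: fin_dim_def)

lemma fin_dim_in_Sub: "fin_dim F \<Longrightarrow> (F :: 'a::banach set) \<in> Sub"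
  by (simp add: Sub_def fin_dim_closed fin_dim_subspace)

section \<open>Continuity of the coordinate projections of an FDD\<close>

context
  fixes F :: "nat \<Rightarrow> 'a::banach set"
  assumes FDD: "is_FDD F"
begin

definition fdd_coord :: "nat \<Rightarrow> 'a \<Rightarrow> 'a" where
  "fdd_coord n x = (THE xs. (\<forall>n. xs n \<in> F n) \<and> xs sums x) n"

lemma FDD_subspace: "subspace (F n)" and FDD_closed: "closed (F n)"
  using FDD fin_dim_subspace fin_dim_closed by (auto simp: is_FDD_def)

lemma fdd_coord_in: "fdd_coord n x \<in> F n"
  and fdd_coord_sums: "(\<lambda>n. fdd_coord n x) sums x"
proof -
  have "\<exists>!xs. (\<forall>n. xs n \<in> F n) \<and> xs sums x" using FDD unfolding is_FDD_def by metis
  from theI'[OF this] show "fdd_coord n x \<in> F n" "(\<lambda>n. fdd_coord n x) sums x"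
    by (auto simp: fdd_coord_def)
qed

lemma fdd_coord_unique:
  assumes "\<And>n. xs n \<in> F n" "xs sums x"
  shows "fdd_coord n x = xs n"
proof -
  have "\<exists>!xs. (\<forall>n. xs n \<in> F n) \<and> xs sums x" using FDD unfolding is_FDD_def by metis
  then have "(THE xs. (\<forall>n. xs n \<in> F n) \<and> xs sums x) = xs"
    using assms by (intro the1_equality) auto
  then show ?thesis by (simp add: fdd_coord_def)
qed

lemma fdd_coord_add: "fdd_coord n (x + y) = fdd_coord n x + fdd_coord n y"
  by (rule fdd_coord_unique)
     (auto intro: subspace_add FDD_subspace fdd_coord_in sums_add fdd_coord_sums)

lemma fdd_coord_scaleR: "fdd_coord n (c *\<^sub>R x) = c *\<^sub>R fdd_coord n x"
  by (rule fdd_coord_unique)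
     (auto intro: subspace_scale FDD_subspace fdd_coord_in sums_scaleR_right fdd_coord_sums)

lemma fdd_coord_diff: "fdd_coord n (x - y) = fdd_coord n x - fdd_coord n y"
  using fdd_coord_add[of n x "(-1) *\<^sub>R y"] fdd_coord_scaleR[of n "-1" y] by simp

definition fdd_partial :: "nat \<Rightarrow> 'a \<Rightarrow> 'a" where
  "fdd_partial N x = (\<Sum>n<N. fdd_coord n x)"

lemma fdd_partial_tendsto: "(\<lambda>N. fdd_partial N x) \<longlonglongrightarrow> x"
  using fdd_coord_sums[of x] by (simp add: sums_def fdd_partial_def)

lemma fdd_partial_scaleR: "fdd_partial N (c *\<^sub>R x) = c *\<^sub>R fdd_partial N x"
  and fdd_partial_diff: "fdd_partial N (x - y) = fdd_partial N x - fdd_partial N y"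
  by (simp_all add: fdd_partial_def fdd_coord_scaleR fdd_coord_diff scaleR_sum_right sum_subtractf)

text \<open>
  Every vector has bounded partial sums, so by the Baire category theorem the vectors whose partial sums are
  bounded by some \<open>k\<close> are dense in a ball. Differences of such vectors are dense in a ball around \<open>0\<close>, and
  scaling gives approximation of every vector with partial sums controlled by its norm.
\<close>

lemma fdd_dense_bounded:
  obtains M where "M > 0"
    "\<And>y e. e > 0 \<Longrightarrow> \<exists>v. norm (y - v) < e \<and> (\<forall>N. norm (fdd_partial N v) \<le> M * norm y)"
proof -
  define V where "V k = {x. \<forall>N. norm (fdd_partial N x) \<le> real k}" for k :: nat
  have "\<exists>k. x \<in> V k" for x
  proof -
    have "Bseq (\<lambda>N. fdd_partial N x)"
      using fdd_partial_tendsto[of x] convergentI convergent_imp_Bseq by blast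
    then obtain K where "\<And>N. norm (fdd_partial N x) \<le> K" by (auto simp: Bseq_def)
    moreover obtain k :: nat where "K \<le> real k" using real_arch_simple by blast
    ultimately show ?thesis unfolding V_def by (auto intro: order_trans)
  qed
  then have cover: "(\<Union>k. closure (V k)) = UNIV"
    using closure_subset by blast
  have "\<exists>k. interior (closure (V k)) \<noteq> {}"
  proof (rule ccontr)
    assume "\<not> ?thesis"
    then have "(euclidean :: 'a topology) interior_of \<Union>(range (\<lambda>k. closure (V k))) = {}"
      by (intro Baire_category_alt) (auto simp: completely_metrizable_space_euclidean)
    then show False using cover by simp
  qed
  then obtain k x0 where "x0 \<in> interior (closure (V k))" by blast
  then obtain r where r: "r > 0" "ball x0 r \<subseteq> closure (V k)"
    by (meson mem_interior)
  have small: "\<exists>v. norm (y - v) < e \<and> (\<forall>N. norm (fdd_partial N v) \<le> 2 * real k)"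
    if y: "norm y < r" and e: "e > 0" for y e
  proof -
    have "x0 \<in> closure (V k)" "x0 + y \<in> closure (V k)"
      using r y by (auto simp: dist_norm)
    then obtain a b where ab: "a \<in> V k" "dist a x0 < e/2" "b \<in> V k" "dist b (x0 + y) < e/2"
      using e by (meson closure_approachable half_gt_zero)
    have "norm (y - (b - a)) = norm ((x0 + y - b) + (a - x0))" by (simp add: algebra_simps)
    also have "\<dots> \<le> dist b (x0 + y) + dist a x0"
      by (metis dist_norm norm_minus_commute norm_triangle_ineq)
    finally have "norm (y - (b - a)) < e" using ab by simp
    moreover have "norm (fdd_partial N (b - a)) \<le> 2 * real k" for N
    proof -
      have "norm (fdd_partial N (b - a)) \<le> norm (fdd_partial N b) + norm (fdd_partial N a)"
        unfolding fdd_partial_diff by (rule norm_triangle_ineq4)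
      also have "\<dots> \<le> real k + real k" using ab by (intro add_mono) (auto simp: V_def)
      finally show ?thesis by simp
    qed
    ultimately show ?thesis by blast
  qed
  define M where "M = (2 * real k + 1) * 2 / r"
  show ?thesis
  proof (rule that)
    show "M > 0" using r by (simp add: M_def)
    fix y :: 'a and e :: real assume e: "e > 0"
    show "\<exists>v. norm (y - v) < e \<and> (\<forall>N. norm (fdd_partial N v) \<le> M * norm y)"
    proof (cases "y = 0")
      case True
      have "fdd_partial N 0 = 0" for N using fdd_partial_scaleR[of N 0 0] by simp
      then show ?thesis using True e by (intro exI[of _ 0]) auto
    next
      case False
      define c where "c = r / (2 * norm y)"
      have c: "c > 0" using r False by (simp add: c_def)
      have "norm (c *\<^sub>R y) < r" using r False by (simp add: c_def)
      then obtain w where w: "norm (c *\<^sub>R y - w) < c * e" "\<And>N. norm (fdd_partial N w) \<le> 2 * real k"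
        using small[of "c *\<^sub>R y" "c * e"] c e by auto
      define v where "v = w /\<^sub>R c"
      have wv: "w = c *\<^sub>R v" using c by (simp add: v_def)
      have "c * norm (y - v) < c * e"
        using w(1) c unfolding wv by (metis norm_scaleR scaleR_diff_right abs_of_pos)
      moreover have "norm (fdd_partial N v) \<le> M * norm y" for N
      proof -
        have "norm (fdd_partial N v) = norm (fdd_partial N w) / c"
          using c by (simp add: v_def fdd_partial_scaleR field_simps)
        also have "\<dots> \<le> (2 * real k + 1) / c"
          using w(2)[of N] c by (intro divide_right_mono) auto
        also have "\<dots> = M * norm y" using False by (simp add: c_def M_def)
        finally show ?thesis .
      qed
      ultimately show ?thesis using c by auto
    qed
  qed
qed

text \<open>
  As in the open mapping theorem, the approximation is iterated: \<open>y\<close> is the sum of vectors \<open>v k\<close> whose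
  partial sums decay geometrically. Adding up the components of the \<open>v k\<close> block by block gives an expansion
  of \<open>y\<close> along the FDD, and by uniqueness it is the expansion of \<open>y\<close>; the bound is inherited.
\<close>

theorem bounded_linear_fdd_coord: "bounded_linear (fdd_coord n)"
proof -
  obtain M where M: "M > 0" and approx:
    "\<And>y e. e > 0 \<Longrightarrow> \<exists>v. norm (y - v) < e \<and> (\<forall>N. norm (fdd_partial N v) \<le> M * norm y)"
    using fdd_dense_bounded by metis
  have coord_le: "norm (fdd_coord m v) \<le> 2 * B" if "\<And>N. norm (fdd_partial N v) \<le> B" for m v B
  proof -
    have "fdd_coord m v = fdd_partial (Suc m) v - fdd_partial m v" by (simp add: fdd_partial_def)
    also have "norm \<dots> \<le> norm (fdd_partial (Suc m) v) + norm (fdd_partial m v)"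
      by (rule norm_triangle_ineq4)
    also have "\<dots> \<le> B + B" using that by (intro add_mono)
    finally show ?thesis by simp
  qed
  have bound: "norm (fdd_coord n y) \<le> 4 * M * norm y" for y
  proof (cases "y = 0")
    case True
    then show ?thesis using fdd_coord_scaleR[of n 0 0] by simp
  next
    case y0: False
    define g where "g z k = (SOME v. norm (z - v) < norm y * (1/2) ^ Suc k \<and>
                                     (\<forall>N. norm (fdd_partial N v) \<le> M * norm z))" for z k
    have g: "norm (z - g z k) < norm y * (1/2) ^ Suc k" "norm (fdd_partial N (g z k)) \<le> M * norm z"
      for z k N
      using someI_ex[OF approx[of "norm y * (1/2) ^ Suc k" z]] y0 unfolding g_def by auto
    define r where "r = rec_nat y (\<lambda>k z. z - g z k)"
    have r_0: "r 0 = y" and r_Suc: "r (Suc k) = r k - g (r k) k" for k by (simp_all add: r_def)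
    define v where "v k = g (r k) k" for k
    have r_le: "norm (r k) \<le> norm y * (1/2) ^ k" for k
      by (cases k) (use g(1) in \<open>auto simp: r_0 r_Suc intro: less_imp_le\<close>)
    have v_le: "norm (fdd_partial N (v k)) \<le> M * norm y * (1/2) ^ k" for N k
    proof -
      have "norm (fdd_partial N (v k)) \<le> M * norm (r k)" unfolding v_def by (rule g(2))
      also have "\<dots> \<le> M * (norm y * (1/2) ^ k)" using r_le[of k] M by (intro mult_left_mono) auto
      finally show ?thesis by (simp add: algebra_simps)
    qed
    have "(\<Sum>i<k. v i) = y - r k" for k
      by (induction k) (simp_all add: r_0 r_Suc v_def)
    moreover have "r \<longlonglongrightarrow> 0"
    proof (rule tendsto_norm_zero_cancel, rule tendsto_sandwich[OF _ _ tendsto_const])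
      show "(\<lambda>k. norm y * (1/2) ^ k) \<longlonglongrightarrow> 0"
        by (intro tendsto_mult_right_zero LIMSEQ_realpow_zero) auto
    qed (use r_le in auto)
    ultimately have v_sums: "v sums y"
      unfolding sums_def by (simp, intro tendsto_eq_intros) auto
    have geo: "(\<lambda>k. c * (1/2) ^ k) sums (c * 2)" for c :: real
      using sums_mult[OF geometric_sums[of "1/2 :: real"], of c] by simp
    define z where "z m = (\<Sum>k. fdd_coord m (v k))" for m
    have c_le: "norm (fdd_coord m (v k)) \<le> (2 * M * norm y) * (1/2) ^ k" for m k
      using coord_le[OF v_le, of m k] by (simp add: algebra_simps)
    have c_summable_norm: "summable (\<lambda>k. norm (fdd_coord m (v k)))" for m
      by (rule summable_comparison_test'[OF sums_summable[OF geo[of "2 * M * norm y"]], of 0])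
         (use c_le in simp)
    have c_summable: "summable (\<lambda>k. fdd_coord m (v k))" for m
      by (rule summable_norm_cancel[OF c_summable_norm])
    have z_in: "z m \<in> F m" for m
    proof (rule closed_sequentially[OF FDD_closed])
      show "(\<Sum>k<K. fdd_coord m (v k)) \<in> F m" for K
        by (intro subspace_sum FDD_subspace fdd_coord_in)
      show "(\<lambda>K. \<Sum>k<K. fdd_coord m (v k)) \<longlonglongrightarrow> z m"
        unfolding z_def by (rule summable_LIMSEQ[OF c_summable])
    qed
    have "z sums y"
    proof -
      have part: "(\<Sum>m<N. z m) = (\<Sum>k. fdd_partial N (v k))" for N
        unfolding z_def fdd_partial_def by (rule suminf_sum[symmetric]) (rule c_summable)
      (* The error after N blocks is a series of terms that tend to 0 for each k, dominated uniformly
         in N by a geometric series, so it tends to 0 by Tannery's theorem. *)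
      define a where "a k N = norm (fdd_partial N (v k) - v k)" for k N
      have a_le: "a k N \<le> (2 * (M * norm y)) * (1/2) ^ k" for k N
      proof -
        have "norm (v k) \<le> M * norm y * (1/2) ^ k"
          by (rule LIMSEQ_le_const2[OF tendsto_norm[OF fdd_partial_tendsto]]) (use v_le in auto)
        moreover have "a k N \<le> norm (fdd_partial N (v k)) + norm (v k)"
          unfolding a_def by (rule norm_triangle_ineq4)
        ultimately show ?thesis using v_le[of N k] by linarith
      qed
      have geo': "summable (\<lambda>k. (2 * (M * norm y)) * (1/2) ^ k)" by (rule sums_summable[OF geo])
      have a_nonneg: "0 \<le> a k N" for k N by (simp add: a_def)
      have a_summable: "summable (\<lambda>k. a k N)" for N
        by (rule summable_comparison_test'[OF geo', of 0]) (use a_le a_nonneg in simp)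
      have "((\<lambda>N. \<Sum>k. a k N) \<longlongrightarrow> (\<Sum>k. 0)) sequentially"
      proof (rule tannerys_theorem[THEN conjunct2, THEN conjunct2])
        show "((\<lambda>N. a k N) \<longlongrightarrow> 0) sequentially" for k
          unfolding a_def by (intro tendsto_norm_zero LIM_zero fdd_partial_tendsto)
        show "summable (\<lambda>k. (2 * (M * norm y)) * (1/2) ^ k)" by (rule geo')
        show "\<forall>\<^sub>F (k, N) in at_top \<times>\<^sub>F sequentially. norm (a k N) \<le> (2 * (M * norm y)) * (1/2) ^ k"
          using a_le a_nonneg by (intro always_eventually) auto
      qed auto
      then have lim: "(\<lambda>N. \<Sum>k. a k N) \<longlonglongrightarrow> 0" by simp
      have "norm ((\<Sum>m<N. z m) - y) \<le> (\<Sum>k. a k N)" for N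
      proof -
        have "summable (\<lambda>k. fdd_partial N (v k))"
          unfolding fdd_partial_def by (rule summable_sum) (rule c_summable)
        then have "(\<Sum>m<N. z m) - y = (\<Sum>k. fdd_partial N (v k) - v k)"
          using suminf_diff[OF _ sums_summable[OF v_sums]] sums_unique[OF v_sums] by (simp add: part)
        also have "norm \<dots> \<le> (\<Sum>k. a k N)"
          unfolding a_def by (rule summable_norm) (use a_summable[of N] in \<open>simp add: a_def\<close>)
        finally show ?thesis .
      qed
      then have "(\<lambda>N. norm ((\<Sum>m<N. z m) - y)) \<longlonglongrightarrow> 0"
        by (intro tendsto_sandwich[OF _ _ tendsto_const lim]) auto
      then show ?thesis unfolding sums_def using LIM_zero_cancel tendsto_norm_zero_iff by blast
    qed
    then have "fdd_coord n y = z n" by (intro fdd_coord_unique z_in)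
    also have "norm (z n) \<le> (\<Sum>k. norm (fdd_coord n (v k)))"
      unfolding z_def by (rule summable_norm[OF c_summable_norm])
    also have "\<dots> \<le> 2 * M * norm y * 2"
      using geo[of "2 * M * norm y"] c_le
      by (metis c_summable_norm suminf_le sums_summable sums_unique)
    finally show ?thesis by simp
  qed
  show ?thesis
    by (rule bounded_linear_intro[OF fdd_coord_add fdd_coord_scaleR, of _ "4 * M"])
       (use bound in \<open>simp add: mult.commute\<close>)
qed

end

section \<open>Strong Markushevich bases\<close>

text \<open>
  A strong Markushevich basis: a biorthogonal system in which every vector lies in the closed span of the
  basis vectors on its support. In contrast to a Schauder basis this does not depend on the order of the
  basis vectors, so that bases of the blocks of an FDD can be merged in any enumeration, and the spaces
  \<open>Y A\<close> below have a closed description by coordinates.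
\<close>

locale strong_mbasis =
  fixes e :: "nat \<Rightarrow> 'a::banach" and \<phi> :: "nat \<Rightarrow> 'a \<Rightarrow> real"
  assumes bounded_linear_coord: "bounded_linear (\<phi> j)"
    and biorthogonal: "\<phi> i (e j) = (if i = j then 1 else 0)"
    and strong: "x \<in> closure (span (e ` {j. \<phi> j x \<noteq> 0}))"
begin

lemma coord_add: "\<phi> j (x + y) = \<phi> j x + \<phi> j y"
  and coord_diff: "\<phi> j (x - y) = \<phi> j x - \<phi> j y"
  and coord_scaleR: "\<phi> j (c *\<^sub>R x) = c * \<phi> j x"
  and coord_zero: "\<phi> j 0 = 0"
  and coord_sum: "\<phi> j (\<Sum>i\<in>S. g i) = (\<Sum>i\<in>S. \<phi> j (g i))"
proof -
  interpret bounded_linear "\<phi> j" by (rule bounded_linear_coord)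
  show "\<phi> j (x + y) = \<phi> j x + \<phi> j y" "\<phi> j (x - y) = \<phi> j x - \<phi> j y"
    "\<phi> j (c *\<^sub>R x) = c * \<phi> j x" "\<phi> j 0 = 0" "\<phi> j (\<Sum>i\<in>S. g i) = (\<Sum>i\<in>S. \<phi> j (g i))"
    by (simp_all add: add diff scaleR zero sum)
qed

lemma coord_finite_sum:
  assumes "finite S"
  shows "\<phi> j (\<Sum>i\<in>S. c i *\<^sub>R e i) = (if j \<in> S then c j else 0)"
proof -
  have "(\<Sum>i\<in>S. c i * \<phi> j (e i)) = (\<Sum>i\<in>S. if i = j then c j else 0)"
    by (intro sum.cong) (auto simp: biorthogonal)
  then show ?thesis using assms by (simp add: coord_sum coord_scaleR)
qed

lemma coord_tendsto: "X \<longlonglongrightarrow> x \<Longrightarrow> (\<lambda>n. \<phi> j (X n)) \<longlonglongrightarrow> \<phi> j x"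
  by (rule bounded_linear.tendsto[OF bounded_linear_coord])

definition Y :: "nat set \<Rightarrow> 'a set" where
  "Y A = {x. \<forall>j. j \<notin> A \<longrightarrow> \<phi> j x = 0}"

lemma in_Y: "x \<in> Y A \<longleftrightarrow> (\<forall>j. j \<notin> A \<longrightarrow> \<phi> j x = 0)"
  by (simp add: Y_def)

lemma Y_mono: "A \<subseteq> B \<Longrightarrow> Y A \<subseteq> Y B"
  unfolding Y_def by blast

lemma Y_UNIV: "Y UNIV = UNIV"
  by (auto simp: in_Y)

lemma subspace_Y: "subspace (Y A)"
  by (auto simp: subspace_def in_Y coord_add coord_scaleR coord_zero)

lemma closed_Y: "closed (Y A)"
proof -
  have "Y A = (\<Inter>j\<in>-A. {x. \<phi> j x = 0})" by (auto simp: in_Y)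
  moreover have "closed {x. \<phi> j x = 0}" for j
    by (intro closed_Collect_eq continuous_intros bounded_linear.continuous_on[OF bounded_linear_coord])
  ultimately show ?thesis by auto
qed

lemma Y_in_Sub: "Y A \<in> Sub"
  by (simp add: Sub_def subspace_Y closed_Y)

lemma e_in_Y: "e j \<in> Y A \<longleftrightarrow> j \<in> A"
  by (auto simp: in_Y biorthogonal)

lemma Y_eq_closure_span: "Y A = closure (span (e ` A))"
proof
  show "Y A \<subseteq> closure (span (e ` A))"
  proof
    fix x assume "x \<in> Y A"
    then have "span (e ` {j. \<phi> j x \<noteq> 0}) \<subseteq> span (e ` A)"
      by (intro span_mono image_mono) (auto simp: in_Y)
    then show "x \<in> closure (span (e ` A))" using strong[of x] closure_mono by blast
  qed
  show "closure (span (e ` A)) \<subseteq> Y A"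
    by (intro closure_minimal closed_Y span_minimal subspace_Y) (auto simp: e_in_Y)
qed

lemma coords_zero_imp_zero:
  assumes "\<And>j. \<phi> j x = 0"
  shows "x = 0"
  using strong[of x] assms by simp

lemma inj_e: "inj e"
  by (rule injI) (metis biorthogonal zero_neq_one)


end

context
  fixes F :: "nat \<Rightarrow> 'a::banach set"
  assumes FDD: "is_FDD F"
begin

lemma fdd_coord_of_component:
  assumes "x \<in> F m"
  shows "fdd_coord F n x = (if n = m then x else 0)"
proof -
  have "(\<lambda>n. if n = m then x else 0) sums x"
    using sums_single[of m "\<lambda>_. x"] by (simp cong: if_cong)
  then show ?thesis
    using assms subspace_0[OF FDD_subspace[OF FDD]]
    by (intro fdd_coord_unique[OF FDD]) auto
qed

lemma FDD_component_basis:
  obtains B where "finite B" "independent B" "span B = F n" "B \<noteq> {}"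
proof -
  have n: "fin_dim (F n)" "F n \<noteq> {0}" using FDD by (auto simp: is_FDD_def)
  then obtain C where C: "finite C" "F n = span C" by (auto simp: fin_dim_def)
  obtain B where B: "B \<subseteq> C" "independent B" "C \<subseteq> span B"
    using maximal_independent_subset[of C] by metis
  have "span B = F n"
    unfolding C(2) using B by (intro antisym span_minimal subspace_span) (auto intro: span_base)
  moreover have "B \<noteq> {}" using n(2) \<open>span B = F n\<close> by (metis span_empty)
  ultimately show ?thesis using that B C finite_subset by blast
qed

text \<open>
  The functional of a basis vector \<open>b\<close> of the block \<open>F n\<close> is the projection onto \<open>F n\<close> followed by a
  Hahn-Banach functional that is dual to \<open>b\<close> within the basis of \<open>F n\<close>. The map \<open>blk\<close> tells the block of a
  basis vector.
\<close>

theorem FDD_strong_mbasis: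
  obtains e \<phi> blk where "strong_mbasis e \<phi>" "\<And>j. e j \<in> F (blk j)" "\<And>n. finite {j. blk j = n}"
proof -
  have "\<forall>n. \<exists>B. finite B \<and> independent B \<and> span B = F n \<and> B \<noteq> {}"
    using FDD_component_basis by metis
  then obtain B where B: "\<And>n. finite (B n)" "\<And>n. independent (B n)" "\<And>n. span (B n) = F n" "\<And>n. B n \<noteq> {}"
    by metis
  have BF: "b \<in> F n" if "b \<in> B n" for b n using B(3)[of n] span_superset that by blast
  have nz: "b \<noteq> 0" if "b \<in> B n" for b n using B(2)[of n] that dependent_zero by blast
  have disj: "n = m" if "b \<in> B n" "b \<in> B m" for b n m
    using fdd_coord_of_component[OF BF[OF that(1)], of n] fdd_coord_of_component[OF BF[OF that(2)], of n]
      nz[OF that(1)] by (auto split: if_splits)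
  define E where "E = (\<Union>n. B n)"
  have cE: "countable E" unfolding E_def using B(1) by (intro countable_UN) (auto intro: countable_finite)
  have "infinite E"
  proof
    assume fin: "finite E"
    have "\<forall>n. \<exists>b. b \<in> B n" using B(4) by blast
    then obtain b where b: "\<And>n. b n \<in> B n" by metis
    have "inj b" by (rule injI) (metis b disj)
    moreover have "range b \<subseteq> E" using b by (auto simp: E_def)
    ultimately show False using fin finite_subset infinite_UNIV_nat finite_imageD by metis
  qed
  define e where "e = from_nat_into E"
  have bij: "bij_betw e UNIV E" unfolding e_def by (rule bij_betw_from_nat_into) fact+
  have inj: "e i = e j \<longleftrightarrow> i = j" for i j using bij by (auto simp: bij_betw_def inj_def)
  have "\<forall>j. \<exists>n. e j \<in> B n" using bij by (auto simp: bij_betw_def E_def)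
  then obtain blk where blk: "\<And>j. e j \<in> B (blk j)" by metis
  have "\<exists>f :: 'a \<Rightarrow> real. bounded_linear f \<and> (\<forall>x\<in>span (B (blk j) - {e j}). f x = 0) \<and> f (e j) = 1" for j
  proof -
    have "closed (span (B (blk j) - {e j}))" using B(1) by (intro closed_span_finite) auto
    moreover have "e j \<notin> span (B (blk j) - {e j})" using B(2) blk by (auto simp: dependent_def)
    ultimately show ?thesis
      using separating_functional[OF subspace_span, of "B (blk j) - {e j}" "e j"] by metis
  qed
  then obtain \<psi> :: "nat \<Rightarrow> 'a \<Rightarrow> real" where \<psi>: "\<And>j. bounded_linear (\<psi> j)"
    "\<And>j x. x \<in> span (B (blk j) - {e j}) \<Longrightarrow> \<psi> j x = 0" "\<And>j. \<psi> j (e j) = 1" by metis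
  define \<phi> where "\<phi> j x = \<psi> j (fdd_coord F (blk j) x)" for j x
  have same_block: "\<psi> i (e j) = (if i = j then 1 else 0)" if "blk i = blk j" for i j
  proof (cases "i = j")
    case False
    then have "e j \<in> B (blk i) - {e i}" using blk[of j] that inj by auto
    then show ?thesis using False \<psi>(2) span_base by metis
  qed (simp add: \<psi>(3))
  have "strong_mbasis e \<phi>"
  proof (rule strong_mbasis.intro)
    show "bounded_linear (\<phi> j)" for j
      unfolding \<phi>_def by (rule bounded_linear_compose[OF \<psi>(1) bounded_linear_fdd_coord[OF FDD]])
    show "\<phi> i (e j) = (if i = j then 1 else 0)" for i j
      using fdd_coord_of_component[OF BF[OF blk[of j]], of "blk i"] same_block[of i j]
        linear_0[OF bounded_linear.linear[OF \<psi>(1)], of i] by (auto simp: \<phi>_def)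
  next
    fix x
    have "fdd_coord F n x \<in> span (e ` {j. \<phi> j x \<noteq> 0})" for n
    proof -
      define v where "v = fdd_coord F n x"
      have "v \<in> span (B n)" using B(3) fdd_coord_in[OF FDD] by (simp add: v_def)
      then obtain u where u: "v = (\<Sum>b\<in>B n. u b *\<^sub>R b)" by (auto simp: span_finite[OF B(1)])
      have "u b *\<^sub>R b \<in> span (e ` {j. \<phi> j x \<noteq> 0})" if b: "b \<in> B n" for b
      proof -
        have "b \<in> range e" using b bij unfolding bij_betw_def E_def by blast
        then obtain j where j: "b = e j" by blast
        then have n: "blk j = n" using b blk disj by blast
        interpret \<psi>j: bounded_linear "\<psi> j" by (rule \<psi>(1))
        have "\<phi> j x = (\<Sum>b'\<in>B n. u b' * \<psi> j b')"
          unfolding \<phi>_def n v_def[symmetric] u by (simp add: \<psi>j.sum \<psi>j.scaleR)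
        also have "\<dots> = (\<Sum>b'\<in>B n. if b' = b then u b else 0)"
          using \<psi>(2)[of _ j] \<psi>(3)[of j] j n by (intro sum.cong) (auto intro: span_base)
        also have "\<dots> = u b" using b B(1)[of n] by simp
        finally have "\<phi> j x = u b" .
        then show ?thesis
        proof (cases "u b = 0")
          case False
          then have "b \<in> e ` {j. \<phi> j x \<noteq> 0}" using \<open>\<phi> j x = u b\<close> j by auto
          then show ?thesis by (intro span_scale span_base)
        qed (simp add: span_zero)
      qed
      then show ?thesis unfolding v_def[symmetric] u by (intro span_sum)
    qed
    then have "(\<Sum>n<N. fdd_coord F n x) \<in> span (e ` {j. \<phi> j x \<noteq> 0})" for N
      by (intro span_sum)
    moreover have "(\<lambda>N. \<Sum>n<N. fdd_coord F n x) \<longlonglongrightarrow> x"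
      using fdd_coord_sums[OF FDD, of x] by (simp add: sums_def)
    ultimately show "x \<in> closure (span (e ` {j. \<phi> j x \<noteq> 0}))"
      unfolding closure_sequential by (intro exI[of _ "\<lambda>N. \<Sum>n<N. fdd_coord F n x"]) auto
  qed
  moreover have "e j \<in> F (blk j)" for j by (rule BF[OF blk])
  moreover have "finite {j. blk j = n}" for n
  proof (rule finite_imageD)
    show "finite (e ` {j. blk j = n})"
      using blk by (intro finite_subset[OF _ B(1)[of n]]) auto
    show "inj_on e {j. blk j = n}" using inj by (auto intro: inj_onI)
  qed
  ultimately show ?thesis by (rule that)
qed

end

section \<open>Isomorphisms, perturbations and Ellentuck-open sets\<close>

text \<open>
  The isomorphisms between subspaces are functions on the whole type that are arbitrary off their domain, so
  linearity has to be relativised.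
\<close>

definition linear_on_set :: "'a::real_vector set \<Rightarrow> ('a \<Rightarrow> 'b::real_vector) \<Rightarrow> bool" where
  "linear_on_set V T \<longleftrightarrow>
     (\<forall>x\<in>V. \<forall>y\<in>V. T (x + y) = T x + T y) \<and> (\<forall>x\<in>V. \<forall>c. T (c *\<^sub>R x) = c *\<^sub>R T x)"

lemma linear_on_set_add: "linear_on_set V T \<Longrightarrow> x \<in> V \<Longrightarrow> y \<in> V \<Longrightarrow> T (x + y) = T x + T y"
  and linear_on_set_scale: "linear_on_set V T \<Longrightarrow> x \<in> V \<Longrightarrow> T (c *\<^sub>R x) = c *\<^sub>R T x"
  by (auto simp: linear_on_set_def)

lemma linear_on_set_zero: "linear_on_set V T \<Longrightarrow> subspace V \<Longrightarrow> T 0 = 0"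
  using linear_on_set_scale[of V T 0 0] subspace_0[of V] by simp

lemma linear_on_set_diff:
  assumes T: "linear_on_set V T" and V: "subspace V" and xy: "x \<in> V" "y \<in> V"
  shows "T (x - y) = T x - T y"
  using linear_on_set_add[OF T xy(1) subspace_scale[OF V xy(2), of "-1"]]
    linear_on_set_scale[OF T xy(2), of "-1"] by simp

lemma linear_on_set_mono: "linear_on_set V T \<Longrightarrow> W \<subseteq> V \<Longrightarrow> linear_on_set W T"
  unfolding linear_on_set_def by blast

lemma linear_on_set_linear: "linear T \<Longrightarrow> linear_on_set V T"
  by (simp add: linear_on_set_def linear_add linear_scale)

lemma linear_on_set_vimage:
  assumes T: "linear_on_set V T" and V: "subspace V" and W: "subspace W"
  shows "subspace {x \<in> V. T x \<in> W}"
  using assms linear_on_set_zero[OF T V]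
  by (auto simp: subspace_def linear_on_set_add linear_on_set_scale)

lemma linear_on_set_image:
  assumes T: "linear_on_set V T" and V: "subspace V"
  shows "subspace (T ` V)"
proof (rule subspaceI)
  show "0 \<in> T ` V"
    by (rule image_eqI[of _ _ 0]) (simp_all add: linear_on_set_zero[OF T V] subspace_0[OF V])
  show "x + y \<in> T ` V" if "x \<in> T ` V" "y \<in> T ` V" for x y
  proof -
    obtain a b where ab: "a \<in> V" "b \<in> V" "x = T a" "y = T b" using \<open>x \<in> T ` V\<close> \<open>y \<in> T ` V\<close> by blast
    show ?thesis
      by (rule image_eqI[of _ _ "a + b"]) (simp_all add: ab linear_on_set_add[OF T] subspace_add[OF V])
  qed
  show "c *\<^sub>R x \<in> T ` V" if "x \<in> T ` V" for x c
  proof -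
    obtain a where a: "a \<in> V" "x = T a" using \<open>x \<in> T ` V\<close> by blast
    show ?thesis
      by (rule image_eqI[of _ _ "c *\<^sub>R a"])
         (simp_all add: a linear_on_set_scale[OF T] subspace_scale[OF V])
  qed
qed

lemma linear_on_set_image_fin_dim:
  assumes T: "linear_on_set V T" and V: "subspace V" and F: "fin_dim F" "F \<subseteq> V"
  shows "fin_dim (T ` F)"
proof -
  obtain C where C: "finite C" "F = span C" using F by (auto simp: fin_dim_def)
  have CV: "C \<subseteq> V" using C(2) F(2) span_superset by blast
  have "T ` span C = span (T ` C)"
  proof
    have "span C \<subseteq> {x \<in> V. T x \<in> span (T ` C)}"
      by (intro span_minimal linear_on_set_vimage T V subspace_span) (use CV in \<open>auto intro: span_base\<close>)
    then show "T ` span C \<subseteq> span (T ` C)" by auto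
    have "subspace (T ` span C)"
      using F(2) C(2) by (intro linear_on_set_image linear_on_set_mono[OF T]) auto
    then show "span (T ` C) \<subseteq> T ` span C"
      by (intro span_minimal) (auto intro: span_base)
  qed
  then show ?thesis using C unfolding fin_dim_def by blast
qed

lemma bounded_linear_onI:
  fixes T :: "'a::real_normed_vector \<Rightarrow> 'b::real_normed_vector"
  assumes "T ` V \<subseteq> W" "linear_on_set V T" "\<And>x. x \<in> V \<Longrightarrow> norm (T x) \<le> K * norm x"
  shows "bounded_linear_on V norm W norm T"
  using assms unfolding bounded_linear_on_def linear_on_set_def by blast

text \<open>
  The continuity of the inverse is stated as a lower bound, so that the inverse need not be named.
\<close>

lemma isomorphism_onI:
  fixes T :: "'a::real_normed_vector \<Rightarrow> 'b::real_normed_vector"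
  assumes V: "subspace V" and lin: "linear_on_set V T" and im: "T ` V = W"
    and up: "\<And>x. x \<in> V \<Longrightarrow> norm (T x) \<le> K * norm x"
    and low: "\<And>x. x \<in> V \<Longrightarrow> norm x \<le> L * norm (T x)"
  shows "isomorphism_on V norm W norm T"
proof -
  have inj: "inj_on T V"
  proof (rule inj_onI)
    fix x y assume xy: "x \<in> V" "y \<in> V" "T x = T y"
    then have "T (x - y) = 0" using linear_on_set_diff[OF lin V] by simp
    then show "x = y" using low[OF subspace_diff[OF V xy(1,2)]] by simp
  qed
  let ?S = "the_inv_into V T"
  have S: "?S y \<in> V" "T (?S y) = y" if "y \<in> W" for y
    using that inj im by (auto intro: the_inv_into_into f_the_inv_into_f)
  have S_eq: "?S (T x) = x" if "x \<in> V" for x using the_inv_into_f_f[OF inj that] .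
  have "linear_on_set W ?S"
    unfolding linear_on_set_def
  proof safe
    fix x y assume xy: "x \<in> W" "y \<in> W"
    have "T (?S x + ?S y) = x + y" using S xy by (simp add: linear_on_set_add[OF lin])
    then show "?S (x + y) = ?S x + ?S y" using S_eq[OF subspace_add[OF V S(1)[OF xy(1)] S(1)[OF xy(2)]]] by simp
  next
    fix x c assume x: "x \<in> W"
    have "T (c *\<^sub>R ?S x) = c *\<^sub>R x" using S x by (simp add: linear_on_set_scale[OF lin])
    then show "?S (c *\<^sub>R x) = c *\<^sub>R ?S x" using S_eq[OF subspace_scale[OF V S(1)[OF x], of c]] by simp
  qed
  moreover have "norm (?S y) \<le> L * norm y" if "y \<in> W" for y using low[OF S(1)[OF that]] S(2)[OF that] by simp
  ultimately have "bounded_linear_on W norm V norm ?S"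
    using S(1) by (intro bounded_linear_onI[where K = L]) auto
  moreover have "bounded_linear_on V norm W norm T"
    using im lin up by (intro bounded_linear_onI[where K = K]) auto
  ultimately show ?thesis using inj im by (auto simp: isomorphism_on_def bij_betw_def)
qed

lemma isomorphism_onE:
  fixes T :: "'a::real_normed_vector \<Rightarrow> 'b::real_normed_vector"
  assumes "isomorphism_on V norm W norm T"
  obtains K where "linear_on_set V T" "T ` V = W" "inj_on T V" "K > 0"
    "\<And>x. x \<in> V \<Longrightarrow> norm (T x) \<le> K * norm x" "\<And>x. x \<in> V \<Longrightarrow> norm x \<le> K * norm (T x)"
proof -
  have bij: "bij_betw T V W" and T: "bounded_linear_on V norm W norm T"
    and S: "bounded_linear_on W norm V norm (the_inv_into V T)"
    using assms by (auto simp: isomorphism_on_def)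
  obtain K1 where K1: "\<And>x. x \<in> V \<Longrightarrow> norm (T x) \<le> K1 * norm x"
    using T unfolding bounded_linear_on_def by blast
  obtain K2 where K2: "\<And>x. x \<in> W \<Longrightarrow> norm (the_inv_into V T x) \<le> K2 * norm x"
    using S unfolding bounded_linear_on_def by blast
  define K where "K = max 1 (max K1 K2)"
  have le: "K1 * t \<le> K * t" "K2 * t \<le> K * t" if "t \<ge> 0" for t
    using that by (auto simp: K_def intro!: mult_right_mono)
  show ?thesis
  proof (rule that)
    show "linear_on_set V T" using T by (auto simp: bounded_linear_on_def linear_on_set_def)
    show "T ` V = W" "inj_on T V" using bij by (auto simp: bij_betw_def)
    show "K > 0" by (simp add: K_def)
    fix x assume x: "x \<in> V"
    show "norm (T x) \<le> K * norm x" using K1[OF x] le(1)[of "norm x"] by simp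
    have "the_inv_into V T (T x) = x" "T x \<in> W"
      using bij x by (auto simp: bij_betw_def the_inv_into_f_f)
    then show "norm x \<le> K * norm (T x)" using K2[of "T x"] le(2)[of "norm (T x)"] by simp
  qed
qed

lemma continuous_on_bounded_linear_on_set:
  fixes T :: "'a::real_normed_vector \<Rightarrow> 'b::real_normed_vector"
  assumes V: "subspace V" and lin: "linear_on_set V T"
    and up: "\<And>x. x \<in> V \<Longrightarrow> norm (T x) \<le> K * norm x" and K: "K \<ge> 0"
  shows "continuous_on V T"
proof (rule lipschitz_on_continuous_on[where L = K], rule lipschitz_onI)
  fix x y assume xy: "x \<in> V" "y \<in> V"
  show "dist (T x) (T y) \<le> K * dist x y"
    using up[OF subspace_diff[OF V xy]] linear_on_set_diff[OF lin V xy] by (simp add: dist_norm)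
qed fact

lemma opnorm_on_bound:
  fixes T :: "'a::real_normed_vector \<Rightarrow> 'b::real_normed_vector"
  assumes "\<And>x. x \<in> V \<Longrightarrow> norm (T x) \<le> K * norm x" "x \<in> V"
  shows "norm (T x) \<le> opnorm_on V norm norm T * norm x"
proof (cases "x = 0")
  case True
  then show ?thesis using assms(1)[OF assms(2)] by simp
next
  case False
  have "bdd_above ((\<lambda>x. norm (T x) / norm x) ` V)"
  proof (rule bdd_aboveI2)
    fix x assume "x \<in> V"
    then show "norm (T x) / norm x \<le> \<bar>K\<bar>"
      using order_trans[OF assms(1)[of x] mult_right_mono[OF abs_ge_self[of K] norm_ge_zero[of x]]]
      by (cases "x = 0") (simp_all add: divide_le_eq)
  qed
  then have "norm (T x) / norm x \<le> opnorm_on V norm norm T"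
    unfolding opnorm_on_def by (intro cSUP_upper assms)
  then show ?thesis using False by (simp add: field_simps)
qed

lemma opnorm_on_le:
  fixes T :: "'a::real_normed_vector \<Rightarrow> 'b::real_normed_vector"
  assumes "\<And>x. x \<in> V \<Longrightarrow> norm (T x) \<le> K * norm x" "V \<noteq> {}" "K \<ge> 0"
  shows "opnorm_on V norm norm T \<le> K"
  unfolding opnorm_on_def
proof (rule cSUP_least[OF assms(2)])
  fix x assume "x \<in> V"
  then show "norm (T x) / norm x \<le> K"
    using assms(1)[of x] assms(3) by (cases "x = 0") (auto simp: divide_le_eq)
qed

lemma isomorphism_on_distance:
  assumes iso: "isomorphism_on V norm W norm T" and V: "subspace V"
  shows "x \<in> V \<Longrightarrow> norm (T x - x) \<le> opnorm_on V norm norm (\<lambda>z. T z - z) * norm x"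
    and "0 \<le> opnorm_on V norm norm (\<lambda>z. T z - z)"
proof -
  obtain K where up: "\<And>x. x \<in> V \<Longrightarrow> norm (T x) \<le> K * norm x" and K: "K > 0"
    using isomorphism_onE[OF iso] by metis
  have le: "norm (T x - x) \<le> (K + 1) * norm x" if "x \<in> V" for x
    using up[OF that] norm_triangle_ineq4[of "T x" x] by (simp add: algebra_simps)
  show "x \<in> V \<Longrightarrow> norm (T x - x) \<le> opnorm_on V norm norm (\<lambda>z. T z - z) * norm x"
    by (rule opnorm_on_bound[of V "\<lambda>z. T z - z", OF le])
  have "bdd_above ((\<lambda>x. norm (T x - x) / norm x) ` V)"
  proof (rule bdd_aboveI2)
    show "norm (T x - x) / norm x \<le> K + 1" if "x \<in> V" for x
      using le[OF that] K by (cases "x = 0") (auto simp: divide_le_eq)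
  qed
  then have "norm (T 0 - 0) / norm (0 :: 'a) \<le> opnorm_on V norm norm (\<lambda>z. T z - z)"
    unfolding opnorm_on_def by (rule cSUP_upper[OF subspace_0[OF V]])
  then show "0 \<le> opnorm_on V norm norm (\<lambda>z. T z - z)" by simp
qed

text \<open>
  Surjectivity is a fixed point argument: \<open>R x = y\<close> iff \<open>x\<close> is fixed by the contraction
  \<open>x \<mapsto> x + (y - R x)\<close>.
\<close>

lemma near_identity_bij:
  fixes R :: "'a::banach \<Rightarrow> 'a"
  assumes R: "linear R" and near: "\<And>x. norm (R x - x) \<le> \<eta> * norm x" and \<eta>: "\<eta> < 1" "0 \<le> \<eta>"
  shows "bij R" "norm x \<le> norm (R x) / (1 - \<eta>)" "norm (R x) \<le> (1 + \<eta>) * norm x"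
proof -
  have low: "(1 - \<eta>) * norm x \<le> norm (R x)" for x
    using near[of x] norm_triangle_ineq4[of "R x" "R x - x"] by (simp add: algebra_simps)
  then show "norm x \<le> norm (R x) / (1 - \<eta>)"
    using \<eta> by (simp add: field_simps)
  show "norm (R x) \<le> (1 + \<eta>) * norm x"
    using near[of x] norm_triangle_ineq[of "R x - x" x] by (simp add: algebra_simps)
  have "inj R"
    unfolding linear_injective_0[OF R]
  proof safe
    fix x assume "R x = 0"
    then have "(1 - \<eta>) * norm x \<le> 0" using low[of x] by simp
    then show "x = 0" using \<eta> by (simp add: mult_le_0_iff)
  qed
  moreover have "\<exists>x. R x = y" for y
  proof -
    have "\<exists>!x. x + (y - R x) = x"
    proof (rule banach_fix_type[OF \<eta>(2) \<eta>(1)], intro allI)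
      fix x z
      have "dist (x + (y - R x)) (z + (y - R z)) = norm (R (x - z) - (x - z))"
        unfolding dist_norm linear_diff[OF R] by (subst norm_minus_commute) (simp add: algebra_simps)
      also have "\<dots> \<le> \<eta> * dist x z" unfolding dist_norm by (rule near)
      finally show "dist (x + (y - R x)) (z + (y - R z)) \<le> \<eta> * dist x z" .
    qed
    then obtain x where "x + (y - R x) = x" by blast
    then show ?thesis by (intro exI[of _ x]) simp
  qed
  then have "surj R" unfolding surj_def by metis
  ultimately show "bij R" by (simp add: bij_def)
qed

context strong_mbasis
begin

lemma Y_infinite_dim:
  assumes A: "infinite A"
  shows "\<not> fin_dim (Y A)"
proof
  assume "fin_dim (Y A)"
  then obtain B where B: "finite B" "Y A = span B" by (auto simp: fin_dim_def)
  have "independent (e ` A)"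
    unfolding dependent_def
  proof safe
    fix i assume "e i \<in> span (e ` A - {e i})"
    moreover have "span (e ` A - {e i}) \<subseteq> Y (- {i})"
      by (intro span_minimal subspace_Y) (auto simp: e_in_Y)
    ultimately show False by (auto simp: e_in_Y)
  qed
  moreover have "e ` A \<subseteq> span B" using B(2) by (auto simp: e_in_Y simp flip: B(2))
  ultimately have "finite (e ` A)" using independent_span_bound[OF B(1)] by blast
  then show False using A finite_imageD[OF _ inj_on_subset[OF inj_e subset_UNIV]] by blast
qed

lemma span_e_finite_support:
  assumes "x \<in> span (e ` A)"
  obtains N where "x \<in> Y (A \<inter> {..<N})"
proof -
  obtain S r where Sr: "finite S" "S \<subseteq> e ` A" "x = (\<Sum>a\<in>S. r a *\<^sub>R a)"
    using assms unfolding span_explicit by blast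
  then have S: "finite S" "S \<subseteq> e ` A" "x \<in> span S"
    by (auto intro!: span_sum span_scale intro: span_base)
  obtain J where J: "finite J" "J \<subseteq> A" "S = e ` J" using S finite_subset_image by metis
  obtain N where "J \<subseteq> {..<N}" using J(1) finite_nat_iff_bounded by blast
  then have "span S \<subseteq> Y (A \<inter> {..<N})"
    using J by (intro span_minimal subspace_Y) (auto simp: e_in_Y)
  then show ?thesis using that S by blast
qed

text \<open>
  The vectors of \<open>C\<close> are moved one at a time. If \<open>R\<close> has moved \<open>C\<close> into the span of finitely many \<open>e i\<close> but
  \<open>R v\<close> is not in that span, then \<open>R v\<close> has a nonzero coordinate \<open>j\<close> outside it. The rank-one perturbation
  of the identity along \<open>\<phi> j\<close> that sends \<open>R v\<close> to a nearby finite combination \<open>g\<close> fixes the span already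
  reached, as \<open>\<phi> j\<close> vanishes there, so nothing is lost by composing with it.
\<close>

lemma perturb_into_finite_span:
  assumes "finite C" "C \<subseteq> Y A" "\<eta> > 0"
  shows "\<exists>R N. linear R \<and> (\<forall>x. norm (R x - x) \<le> \<eta> * norm x) \<and> (\<forall>x. R x - x \<in> Y A) \<and>
               R ` C \<subseteq> Y (A \<inter> {..<N})"
  using assms
proof (induction C arbitrary: \<eta>)
  case empty
  have "0 \<in> Y A" by (rule subspace_0[OF subspace_Y])
  then show ?case using \<open>\<eta> > 0\<close> by (intro exI[of _ "\<lambda>x. x"]) (auto intro: linear_ident)
next
  case (insert v C)
  define \<delta> where "\<delta> = min 1 (\<eta> / 3)"
  have \<delta>: "\<delta> > 0" "\<delta> \<le> 1" "3 * \<delta> \<le> \<eta>" using \<open>\<eta> > 0\<close> by (auto simp: \<delta>_def)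
  obtain R N where R: "linear R" "\<And>x. norm (R x - x) \<le> \<delta> * norm x" "\<And>x. R x - x \<in> Y A"
    "R ` C \<subseteq> Y (A \<inter> {..<N})"
    using insert.IH[OF _ \<delta>(1)] insert.prems by blast
  show ?case
  proof (cases "R v \<in> Y (A \<inter> {..<N})")
    case True
    have "norm (R x - x) \<le> \<eta> * norm x" for x
      using R(2)[of x] \<delta> mult_right_mono[of \<delta> \<eta> "norm x"] by simp
    then show ?thesis using R True by (intro exI[of _ R] exI[of _ N]) auto
  next
    case False
    define v' where "v' = R v"
    have "v \<in> Y A" using insert.prems by auto
    then have v': "v' \<in> Y A" using subspace_add[OF subspace_Y R(3)[of v], of v] by (simp add: v'_def)
    obtain j where j: "j \<notin> A \<inter> {..<N}" "\<phi> j v' \<noteq> 0" using False by (auto simp: in_Y v'_def)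
    obtain K where K: "K > 0" "\<And>x. \<bar>\<phi> j x\<bar> \<le> K * norm x"
      using bounded_linear.pos_bounded[OF bounded_linear_coord[of j]] by (auto simp: mult.commute)
    define c where "c = \<phi> j v'"
    have "\<exists>g\<in>span (e ` A). dist g v' < \<delta> * \<bar>c\<bar> / K"
      using v' j(2) \<delta>(1) K(1) unfolding Y_eq_closure_span closure_approachable by (simp add: c_def)
    then obtain g where g: "g \<in> span (e ` A)" "norm (g - v') < \<delta> * \<bar>c\<bar> / K"
      by (auto simp: dist_norm)
    obtain N' where N': "g \<in> Y (A \<inter> {..<N'})" using span_e_finite_support[OF g(1)] by blast
    define Q where "Q x = x + (\<phi> j x / c) *\<^sub>R (g - v')" for x
    have Q: "linear Q"
      by (rule linearI) (auto simp: Q_def coord_add coord_scaleR algebra_simps add_divide_distrib)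
    have Q_near: "norm (Q x - x) \<le> \<delta> * norm x" for x
    proof -
      have "norm (Q x - x) = \<bar>\<phi> j x\<bar> / \<bar>c\<bar> * norm (g - v')" by (simp add: Q_def)
      also have "\<dots> \<le> (K * norm x) / \<bar>c\<bar> * (\<delta> * \<bar>c\<bar> / K)"
        using K g(2) by (intro mult_mono divide_right_mono) (auto intro: less_imp_le)
      also have "\<dots> = \<delta> * norm x" using K(1) j(2) by (simp add: c_def)
      finally show ?thesis .
    qed
    have gY: "g \<in> Y A" using N' Y_mono[of "A \<inter> {..<N'}" A] by auto
    have Q_Y: "Q x - x \<in> Y A" for x
      by (simp add: Q_def subspace_scale[OF subspace_Y] subspace_diff[OF subspace_Y] gY v')
    have Q_fix: "Q x = x" if "x \<in> Y (A \<inter> {..<N})" for x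
      using that j(1) by (auto simp: Q_def in_Y)
    have "Q (R v) = g" using j(2) by (simp add: Q_def c_def flip: v'_def)
    then have "(Q \<circ> R) ` insert v C \<subseteq> Y (A \<inter> {..<max N N'})"
    proof -
      have sub: "Y (A \<inter> {..<N}) \<subseteq> Y (A \<inter> {..<max N N'})" "Y (A \<inter> {..<N'}) \<subseteq> Y (A \<inter> {..<max N N'})"
        by (intro Y_mono; auto)+
      have "Q (R x) \<in> Y (A \<inter> {..<max N N'})" if "x \<in> C" for x
        using R(4) that Q_fix[of "R x"] sub(1) by auto
      then show ?thesis using \<open>Q (R v) = g\<close> N' sub(2) by auto
    qed
    moreover have "norm ((Q \<circ> R) x - x) \<le> \<eta> * norm x" for x
    proof -
      have "norm (R x) \<le> norm (R x - x) + norm x" using norm_triangle_ineq[of "R x - x" x] by simp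
      also have "\<dots> \<le> 2 * norm x" using R(2)[of x] \<delta>(2) mult_right_mono[of \<delta> 1 "norm x"] by simp
      finally have "norm (Q (R x) - R x) \<le> \<delta> * (2 * norm x)"
        using Q_near[of "R x"] \<delta>(1) mult_left_mono[of "norm (R x)" "2 * norm x" \<delta>] by linarith
      moreover have "norm ((Q \<circ> R) x - x) \<le> norm (Q (R x) - R x) + norm (R x - x)"
        using norm_triangle_ineq[of "Q (R x) - R x" "R x - x"] by simp
      ultimately have "norm ((Q \<circ> R) x - x) \<le> 3 * \<delta> * norm x" using R(2)[of x] by linarith
      also have "\<dots> \<le> \<eta> * norm x" using \<delta>(3) by (intro mult_right_mono) auto
      finally show ?thesis .
    qed
    moreover have "(Q \<circ> R) x - x \<in> Y A" for x
      using subspace_add[OF subspace_Y Q_Y[of "R x"] R(3)[of x]] by simp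
    moreover have "linear (Q \<circ> R)" by (rule linear_compose[OF R(1) Q])
    ultimately show ?thesis by blast
  qed
qed

text \<open>
  Let \<open>T\<close> from \<open>Z\<close> onto \<open>Y A\<close> witness the membership of \<open>Y A\<close>. A perturbation \<open>R\<close> of the identity that
  moves \<open>T F\<close> into finitely many coordinates makes \<open>R \<circ> T\<close>, restricted to the preimage of \<open>Y B\<close>, a witness
  for every \<open>B \<subseteq> A\<close> that contains these coordinates. Since the distance of \<open>T\<close> to the identity is strictly
  below \<open>\<epsilon>\<close>, there is room for \<open>R\<close>.
\<close>

lemma ellentuck_nbhd_locally_determined:
  assumes F: "fin_dim F" and YA: "Y A \<in> ellentuck_nbhd F W \<epsilon>"
  shows "\<exists>N. \<forall>B\<subseteq>A. A \<inter> {..<N} \<subseteq> B \<longrightarrow> Y B \<in> ellentuck_nbhd F W \<epsilon>"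
proof -
  obtain Z T where Z: "Z \<in> Sub" "F \<subseteq> Z" "Z \<subseteq> W" and iso: "isomorphism_on Z norm (Y A) norm T"
    and op: "opnorm_on Z norm norm (\<lambda>z. T z - z) < \<epsilon>"
    using YA by (auto simp: ellentuck_nbhd_def)
  have subZ: "subspace Z" and clZ: "closed Z" using Z(1) by (auto simp: Sub_def)
  obtain K where T: "linear_on_set Z T" "T ` Z = Y A" "inj_on T Z" and K: "K > 0"
    and up: "\<And>x. x \<in> Z \<Longrightarrow> norm (T x) \<le> K * norm x" and low: "\<And>x. x \<in> Z \<Longrightarrow> norm x \<le> K * norm (T x)"
    by (rule isomorphism_onE[OF iso]) blast
  define c where "c = opnorm_on Z norm norm (\<lambda>z. T z - z)"
  note c = isomorphism_on_distance[OF iso subZ, folded c_def]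
  define \<eta> where "\<eta> = min (1/2) ((\<epsilon> - c) / (2 * K))"
  have "\<epsilon> - c > 0" using op by (simp add: c_def)
  then have \<eta>: "0 < \<eta>" "\<eta> < 1" using K by (auto simp: \<eta>_def)
  have "\<eta> * K \<le> (\<epsilon> - c) / (2 * K) * K" using K by (intro mult_right_mono) (auto simp: \<eta>_def)
  also have "\<dots> = (\<epsilon> - c) / 2" using K by simp
  finally have \<eta>K: "\<eta> * K + c < \<epsilon>" using \<open>\<epsilon> - c > 0\<close> by simp
  obtain C where C: "finite C" "F = span C" using F by (auto simp: fin_dim_def)
  have CZ: "C \<subseteq> Z" using C(2) Z(2) span_superset by blast
  have "finite (T ` C)" "T ` C \<subseteq> Y A" using C(1) CZ T(2) by auto
  then obtain R N where R: "linear R" "\<And>x. norm (R x - x) \<le> \<eta> * norm x" "\<And>x. R x - x \<in> Y A"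
    "R ` T ` C \<subseteq> Y (A \<inter> {..<N})"
    using perturb_into_finite_span[OF _ _ \<eta>(1)] by meson
  note nearR = near_identity_bij[OF R(1,2) \<eta>(2) less_imp_le[OF \<eta>(1)]]
  have "Y B \<in> ellentuck_nbhd F W \<epsilon>" if B: "B \<subseteq> A" "A \<inter> {..<N} \<subseteq> B" for B
  proof -
    define RT where "RT = (\<lambda>z. R (T z))"
    have linRT: "linear_on_set Z RT"
      using T(1) R(1) by (auto simp: RT_def linear_on_set_def linear_add linear_scale)
    have upRT: "norm (RT z) \<le> (1 + \<eta>) * K * norm z" if "z \<in> Z" for z
      using order_trans[OF nearR(3)[of "T z"] mult_left_mono[OF up[OF that], of "1 + \<eta>"]] \<eta>
      by (simp add: RT_def mult.assoc)
    have lowRT: "norm z \<le> K / (1 - \<eta>) * norm (RT z)" if "z \<in> Z" for z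
      using low[OF that] mult_left_mono[OF nearR(2)[of "T z"], of K] K by (simp add: RT_def)
    define Z'' where "Z'' = {z \<in> Z. RT z \<in> Y B}"
    have sub: "subspace Z''"
      unfolding Z''_def by (rule linear_on_set_vimage[OF linRT subZ subspace_Y])
    have "continuous_on Z RT"
      by (rule continuous_on_bounded_linear_on_set[OF subZ linRT upRT]) (use K \<eta> in auto)
    then have "closed (Z \<inter> RT -` Y B)" by (rule continuous_closed_preimage[OF _ clZ closed_Y])
    also have "Z \<inter> RT -` Y B = Z''" by (auto simp: Z''_def)
    finally have SubZ'': "Z'' \<in> Sub" using sub by (simp add: Sub_def)
    have "C \<subseteq> Z''" using CZ R(4) Y_mono[OF B(2)] by (auto simp: Z''_def RT_def)
    then have FZ'': "F \<subseteq> Z''" unfolding C(2) by (rule span_minimal[OF _ sub])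
    have Z''W: "Z'' \<subseteq> W" using Z(3) by (auto simp: Z''_def)
    have "RT ` Z'' = Y B"
    proof
      show "RT ` Z'' \<subseteq> Y B" by (auto simp: Z''_def)
      show "Y B \<subseteq> RT ` Z''"
      proof
        fix y assume y: "y \<in> Y B"
        obtain x where x: "R x = y" using nearR(1) by (metis bij_pointE)
        have "y - (R x - x) \<in> Y A"
          using subspace_diff[OF subspace_Y _ R(3)[of x], of y] y Y_mono[OF B(1)] by blast
        then have "x \<in> Y A" by (simp add: x)
        then have "x \<in> T ` Z" by (simp add: T(2))
        then obtain z where "z \<in> Z" "T z = x" by blast
        then show "y \<in> RT ` Z''" using x y by (auto simp: Z''_def RT_def intro!: image_eqI[of _ _ z])
      qed
    qed
    then have isoRT: "isomorphism_on Z'' norm (Y B) norm RT"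
      using linear_on_set_mono[OF linRT, of Z'']
      by (intro isomorphism_onI[OF sub, of RT "Y B" "(1 + \<eta>) * K" "K / (1 - \<eta>)"])
         (auto simp: Z''_def intro: upRT lowRT[simplified])
    have "norm (RT z - z) \<le> (\<eta> * K + c) * norm z" if "z \<in> Z''" for z
    proof -
      have z: "z \<in> Z" using that by (simp add: Z''_def)
      have "norm (RT z - z) \<le> norm (R (T z) - T z) + norm (T z - z)"
        using norm_triangle_ineq[of "R (T z) - T z" "T z - z"] by (simp add: RT_def)
      also have "\<dots> \<le> \<eta> * (K * norm z) + c * norm z"
        using R(2)[of "T z"] mult_left_mono[OF up[OF z], of \<eta>] \<eta>(1) c(1)[OF z] by linarith
      finally show ?thesis by (simp add: algebra_simps)
    qed
    then have "opnorm_on Z'' norm norm (\<lambda>z. RT z - z) \<le> \<eta> * K + c"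
      using subspace_0[OF sub] K \<eta> c(2) by (intro opnorm_on_le) auto
    then have "opnorm_on Z'' norm norm (\<lambda>z. RT z - z) < \<epsilon>" using \<eta>K by linarith
    then show ?thesis
      unfolding ellentuck_nbhd_def using Y_in_Sub[of B] SubZ'' FZ'' isoRT Z''W by blast
  qed
  then show ?thesis by blast
qed

text \<open>
  This is how the Ellentuck topology enters the proof: within the spaces \<open>Y B\<close> with \<open>B \<subseteq> A\<close>, its
  neighbourhoods of \<open>Y A\<close> depend on finitely many indices.
\<close>

theorem ellentuck_open_locally_determined:
  assumes U: "openin ellentuck U" and YA: "Y A \<in> U"
  shows "\<exists>N. \<forall>B\<subseteq>A. A \<inter> {..<N} \<subseteq> B \<longrightarrow> Y B \<in> U"
proof -
  define \<B> where "\<B> = {ellentuck_nbhd F Y \<epsilon> | F (Y :: 'a set) \<epsilon>. Y \<in> Sub \<and> fin_dim F \<and> F \<subseteq> Y \<and> 0 < \<epsilon>}"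
  have "generate_topology_on \<B> U"
    using U unfolding ellentuck_def \<B>_def by (rule openin_topology_generated_by)
  then show ?thesis using YA
  proof (induction)
    case (Int a b)
    then obtain N M where NM: "\<forall>B\<subseteq>A. A \<inter> {..<N} \<subseteq> B \<longrightarrow> Y B \<in> a" "\<forall>B\<subseteq>A. A \<inter> {..<M} \<subseteq> B \<longrightarrow> Y B \<in> b"
      by auto
    have "A \<inter> {..<N} \<subseteq> A \<inter> {..<max N M}" "A \<inter> {..<M} \<subseteq> A \<inter> {..<max N M}" by auto
    then show ?case using NM by (intro exI[of _ "max N M"]) (meson Int_iff order_trans)
  next
    case (UN K)
    then obtain k where "k \<in> K" "Y A \<in> k" by blast
    then show ?case using UN.IH[of k] by blast
  next
    case (Basis s)
    then show ?case using ellentuck_nbhd_locally_determined by (auto simp: \<B>_def)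
  qed simp
qed

end

section \<open>Meagre sets and the Souslin operation\<close>

definition meagre :: "'a::topological_space set \<Rightarrow> bool" where
  "meagre S \<longleftrightarrow> (\<exists>\<F>. countable \<F> \<and> (\<forall>T\<in>\<F>. closed T \<and> interior T = {}) \<and> S \<subseteq> \<Union>\<F>)"

lemma meagre_mono: "meagre T \<Longrightarrow> S \<subseteq> T \<Longrightarrow> meagre S"
  unfolding meagre_def by (meson subset_trans)

lemma meagre_closed: "closed T \<Longrightarrow> interior T = {} \<Longrightarrow> meagre T"
  unfolding meagre_def by (intro exI[of _ "{T}"]) auto

lemma meagre_UN:
  assumes I: "countable I" and m: "\<And>i. i \<in> I \<Longrightarrow> meagre (S i)"
  shows "meagre (\<Union>i\<in>I. S i)"
proof -
  have "\<forall>i\<in>I. \<exists>\<F>. countable \<F> \<and> (\<forall>T\<in>\<F>. closed T \<and> interior T = {}) \<and> S i \<subseteq> \<Union>\<F>"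
    using m by (simp add: meagre_def)
  then obtain \<F> where \<F>: "\<And>i. i \<in> I \<Longrightarrow> countable (\<F> i)"
    "\<And>i T. i \<in> I \<Longrightarrow> T \<in> \<F> i \<Longrightarrow> closed T \<and> interior T = {}" "\<And>i. i \<in> I \<Longrightarrow> S i \<subseteq> \<Union>(\<F> i)"
    by metis
  show ?thesis
    unfolding meagre_def
  proof (intro exI[of _ "\<Union>i\<in>I. \<F> i"] conjI ballI)
    show "countable (\<Union>i\<in>I. \<F> i)" using I \<F>(1) by (rule countable_UN)
    show "closed T" "interior T = {}" if "T \<in> (\<Union>i\<in>I. \<F> i)" for T using that \<F>(2) by auto
    show "(\<Union>i\<in>I. S i) \<subseteq> \<Union>(\<Union>i\<in>I. \<F> i)" using \<F>(3) by fastforce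
  qed
qed

lemma meagre_Un: "meagre S \<Longrightarrow> meagre T \<Longrightarrow> meagre (S \<union> T)"
  using meagre_UN[of "UNIV :: bool set" "\<lambda>b. if b then S else T"]
  by (simp add: UNIV_bool countable_finite Un_commute)

lemma meagre_closure_minus_open:
  assumes "open W"
  shows "meagre (closure W - W)"
proof (rule meagre_closed)
  show "closed (closure W - W)" using assms by (intro closed_Diff) auto
  have "interior (closure W - W) \<inter> W = {}"
    using interior_subset[of "closure W - W"] by blast
  then have "interior (closure W - W) \<inter> closure W = {}"
    by (simp add: open_Int_closure_eq_empty)
  then show "interior (closure W - W) = {}" using interior_subset[of "closure W - W"] by blast
qed

lemma meagre_closed_minus_interior:
  assumes "closed T"
  shows "meagre (T - interior T)"
proof (rule meagre_closed)
  show "closed (T - interior T)" using assms by (intro closed_Diff) auto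
  have "interior (T - interior T) \<subseteq> interior T" by (intro interior_mono) auto
  then show "interior (T - interior T) = {}" using interior_subset[of "T - interior T"] by blast
qed

text \<open>
  In a second countable space \<open>S\<close> is meagre in the complement of its hull, which is the largest open set with
  this property. Thus the hull is a closed set that contains \<open>S\<close> up to a meagre set and is as small as possible.
\<close>

definition meagre_hull :: "'a::topological_space set \<Rightarrow> 'a set" where
  "meagre_hull S = - \<Union>{U. open U \<and> meagre (S \<inter> U)}"

lemma closed_meagre_hull: "closed (meagre_hull S)"
  unfolding meagre_hull_def by (intro closed_Compl open_Union) auto

lemma meagre_hull_disjoint: "open U \<Longrightarrow> meagre (S \<inter> U) \<Longrightarrow> U \<inter> meagre_hull S = {}"
  by (auto simp: meagre_hull_def)

lemma meagre_hull_subset_closure: "meagre_hull S \<subseteq> closure S"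
proof -
  have "S \<inter> - closure S = {}" using closure_subset[of S] by blast
  moreover have "meagre ({} :: 'a set)" by (rule meagre_closed) auto
  ultimately have "- closure S \<inter> meagre_hull S = {}" by (intro meagre_hull_disjoint) auto
  then show ?thesis by blast
qed

lemma meagre_minus_hull:
  fixes S :: "'a::second_countable_topology set"
  shows "meagre (S - meagre_hull S)"
proof -
  obtain \<B> :: "'a set set" where \<B>: "countable \<B>" "topological_basis \<B>"
    using ex_countable_basis by blast
  have "S - meagre_hull S \<subseteq> (\<Union>B\<in>{B\<in>\<B>. meagre (S \<inter> B)}. S \<inter> B)"
  proof
    fix x assume x: "x \<in> S - meagre_hull S"
    then obtain U where U: "open U" "meagre (S \<inter> U)" "x \<in> U" by (auto simp: meagre_hull_def)
    obtain B where B: "B \<in> \<B>" "x \<in> B" "B \<subseteq> U" using topological_basisE[OF \<B>(2) U(1,3)] by metis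
    have "meagre (S \<inter> B)" by (rule meagre_mono[OF U(2)]) (use B in auto)
    then show "x \<in> (\<Union>B\<in>{B\<in>\<B>. meagre (S \<inter> B)}. S \<inter> B)" using x B by auto
  qed
  moreover have "meagre (\<Union>B\<in>{B\<in>\<B>. meagre (S \<inter> B)}. S \<inter> B)"
  proof (rule meagre_UN)
    show "countable {B \<in> \<B>. meagre (S \<inter> B)}" by (rule countable_subset[OF _ \<B>(1)]) auto
  qed simp
  ultimately show ?thesis by (rule meagre_mono[rotated])
qed

text \<open>
  Where the interiors of the hulls of the pieces \<open>T d\<close> are not dense, every piece is meagre, hence \<open>S\<close> is, and
  the hull of \<open>S\<close> does not reach there. What is left over are boundaries of open and of closed sets.
\<close>

lemma meagre_hull_minus_hulls:
  fixes S :: "'a::second_countable_topology set"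
  assumes S: "S = (\<Union>d::nat. T d)"
  shows "meagre (meagre_hull S - (\<Union>d. meagre_hull (T d)))"
proof -
  define V where "V = interior (meagre_hull S)"
  define W where "W = (\<Union>d. interior (meagre_hull (T d)))"
  define V' where "V' = V - closure W"
  have open_W: "open W" by (auto simp: W_def)
  have "V' \<inter> S \<subseteq> (\<Union>d. (T d - meagre_hull (T d)) \<union> (meagre_hull (T d) - interior (meagre_hull (T d))))"
  proof
    fix x assume x: "x \<in> V' \<inter> S"
    then obtain d where d: "x \<in> T d" using S by auto
    have "x \<notin> W" using x closure_subset[of W] by (auto simp: V'_def)
    then have "x \<notin> interior (meagre_hull (T d))" by (auto simp: W_def)
    then show "x \<in> (\<Union>d. (T d - meagre_hull (T d)) \<union> (meagre_hull (T d) - interior (meagre_hull (T d))))"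
      using d by blast
  qed
  moreover have "meagre (\<Union>d. (T d - meagre_hull (T d)) \<union> (meagre_hull (T d) - interior (meagre_hull (T d))))"
    by (intro meagre_UN meagre_Un meagre_minus_hull meagre_closed_minus_interior closed_meagre_hull) auto
  ultimately have "meagre (V' \<inter> S)" by (rule meagre_mono[rotated])
  then have "meagre (S \<inter> V')" by (simp add: Int_commute)
  moreover have "open V'" by (auto simp: V'_def V_def intro!: open_Diff)
  ultimately have "V' \<inter> meagre_hull S = {}" by (intro meagre_hull_disjoint)
  then have "V \<subseteq> closure W" using interior_subset[of "meagre_hull S"] by (auto simp: V'_def V_def)
  then have "meagre_hull S - (\<Union>d. meagre_hull (T d)) \<subseteq> (meagre_hull S - V) \<union> (closure W - W)"
  proof -
    have "W \<subseteq> (\<Union>d. meagre_hull (T d))" unfolding W_def by (intro UN_mono interior_subset) auto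
    then show ?thesis using \<open>V \<subseteq> closure W\<close> by blast
  qed
  moreover have "meagre ((meagre_hull S - V) \<union> (closure W - W))"
    unfolding V_def
    by (intro meagre_Un meagre_closed_minus_interior closed_meagre_hull meagre_closure_minus_open open_W)
  ultimately show ?thesis by (rule meagre_mono[rotated])
qed

text \<open>
  A weak form of the Baire property of sets obtained by the Souslin operation. Off the meagre union of the
  sets from \<open>meagre_hull_minus_hulls\<close>, a point in the hull of \<open>C []\<close> lies in the hulls along a whole branch
  \<open>\<sigma>\<close>, hence in the closures along this branch, hence in \<open>C []\<close>. So \<open>C []\<close> and its closed hull differ by a
  meagre set.
\<close>

theorem souslin_meagre_or_locally_comeagre:
  fixes C :: "nat list \<Rightarrow> 'a::second_countable_topology set"
  assumes split: "\<And>s. C s = (\<Union>d. C (s @ [d]))"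
    and lim: "\<And>\<sigma>. (\<Inter>n. closure (C (map \<sigma> [0..<n]))) \<subseteq> C []"
    and nonmeagre: "\<not> meagre (C [])"
  shows "\<exists>V. open V \<and> V \<noteq> {} \<and> meagre (V - C [])"
proof -
  define M where "M = (\<Union>s. meagre_hull (C s) - (\<Union>d. meagre_hull (C (s @ [d]))))"
  have M: "meagre M"
    unfolding M_def by (intro meagre_UN meagre_hull_minus_hulls split) auto
  have in_C: "z \<in> C []" if z: "z \<in> meagre_hull (C [])" "z \<notin> M" for z
  proof -
    have "\<forall>s. \<exists>d. z \<in> meagre_hull (C s) \<longrightarrow> z \<in> meagre_hull (C (s @ [d]))"
      using z(2) by (auto simp: M_def)
    then obtain f where f: "\<And>s. z \<in> meagre_hull (C s) \<Longrightarrow> z \<in> meagre_hull (C (s @ [f s]))"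
      by metis
    define L where "L = rec_nat [] (\<lambda>n s. s @ [f s])"
    have L_0: "L 0 = []" and L_Suc: "L (Suc n) = L n @ [f (L n)]" for n by (simp_all add: L_def)
    have L_in: "z \<in> meagre_hull (C (L n))" for n
    proof (induction n)
      case 0 show ?case using z(1) by (simp add: L_0)
    next
      case (Suc n) then show ?case unfolding L_Suc by (rule f)
    qed
    have L_map: "map (\<lambda>n. f (L n)) [0..<n] = L n" for n
      by (induction n) (simp_all add: L_0 L_Suc)
    have "z \<in> (\<Inter>n. closure (C (map (\<lambda>n. f (L n)) [0..<n])))"
      unfolding L_map using L_in subsetD[OF meagre_hull_subset_closure] by blast
    then show ?thesis by (rule subsetD[OF lim])
  qed
  define V where "V = interior (meagre_hull (C []))"
  have "V \<noteq> {}"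
  proof
    assume "V = {}"
    then have "meagre (meagre_hull (C []))"
      by (intro meagre_closed closed_meagre_hull) (simp add: V_def)
    then have "meagre ((C [] - meagre_hull (C [])) \<union> meagre_hull (C []))"
      by (intro meagre_Un meagre_minus_hull)
    then have "meagre (C [])" by (rule meagre_mono) blast
    then show False using nonmeagre by simp
  qed
  moreover have "meagre (V - C [])"
    using interior_subset[of "meagre_hull (C [])"] in_C by (intro meagre_mono[OF M]) (auto simp: V_def)
  ultimately show ?thesis unfolding V_def by blast
qed

text \<open>
  The half of the Kuratowski-Ulam theorem that holds without the Baire property. For \<open>T\<close> closed without
  interior and \<open>U\<close> basic open, the points whose section of \<open>T\<close> contains \<open>U\<close> form a closed set without
  interior; away from these countably many sets all sections of \<open>T\<close> have empty interior.
\<close>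

lemma kuratowski_ulam:
  fixes M :: "('a::topological_space \<times> 'b::second_countable_topology) set"
  assumes "meagre M"
  shows "meagre {a. \<not> meagre {b. (a, b) \<in> M}}"
proof -
  obtain \<F> where \<F>: "countable \<F>" "\<And>T. T \<in> \<F> \<Longrightarrow> closed T" "\<And>T. T \<in> \<F> \<Longrightarrow> interior T = {}" "M \<subseteq> \<Union>\<F>"
    using assms by (auto simp: meagre_def)
  obtain \<B> :: "'b set set" where \<B>: "countable \<B>" "topological_basis \<B>"
    using ex_countable_basis by blast
  define E where "E T U = {a. \<forall>b\<in>U. (a, b) \<in> T}" for T :: "('a \<times> 'b) set" and U
  have slice: "{b. (a, b) \<in> T} = Pair a -` T" for a and T :: "('a \<times> 'b) set" by auto
  have closed_slice: "closed {b. (a, b) \<in> T}" if "T \<in> \<F>" for a T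
    unfolding slice using \<F>(2)[OF that] by (intro closed_vimage continuous_intros)
  have E: "meagre (E T U)" if T: "T \<in> \<F>" and U: "open U" "U \<noteq> {}" for T U
  proof (rule meagre_closed)
    have "E T U = (\<Inter>b\<in>U. (\<lambda>a. (a, b)) -` T)" by (auto simp: E_def)
    moreover have "closed ((\<lambda>a. (a, b)) -` T)" for b
      using \<F>(2)[OF T] by (intro closed_vimage continuous_intros)
    ultimately show "closed (E T U)" by auto
    have "interior (E T U) \<times> U \<subseteq> interior T"
    proof (rule interior_maximal)
      show "interior (E T U) \<times> U \<subseteq> T" using interior_subset[of "E T U"] by (auto simp: E_def)
      show "open (interior (E T U) \<times> U)" using U by (intro open_Times) auto
    qed
    then show "interior (E T U) = {}" using \<F>(3)[OF T] U(2) by auto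
  qed
  have "meagre (\<Union>(T,U)\<in>\<F> \<times> {U\<in>\<B>. U \<noteq> {}}. E T U)"
  proof (rule meagre_UN)
    have "countable {U \<in> \<B>. U \<noteq> {}}" by (rule countable_subset[OF _ \<B>(1)]) auto
    then show "countable (\<F> \<times> {U \<in> \<B>. U \<noteq> {}})" using \<F>(1) by (intro countable_SIGMA)
  qed (use E topological_basis_open[OF \<B>(2)] in auto)
  moreover have "meagre {b. (a, b) \<in> M}" if a: "a \<notin> (\<Union>(T,U)\<in>\<F> \<times> {U\<in>\<B>. U \<noteq> {}}. E T U)" for a
  proof -
    have "interior {b. (a, b) \<in> T} = {}" if T: "T \<in> \<F>" for T
    proof (rule ccontr)
      assume "interior {b. (a, b) \<in> T} \<noteq> {}"
      then obtain b where "b \<in> interior {b. (a, b) \<in> T}" by blast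
      then obtain U where U: "U \<in> \<B>" "b \<in> U" "U \<subseteq> interior {b. (a, b) \<in> T}"
        using topological_basisE[OF \<B>(2) open_interior] by metis
      from U have "U \<in> \<B>" "U \<noteq> {}" "a \<in> E T U"
        using interior_subset[of "{b. (a, b) \<in> T}"] by (auto simp: E_def)
      then show False using a T by auto
    qed
    then have "meagre (\<Union>T\<in>\<F>. {b. (a, b) \<in> T})"
      using \<F>(1) closed_slice by (intro meagre_UN meagre_closed)
    then show ?thesis by (rule meagre_mono) (use \<F>(4) in auto)
  qed
  ultimately show ?thesis by (elim meagre_mono) blast
qed

instance bool :: second_countable_topology
proof
  have "(open :: bool set \<Rightarrow> bool) = generate_topology UNIV"
    by (intro ext) (auto intro: generate_topology.Basis open_discrete)
  then show "\<exists>B :: bool set set. countable B \<and> open = generate_topology B"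
    by (intro exI[of _ UNIV]) (simp add: countable_finite)
qed

lemma cantor_open_not_meagre:
  fixes U :: "(nat \<Rightarrow> bool) set"
  assumes "open U" "U \<noteq> {}"
  shows "\<not> meagre U"
proof
  assume "meagre U"
  then obtain \<F> where \<F>: "countable \<F>" "\<And>T. T \<in> \<F> \<Longrightarrow> closed T \<and> interior T = {}" "U \<subseteq> \<Union>\<F>"
    by (auto simp: meagre_def)
  have "(euclidean :: bool topology) = discrete_topology UNIV"
    by (auto simp: topology_eq open_discrete)
  then have "completely_metrizable_space (euclidean :: bool topology)"
    by (simp add: completely_metrizable_space_discrete_topology)
  then have "completely_metrizable_space (product_topology (\<lambda>_. euclidean) UNIV :: (nat \<Rightarrow> bool) topology)"
    by (subst completely_metrizable_space_product_topology) auto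
  then have "completely_metrizable_space (euclidean :: (nat \<Rightarrow> bool) topology)"
    by (simp add: euclidean_product_topology)
  then have "euclidean interior_of \<Union>\<F> = {}"
    using \<F> by (intro Baire_category_alt) auto
  then have "interior (\<Union>\<F>) = {}" by simp
  then show False using assms interior_maximal[OF \<F>(3)] by blast
qed

text \<open>
  Otherwise \<open>C []\<close> is comeagre in a rectangle; then most sections over one side of the rectangle are both
  meagre and comeagre in the other side.
\<close>

theorem souslin_meagre_if_sections_meagre:
  fixes C :: "nat list \<Rightarrow> ((nat \<Rightarrow> bool) \<times> (nat \<Rightarrow> bool)) set"
  assumes split: "\<And>s. C s = (\<Union>d. C (s @ [d]))"
    and lim: "\<And>\<sigma>. (\<Inter>n. closure (C (map \<sigma> [0..<n]))) \<subseteq> C []"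
    and sections: "meagre {a. \<not> meagre {b. (a, b) \<in> C []}}"
  shows "meagre (C [])"
proof (rule ccontr)
  assume "\<not> meagre (C [])"
  then obtain V where V: "open V" "V \<noteq> {}" "meagre (V - C [])"
    using souslin_meagre_or_locally_comeagre[OF split lim] by blast
  then obtain O' P where OP: "open O'" "open P" "O' \<noteq> {}" "P \<noteq> {}" "O' \<times> P \<subseteq> V"
  proof -
    obtain z where "z \<in> V" using V(2) by blast
    then obtain O' P where "open O'" "open P" "z \<in> O' \<times> P" "O' \<times> P \<subseteq> V"
      by (rule open_prod_elim[OF V(1)])
    then show ?thesis by (intro that[of O' P]) auto
  qed
  have "meagre ({a. \<not> meagre {b. (a, b) \<in> C []}} \<union> {a. \<not> meagre {b. (a, b) \<in> V - C []}})"
    by (intro meagre_Un sections kuratowski_ulam V)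
  moreover have "\<not> meagre O'" using OP cantor_open_not_meagre by blast
  ultimately obtain a where a: "a \<in> O'" "meagre {b. (a, b) \<in> C []}" "meagre {b. (a, b) \<in> V - C []}"
    using meagre_mono by blast
  have "P \<subseteq> {b. (a, b) \<in> C []} \<union> {b. (a, b) \<in> V - C []}" using OP(5) a(1) by auto
  then have "meagre P" using a by (meson meagre_Un meagre_mono)
  then show False using OP cantor_open_not_meagre by blast
qed

section \<open>Reducing eventual equality to the complement of a meagre relation\<close>

definition cylinder :: "bool list \<Rightarrow> (nat \<Rightarrow> bool) set" where
  "cylinder s = {a. \<forall>i<length s. a i = s ! i}"

lemma cylinder_append: "cylinder (s @ t) \<subseteq> cylinder s"
  by (auto simp: cylinder_def nth_append)

lemma in_cylinder_map: "a \<in> cylinder (map a [0..<n])"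
  by (simp add: cylinder_def)

lemma open_cylinder: "open (cylinder s)"
proof -
  have "cylinder s = Pi\<^sub>E UNIV (\<lambda>i. if i < length s then {s ! i} else UNIV)"
    by (auto simp: cylinder_def PiE_iff split: if_splits)
  moreover have "open (Pi\<^sub>E UNIV (\<lambda>i. if i < length s then {s ! i} else UNIV))"
  proof (rule open_PiE)
    show "finite {i. (if i < length s then {s ! i} else UNIV) \<noteq> UNIV}"
      by (rule finite_subset[of _ "{..<length s}"]) auto
  qed (simp add: open_discrete)
  ultimately show ?thesis by simp
qed

lemma open_contains_cylinder:
  assumes "open U" "a \<in> U"
  shows "\<exists>n. cylinder (map a [0..<n]) \<subseteq> U"
proof -
  obtain X where X: "a \<in> Pi\<^sub>E UNIV X" "finite {i. X i \<noteq> UNIV}" "Pi\<^sub>E UNIV X \<subseteq> U"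
    using product_topology_open_contains_basis[of "\<lambda>_. euclidean" UNIV U a] assms
    unfolding open_fun_def by auto
  obtain n where n: "{i. X i \<noteq> UNIV} \<subseteq> {..<n}" using X(2) finite_nat_iff_bounded by blast
  have "cylinder (map a [0..<n]) \<subseteq> Pi\<^sub>E UNIV X"
  proof
    fix b assume b: "b \<in> cylinder (map a [0..<n])"
    have "b i \<in> X i" for i
    proof (cases "i < n")
      case True
      then have "b i = a i" using b by (simp add: cylinder_def)
      then show ?thesis using X(1) by auto
    next
      case False
      then have "X i = UNIV" using n by auto
      then show ?thesis by simp
    qed
    then show "b \<in> Pi\<^sub>E UNIV X" by auto
  qed
  then show ?thesis using X(3) by blast
qed

lemma cylinder_avoid:
  assumes T: "closed T" "interior T = {}" and len: "length s = length t"
  shows "\<exists>u v. length u = length v \<and> cylinder (s @ u) \<times> cylinder (t @ v) \<inter> T = {}"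
proof -
  have "open (cylinder s \<times> cylinder t)" by (intro open_Times open_cylinder)
  moreover have "cylinder s \<times> cylinder t \<noteq> {}"
  proof -
    have "(\<lambda>i. s ! i) \<in> cylinder s" "(\<lambda>i. t ! i) \<in> cylinder t" by (auto simp: cylinder_def)
    then show ?thesis by blast
  qed
  ultimately have "\<not> cylinder s \<times> cylinder t \<subseteq> T" using T(2) interior_maximal by blast
  then obtain a b where ab: "a \<in> cylinder s" "b \<in> cylinder t" "(a, b) \<in> - T" by auto
  have "open (- T)" using T(1) by auto
  then obtain O' P where OP: "open O'" "open P" "(a, b) \<in> O' \<times> P" "O' \<times> P \<subseteq> - T"
    by (rule open_prod_elim[OF _ ab(3)])
  obtain n where n: "cylinder (map a [0..<n]) \<subseteq> O'" using open_contains_cylinder[of O' a] OP by blast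
  obtain m where m: "cylinder (map b [0..<m]) \<subseteq> P" using open_contains_cylinder[of P b] OP by blast
  define l where "l = max (length s) (max n m)"
  define u where "u = map a [length s..<l]"
  define v where "v = map b [length t..<l]"
  have split: "map c [0..<l] = map c [0..<k] @ map c [k..<l]" if "k \<le> l" for c :: "nat \<Rightarrow> bool" and k
    using upt_add_eq_append[of 0 k "l - k"] that by simp
  have "s = map a [0..<length s]" "t = map b [0..<length t]"
    using ab by (auto simp: cylinder_def intro!: nth_equalityI)
  then have su: "s @ u = map a [0..<l]" and tv: "t @ v = map b [0..<l]"
    unfolding u_def v_def using split[of "length s"] split[of "length t"] len by (auto simp: l_def)
  have "cylinder (s @ u) \<subseteq> O'"
    using n cylinder_append split[of n a] unfolding su by (auto simp: l_def)
  moreover have "cylinder (t @ v) \<subseteq> P"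
    using m cylinder_append split[of m b] unfolding tv by (auto simp: l_def)
  moreover have "length u = length v" using len by (simp add: u_def v_def)
  ultimately show ?thesis using OP(4) by blast
qed

text \<open>
  The extensions are found for one pair of strings after the other; an extension that works for a pair keeps
  working when it is prolonged.
\<close>

lemma cylinder_avoid_finite:
  assumes T: "closed T" "interior T = {}" and "finite P"
    and "\<And>s t. (s, t) \<in> P \<Longrightarrow> length s = length t"
  shows "\<exists>u v. length u = length v \<and> (\<forall>(s, t)\<in>P. cylinder (s @ u) \<times> cylinder (t @ v) \<inter> T = {})"
  using assms(3,4)
proof (induction P)
  case empty
  show ?case by (intro exI[of _ "[]"]) simp
next
  case (insert p P)
  obtain s t where p: "p = (s, t)" by (cases p)
  obtain u v where uv: "length u = length v" "\<forall>(s, t)\<in>P. cylinder (s @ u) \<times> cylinder (t @ v) \<inter> T = {}"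
    using insert.IH insert.prems by blast
  have "length (s @ u) = length (t @ v)" using uv(1) insert.prems[of s t] by (simp add: p)
  then obtain u' v' where uv': "length u' = length v'" "cylinder ((s @ u) @ u') \<times> cylinder ((t @ v) @ v') \<inter> T = {}"
    using cylinder_avoid[OF T] by blast
  have "cylinder (s' @ u @ u') \<times> cylinder (t' @ v @ v') \<inter> T = {}" if "(s', t') \<in> P" for s' t'
  proof -
    have "cylinder (s' @ u) \<times> cylinder (t' @ v) \<inter> T = {}" using uv(2) that by blast
    moreover have "cylinder (s' @ u @ u') \<subseteq> cylinder (s' @ u)" "cylinder (t' @ v @ v') \<subseteq> cylinder (t' @ v)"
      using cylinder_append[of "s' @ u" u'] cylinder_append[of "t' @ v" v'] by simp_all
    ultimately show ?thesis by blast
  qed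
  then show ?case
    using uv' uv(1) by (intro exI[of _ "u @ u'"] exI[of _ "v @ v'"]) (auto simp: p)
qed

definition trues :: "bool list \<Rightarrow> nat" where
  "trues s = card {i. i < length s \<and> s ! i}"

lemma trues_count_list: "trues s = count_list s True"
  unfolding trues_def
proof (induction s rule: rev_induct)
  case (snoc x s)
  have "{i. i < length (s @ [x]) \<and> (s @ [x]) ! i} =
        {i. i < length s \<and> s ! i} \<union> (if x then {length s} else {})"
    by (auto simp: nth_append less_Suc_eq)
  moreover have "card ({i. i < length s \<and> s ! i} \<union> (if x then {length s} else {})) =
                 card {i. i < length s \<and> s ! i} + (if x then 1 else 0)"
    by (auto simp: card_insert_if)
  ultimately show ?case using snoc by simp
qed simp

lemma trues_append: "trues (s @ t) = trues s + trues t"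
  by (simp add: trues_count_list)

lemma trues_replicate: "trues (replicate n b) = (if b then n else 0)"
  by (induction n) (auto simp: trues_count_list)

definition balanced_pair :: "nat \<Rightarrow> ((nat \<Rightarrow> bool) \<times> (nat \<Rightarrow> bool)) set \<Rightarrow> bool list \<Rightarrow> bool list \<Rightarrow> bool" where
  "balanced_pair n T u v \<longleftrightarrow> length u = length v \<and> 0 < length u \<and> trues u = trues v \<and>
     (\<forall>s t. length s = n \<longrightarrow> length t = n \<longrightarrow> cylinder (s @ u) \<times> cylinder (t @ v) \<inter> T = {})"

text \<open>
  The common extensions from \<open>cylinder_avoid_finite\<close>, for all pairs of strings of length \<open>n\<close>, are padded so
  as to contain equally many ones. One more \<open>True\<close> makes them nonempty.
\<close>

lemma balanced_pair_exists:
  assumes T: "closed T" "interior T = {}"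
  shows "\<exists>u v. balanced_pair n T u v"
proof -
  have "finite ({s :: bool list. length s = n} \<times> {t :: bool list. length t = n})"
  proof -
    have "finite {s :: bool list. set s \<subseteq> UNIV \<and> length s = n}"
      by (rule finite_lists_length_eq) simp
    then have "finite {s :: bool list. length s = n}" by simp
    then show ?thesis by (intro finite_cartesian_product)
  qed
  then have "\<exists>u v. length u = length v \<and>
      (\<forall>(s, t)\<in>{s. length s = n} \<times> {t. length t = n}. cylinder (s @ u) \<times> cylinder (t @ v) \<inter> T = {})"
    by (rule cylinder_avoid_finite[OF T]) simp
  then obtain u v where uv': "length u = length v"
    "\<forall>(s, t)\<in>{s. length s = n} \<times> {t. length t = n}. cylinder (s @ u) \<times> cylinder (t @ v) \<inter> T = {}"
    by (elim exE conjE)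
  have uv: "cylinder (s @ u) \<times> cylinder (t @ v) \<inter> T = {}" if "length s = n" "length t = n" for s t
    using uv'(2) that by blast
  define p q where "p = trues u" and "q = trues v"
  define u' where "u' = u @ replicate (Suc q) True @ replicate p False"
  define v' where "v' = v @ replicate (Suc p) True @ replicate q False"
  have "cylinder (s @ u') \<times> cylinder (t @ v') \<inter> T = {}" if "length s = n" "length t = n" for s t
  proof -
    have "cylinder (s @ u') \<subseteq> cylinder (s @ u)" "cylinder (t @ v') \<subseteq> cylinder (t @ v)"
      unfolding u'_def v'_def by (metis append_assoc cylinder_append)+
    then show ?thesis using uv[OF that] by blast
  qed
  moreover have "length u' = length v'" "0 < length u'" "trues u' = trues v'"
    using uv'(1) by (auto simp: u'_def v'_def trues_append trues_replicate p_def q_def simp del: replicate_Suc)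
  ultimately show ?thesis unfolding balanced_pair_def by blast
qed

lemma meagre_closed_cover:
  assumes "meagre R"
  obtains T :: "nat \<Rightarrow> 'a::topological_space set" where "\<And>k. closed (T k)" "\<And>k. interior (T k) = {}"
    "\<And>k. T k \<subseteq> T (Suc k)" "R \<subseteq> (\<Union>k. T k)"
proof -
  obtain \<F> where \<F>: "countable \<F>" "\<And>T. T \<in> \<F> \<Longrightarrow> closed T" "\<And>T. T \<in> \<F> \<Longrightarrow> interior T = {}" "R \<subseteq> \<Union>\<F>"
    using assms unfolding meagre_def by metis
  define S where "S = from_nat_into (insert {} \<F>)"
  have S_range: "range S = insert {} \<F>"
    unfolding S_def using \<F>(1) by (intro range_from_nat_into) auto
  have S_in: "S k \<in> insert {} \<F>" for k using S_range by (metis rangeI)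
  have S: "closed (S k)" "interior (S k) = {}" for k
    using S_in[of k] \<F>(2,3) by auto
  show ?thesis
  proof (rule that[of "\<lambda>k. \<Union>i\<le>k. S i"])
    show "closed (\<Union>i\<le>k. S i)" for k by (intro closed_UN) (use S in auto)
    show "interior (\<Union>i\<le>k. S i) = {}" for k
    proof (induction k)
      case (Suc k)
      have "closed (\<Union>i\<le>k. S i)" by (intro closed_UN) (use S in auto)
      then show ?case
        using interior_closed_Un_empty_interior[of "\<Union>i\<le>k. S i" "S (Suc k)"] S Suc.IH
        by (simp add: atMost_Suc Un_commute)
    qed (simp add: S)
    show "(\<Union>i\<le>k. S i) \<subseteq> (\<Union>i\<le>Suc k. S i)" for k by (intro UN_mono) auto
    show "R \<subseteq> (\<Union>k. \<Union>i\<le>k. S i)"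
    proof
      fix x assume "x \<in> R"
      then have "x \<in> \<Union>(range S)" using \<F>(4) S_range by auto
      then obtain k where "x \<in> S k" by blast
      then show "x \<in> (\<Union>k. \<Union>i\<le>k. S i)" by blast
    qed
  qed
qed

text \<open>
  The value \<open>g x\<close> is the concatenation of strings \<open>u k\<close> or \<open>v k\<close> according to \<open>x k\<close>. These are chosen such
  that two points which disagree at \<open>k\<close> are sent outside the \<open>k\<close>-th closed set of an increasing cover
  \<open>T\<close> of \<open>R\<close>, whatever happened before stage \<open>k\<close>. Points that disagree infinitely often avoid all of \<open>R\<close>.
\<close>

theorem meagre_E0_antihomomorphism:
  fixes R :: "((nat \<Rightarrow> bool) \<times> (nat \<Rightarrow> bool)) set"
  assumes R: "meagre R"
  obtains g :: "(nat \<Rightarrow> bool) \<Rightarrow> nat \<Rightarrow> bool" where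
    "\<And>x y i. (\<And>j. j \<le> i \<Longrightarrow> x j = y j) \<Longrightarrow> g x i = g y i"
    "\<And>x y. E0 x y \<Longrightarrow> \<exists>n. (\<forall>i\<ge>n. g x i = g y i) \<and> card {i. i < n \<and> g x i} = card {i. i < n \<and> g y i}"
    "\<And>x y. \<not> E0 x y \<Longrightarrow> (g x, g y) \<notin> R"
proof -
  obtain T where T: "\<And>k. closed (T k)" "\<And>k. interior (T k) = {}" "\<And>k. T k \<subseteq> T (Suc k)" "R \<subseteq> (\<Union>k. T k)"
    using meagre_closed_cover[OF R] by metis
  have T_mono: "T k \<subseteq> T l" if "k \<le> l" for k l using that by (rule lift_Suc_mono_le[of T, OF T(3)])
  define swap :: "(nat \<Rightarrow> bool) \<times> (nat \<Rightarrow> bool) \<Rightarrow> _" where "swap = (\<lambda>(a, b). (b, a))"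
  have swap: "closed (swap -` C)" "interior (swap -` C) = {}" if C: "closed C" "interior C = {}" for C
  proof -
    have cont: "continuous_on UNIV swap"
      unfolding swap_def case_prod_unfold by (intro continuous_intros)
    show "closed (swap -` C)" by (rule closed_vimage[OF C(1) cont])
    have "open (swap -` interior (swap -` C))" by (rule open_vimage[OF open_interior cont])
    moreover have "swap -` interior (swap -` C) \<subseteq> C"
      using interior_subset[of "swap -` C"] by (auto simp: swap_def)
    ultimately have "swap -` interior (swap -` C) = {}" using C(2) interior_maximal by blast
    moreover have "surj swap" by (auto simp: swap_def surj_def)
    ultimately show "interior (swap -` C) = {}" by (metis surj_image_vimage_eq image_empty)
  qed
  (* Two points can disagree at stage k in either order, hence the symmetrised cover. *)
  define T' where "T' k = T k \<union> swap -` T k" for k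
  have T': "closed (T' k)" "interior (T' k) = {}" for k
    using T(1,2)[of k] swap[OF T(1,2)[of k]] interior_closed_Un_empty_interior[of "T k" "swap -` T k"]
    by (auto simp: T'_def)
  have "\<forall>n k. \<exists>w. balanced_pair n (T' k) (fst w) (snd w)"
    using balanced_pair_exists[OF T'] by simp
  then obtain step where step: "\<And>n k. balanced_pair n (T' k) (fst (step n k)) (snd (step n k))"
    by metis
  define N where "N = rec_nat 0 (\<lambda>k n. n + length (fst (step n k)))"
  define u where "u k = fst (step (N k) k)" for k
  define v where "v k = snd (step (N k) k)" for k
  have N_Suc: "N (Suc k) = N k + length (u k)" and N_0: "N 0 = 0" for k
    by (simp_all add: N_def u_def)
  have uv: "length (u k) = length (v k)" "0 < length (u k)" "trues (u k) = trues (v k)"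
    "\<And>s t. length s = N k \<Longrightarrow> length t = N k \<Longrightarrow> cylinder (s @ u k) \<times> cylinder (t @ v k) \<inter> T' k = {}" for k
    using step[of "N k" k] by (auto simp: balanced_pair_def u_def v_def)
  define pre where "pre x = rec_nat [] (\<lambda>k s. s @ (if x k then u k else v k))" for x :: "nat \<Rightarrow> bool"
  have pre_0: "pre x 0 = []" and pre_Suc: "pre x (Suc k) = pre x k @ (if x k then u k else v k)" for x k
    by (simp_all add: pre_def)
  have len: "length (pre x k) = N k" for x k
    by (induction k) (simp_all add: pre_0 pre_Suc N_0 N_Suc uv(1))
  have N_ge: "k \<le> N k" for k
  proof (induction k)
    case (Suc k)
    then show ?case using uv(2)[of k] by (simp add: N_Suc del: length_greater_0_conv)
  qed simp
  have N_mono: "N k \<le> N l" if "k \<le> l" for k l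
    by (rule lift_Suc_mono_le[of N, OF _ that]) (simp add: N_Suc)
  define g where "g x i = pre x (Suc i) ! i" for x i
  have pre_nth: "pre x l ! i = pre x k ! i" if "k \<le> l" "i < N k" for x k l i
    using that(1)
  proof (induction rule: dec_induct)
    case (step n)
    have "i < N n" using that(2) N_mono[OF step(1)] by linarith
    then show ?case using step.IH by (simp add: pre_Suc nth_append len)
  qed simp
  have g_pre: "g x i = pre x k ! i" if "i < N k" for x k i
  proof (cases "k \<le> Suc i")
    case True
    then show ?thesis unfolding g_def using that by (rule pre_nth)
  next
    case False
    then show ?thesis
      unfolding g_def using N_ge[of "Suc i"] by (intro pre_nth[symmetric]) auto
  qed
  have g_cylinder: "g x \<in> cylinder (pre x k)" for x k
    by (auto simp: cylinder_def len g_pre)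
  have pre_cong: "pre x k = pre y k" if "\<And>j. j < k \<Longrightarrow> x j = y j" for x y k
    using that by (induction k) (simp_all add: pre_0 pre_Suc)
  have trues_pre: "trues (pre x k) = trues (pre y k)" for x y k
    by (induction k) (simp_all add: pre_0 pre_Suc trues_append uv(3))
  have trues_g: "card {i. i < N k \<and> g x i} = trues (pre x k)" for x k
    unfolding trues_def len by (rule arg_cong[of _ _ card]) (auto simp: g_pre)
  show ?thesis
  proof (rule that)
    show "g x i = g y i" if "\<And>j. j \<le> i \<Longrightarrow> x j = y j" for x y i
      unfolding g_def using that pre_cong[of "Suc i" x y] by simp
  next
    fix x y assume "E0 x y"
    then obtain n where n: "\<And>m. m \<ge> n \<Longrightarrow> x m = y m" by (auto simp: E0_def)
    have drop: "drop (N n) (pre x k) = drop (N n) (pre y k)" if "n \<le> k" for k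
      using that
    proof (induction rule: dec_induct)
      case base
      then show ?case by (simp add: len)
    next
      case (step k)
      then show ?case using n[of k] N_mono[of n k] by (simp add: pre_Suc len)
    qed
    have "g x i = g y i" if i: "i \<ge> N n" for i
    proof -
      define k where "k = max n (Suc i)"
      have "i < N k" using N_ge[of k] by (simp add: k_def)
      then have "g z i = drop (N n) (pre z k) ! (i - N n)" for z
        using i by (simp add: g_pre len)
      then show ?thesis using drop[of k] by (simp add: k_def)
    qed
    then show "\<exists>n. (\<forall>i\<ge>n. g x i = g y i) \<and> card {i. i < n \<and> g x i} = card {i. i < n \<and> g y i}"
      using trues_pre[of x n y] by (intro exI[of _ "N n"]) (simp add: trues_g)
  next
    fix x y assume ne: "\<not> E0 x y"
    show "(g x, g y) \<notin> R"
    proof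
      assume "(g x, g y) \<in> R"
      then obtain k where k: "(g x, g y) \<in> T k" using T(4) by blast
      obtain l where l: "l \<ge> k" "x l \<noteq> y l" using ne by (auto simp: E0_def)
      have in_T: "(g x, g y) \<in> T l" using k T_mono[OF l(1)] by blast
      show False
      proof (cases "x l")
        case True
        then have "g x \<in> cylinder (pre x l @ u l)" "g y \<in> cylinder (pre y l @ v l)"
          using g_cylinder[of x "Suc l"] g_cylinder[of y "Suc l"] l by (auto simp: pre_Suc)
        then show False using uv(4)[OF len len, of x l y] in_T by (auto simp: T'_def)
      next
        case False
        then have "g x \<in> cylinder (pre x l @ v l)" "g y \<in> cylinder (pre y l @ u l)"
          using g_cylinder[of x "Suc l"] g_cylinder[of y "Suc l"] l by (auto simp: pre_Suc)
        moreover have "(g y, g x) \<in> T' l" using in_T by (simp add: T'_def swap_def)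
        ultimately show False using uv(4)[OF len len, of y l x] by blast
      qed
    qed
  qed
qed

section \<open>The embedding relation between coordinate subspaces\<close>

lemma closure_sequence_in:
  fixes x :: "'a::metric_space"
  assumes "x \<in> closure V"
  obtains X where "\<And>n. X n \<in> V" "X \<longlonglongrightarrow> x"
  using assms unfolding closure_sequential by blast

lemma extend_embedding_to_closure:
  fixes T :: "'a::real_normed_vector \<Rightarrow> 'b::banach"
  assumes V: "subspace V" and lin: "linear_on_set V T"
    and up: "\<And>x. x \<in> V \<Longrightarrow> norm (T x) \<le> K * norm x"
    and low: "\<And>x. x \<in> V \<Longrightarrow> norm x \<le> K * norm (T x)" and K: "K \<ge> 0"
  obtains g where "linear_on_set (closure V) g" "\<And>x. x \<in> V \<Longrightarrow> g x = T x"
    "\<And>x. x \<in> closure V \<Longrightarrow> norm (g x) \<le> K * norm x"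
    "\<And>x. x \<in> closure V \<Longrightarrow> norm x \<le> K * norm (g x)"
    "g ` closure V \<subseteq> closure (T ` V)"
proof -
  have "K-lipschitz_on V T"
  proof (rule lipschitz_onI[OF _ K])
    fix x y assume xy: "x \<in> V" "y \<in> V"
    show "dist (T x) (T y) \<le> K * dist x y"
      using up[OF subspace_diff[OF V xy]] linear_on_set_diff[OF lin V xy] by (simp add: dist_norm)
  qed
  then have "uniformly_continuous_on V T" by (rule lipschitz_on_uniformly_continuous)
  then obtain g where g: "uniformly_continuous_on (closure V) g" "\<And>x. x \<in> V \<Longrightarrow> T x = g x"
    using uniformly_continuous_on_extension_on_closure by metis
  have cont: "continuous_on (closure V) g" by (rule uniformly_continuous_imp_continuous[OF g(1)])
  have lim: "(\<lambda>n. T (X n)) \<longlonglongrightarrow> g x" if "\<And>n. X n \<in> V" "X \<longlonglongrightarrow> x" for X x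
  proof -
    have x: "x \<in> closure V" using that by (auto simp: closure_sequential)
    have "(\<lambda>n. g (X n)) \<longlonglongrightarrow> g x"
      by (rule continuous_on_tendsto_compose[OF cont that(2) x])
         (use that(1) closure_subset in \<open>auto intro!: always_eventually\<close>)
    then show ?thesis using g(2)[OF that(1)] by simp
  qed
  show ?thesis
  proof (rule that)
    show "linear_on_set (closure V) g"
      unfolding linear_on_set_def
    proof safe
      fix x y assume "x \<in> closure V" "y \<in> closure V"
      then obtain X Z where X: "\<And>n. X n \<in> V" "X \<longlonglongrightarrow> x" and Z: "\<And>n. Z n \<in> V" "Z \<longlonglongrightarrow> y"
        by (metis closure_sequence_in)
      have "(\<lambda>n. T (X n + Z n)) \<longlonglongrightarrow> g (x + y)"
        using X Z V by (intro lim tendsto_add) (auto intro: subspace_add)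
      moreover have "(\<lambda>n. T (X n) + T (Z n)) \<longlonglongrightarrow> g x + g y"
        using X Z by (intro tendsto_add lim)
      moreover have "T (X n + Z n) = T (X n) + T (Z n)" for n
        by (rule linear_on_set_add[OF lin X(1) Z(1)])
      ultimately show "g (x + y) = g x + g y" by (simp add: LIMSEQ_unique)
    next
      fix x c assume "x \<in> closure V"
      then obtain X where X: "\<And>n. X n \<in> V" "X \<longlonglongrightarrow> x" by (metis closure_sequence_in)
      have "(\<lambda>n. T (c *\<^sub>R X n)) \<longlonglongrightarrow> g (c *\<^sub>R x)"
        using X V by (intro lim tendsto_scaleR tendsto_const) (auto intro: subspace_scale)
      moreover have "(\<lambda>n. c *\<^sub>R T (X n)) \<longlonglongrightarrow> c *\<^sub>R g x"
        using X by (intro tendsto_scaleR tendsto_const lim)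
      moreover have "T (c *\<^sub>R X n) = c *\<^sub>R T (X n)" for n
        by (rule linear_on_set_scale[OF lin X(1)])
      ultimately show "g (c *\<^sub>R x) = c *\<^sub>R g x" by (simp add: LIMSEQ_unique)
    qed
    show "g x = T x" if "x \<in> V" for x using g(2)[OF that] by simp
    fix x assume "x \<in> closure V"
    then obtain X where X: "\<And>n. X n \<in> V" "X \<longlonglongrightarrow> x" by (metis closure_sequence_in)
    note l1 = tendsto_norm[OF lim[OF X]] and l2 = tendsto_norm[OF X(2)]
    show "norm (g x) \<le> K * norm x"
      by (rule LIMSEQ_le[OF l1 tendsto_mult[OF tendsto_const l2]]) (use up X(1) in auto)
    show "norm x \<le> K * norm (g x)"
      by (rule LIMSEQ_le[OF l2 tendsto_mult[OF tendsto_const l1]]) (use low X(1) in auto)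
  next
    show "g ` closure V \<subseteq> closure (T ` V)"
    proof
      fix y assume "y \<in> g ` closure V"
      then obtain x where x: "x \<in> closure V" "y = g x" by blast
      then obtain X where X: "\<And>n. X n \<in> V" "X \<longlonglongrightarrow> x" by (metis closure_sequence_in)
      show "y \<in> closure (T ` V)"
        unfolding closure_sequential x(2) using lim[OF X] X(1) by (intro exI[of _ "\<lambda>n. T (X n)"]) auto
    qed
  qed
qed

lemma embeds_mono: "embeds Z W \<Longrightarrow> W \<subseteq> W' \<Longrightarrow> embeds Z W'"
  unfolding embeds_def by (meson subset_trans)

context strong_mbasis
begin

definition embedding :: "real \<Rightarrow> nat set \<Rightarrow> nat set \<Rightarrow> ('a \<Rightarrow> 'a) \<Rightarrow> bool" where
  "embedding K A B T \<longleftrightarrow> linear_on_set (Y A) T \<and> T ` Y A \<subseteq> Y B \<and>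
     (\<forall>x\<in>Y A. norm (T x) \<le> K * norm x \<and> norm x \<le> K * norm (T x))"

lemma embedding_imp_embeds:
  assumes "embedding K A B T"
  shows "embeds (Y A) (Y B)"
  unfolding embeds_def using assms
  by (intro exI[of _ T] conjI isomorphism_onI[OF subspace_Y, of _ _ _ K K])
     (auto simp: embedding_def)

lemma embeds_imp_embedding:
  assumes "embeds (Y A) (Y B)"
  shows "\<exists>(n::nat) T. embedding (real n) A B T"
proof -
  obtain T where T: "T ` Y A \<subseteq> Y B" "isomorphism_on (Y A) norm (T ` Y A) norm T"
    using assms unfolding embeds_def by blast
  obtain K where K: "linear_on_set (Y A) T" "\<And>x. x \<in> Y A \<Longrightarrow> norm (T x) \<le> K * norm x"
    "\<And>x. x \<in> Y A \<Longrightarrow> norm x \<le> K * norm (T x)"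
    using isomorphism_onE[OF T(2)] by metis
  obtain n :: nat where n: "K \<le> real n" using real_arch_simple by blast
  have "K * t \<le> real n * t" if "t \<ge> 0" for t using n that by (rule mult_right_mono)
  then have "embedding (real n) A B T"
    unfolding embedding_def using K(1) T(1) order_trans[OF K(2)] order_trans[OF K(3)] by auto
  then show ?thesis by blast
qed

lemma Y_finite_expansion:
  assumes "x \<in> Y {..<N}"
  shows "x = (\<Sum>i<N. \<phi> i x *\<^sub>R e i)"
proof -
  have "\<phi> j (x - (\<Sum>i<N. \<phi> i x *\<^sub>R e i)) = 0" for j
    using assms by (simp add: coord_diff coord_finite_sum in_Y)
  then show ?thesis using coords_zero_imp_zero by force
qed

lemma countable_dense_set:
  obtains C :: "'a set" where "countable C" "closure C = UNIV"
proof -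
  define C where "C = range (\<lambda>l :: rat list. \<Sum>i<length l. of_rat (l ! i) *\<^sub>R e i)"
  have "(\<Sum>i<N. c i *\<^sub>R e i) \<in> closure C" for N and c :: "nat \<Rightarrow> real"
    unfolding closure_approachable
  proof safe
    fix \<epsilon> :: real assume \<epsilon>: "\<epsilon> > 0"
    (* The N errors then add up to at most \<epsilon> N / (N + 1). *)
    define \<delta> where "\<delta> = (\<lambda>i. \<epsilon> / (real (Suc N) * (norm (e i) + 1)))"
    have e_pos: "norm (e i) + 1 > 0" for i by (simp add: add_nonneg_pos)
    have \<delta>: "\<delta> i > 0" for i
      using \<epsilon> e_pos[of i] by (simp add: \<delta>_def del: of_nat_Suc)
    have "\<exists>r. \<bar>of_rat r - c i\<bar> < \<delta> i" for i
    proof -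
      obtain r where "c i - \<delta> i < of_rat r" "of_rat r < c i + \<delta> i"
        using of_rat_dense[of "c i - \<delta> i" "c i + \<delta> i"] \<delta>[of i] by auto
      then have "\<bar>of_rat r - c i\<bar> < \<delta> i" by linarith
      then show ?thesis by blast
    qed
    then obtain r where r: "\<And>i. \<bar>of_rat (r i) - c i\<bar> < \<delta> i" by metis
    define l where "l = map r [0..<N]"
    have "dist (\<Sum>i<N. of_rat (r i) *\<^sub>R e i) (\<Sum>i<N. c i *\<^sub>R e i) = norm (\<Sum>i<N. (of_rat (r i) - c i) *\<^sub>R e i)"
      by (simp add: dist_norm sum_subtractf scaleR_diff_left)
    also have "\<dots> \<le> (\<Sum>i<N. \<epsilon> / real (Suc N))"
    proof (rule sum_norm_le)
      fix i
      have "norm ((of_rat (r i) - c i) *\<^sub>R e i) \<le> \<delta> i * (norm (e i) + 1)"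
        using r[of i] by (simp add: mult_mono less_imp_le)
      also have "\<dots> = \<epsilon> / real (Suc N)"
        using e_pos[of i] by (simp add: \<delta>_def)
      finally show "norm ((of_rat (r i) - c i) *\<^sub>R e i) \<le> \<epsilon> / real (Suc N)" .
    qed
    also have "\<dots> < \<epsilon>" using \<epsilon> by (simp add: field_simps)
    finally have "dist (\<Sum>i<length l. of_rat (l ! i) *\<^sub>R e i) (\<Sum>i<N. c i *\<^sub>R e i) < \<epsilon>"
      by (simp add: l_def)
    then show "\<exists>y\<in>C. dist y (\<Sum>i<N. c i *\<^sub>R e i) < \<epsilon>" unfolding C_def by blast
  qed
  then have fin: "Y {..<N} \<subseteq> closure C" for N using Y_finite_expansion by (metis subsetI)
  have "span (range e) \<subseteq> closure C"
  proof
    fix x assume "x \<in> span (range e)"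
    then obtain N where "x \<in> Y (UNIV \<inter> {..<N})" by (rule span_e_finite_support)
    then show "x \<in> closure C" using fin by auto
  qed
  then have "closure (span (range e)) \<subseteq> closure C" by (rule closure_minimal) simp
  then have "closure C = UNIV" using Y_eq_closure_span[of UNIV] by (auto simp: Y_UNIV)
  moreover have "countable C" unfolding C_def by auto
  ultimately show ?thesis by (rule that[rotated])
qed

definition dense_seq :: "nat \<Rightarrow> 'a" where
  "dense_seq = (SOME q. \<forall>x. \<forall>\<epsilon>>0. \<exists>d. norm (x - q d) \<le> \<epsilon>)"

lemma dense_seq_approx: "\<epsilon> > 0 \<Longrightarrow> \<exists>d. norm (x - dense_seq d) \<le> \<epsilon>"
proof -
  obtain C :: "'a set" where C: "countable C" "closure C = UNIV" by (rule countable_dense_set)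
  have "C \<noteq> {}" using C(2) by auto
  then have range: "range (from_nat_into C) = C" using C(1) by (simp add: range_from_nat_into)
  have "\<exists>d. norm (x - from_nat_into C d) \<le> \<epsilon>" if "\<epsilon> > 0" for x \<epsilon>
  proof -
    have "x \<in> closure C" using C(2) by simp
    then obtain y where y: "y \<in> C" "dist y x < \<epsilon>"
      using \<open>\<epsilon> > 0\<close> unfolding closure_approachable by blast
    then obtain d where "y = from_nat_into C d" using range by (metis imageE)
    then show ?thesis using y(2) by (intro exI[of _ d]) (simp add: dist_norm norm_minus_commute)
  qed
  then have "\<exists>q :: nat \<Rightarrow> 'a. \<forall>x. \<forall>\<epsilon>>0. \<exists>d. norm (x - q d) \<le> \<epsilon>" by blast
  from someI_ex[OF this] show "\<epsilon> > 0 \<Longrightarrow> \<exists>d. norm (x - dense_seq d) \<le> \<epsilon>"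
    unfolding dense_seq_def by blast
qed

text \<open>
  The entry \<open>d\<close> at the place \<open>p\<close> of a branch promises an approximation of \<open>T (e i)\<close> with error \<open>(1/2) ^ k\<close>,
  where \<open>p\<close> codes \<open>(i, k)\<close>. Nothing is promised when \<open>e i\<close> is outside the domain \<open>Y {i. a i}\<close> of \<open>T\<close>.
\<close>

definition approximates :: "nat \<Rightarrow> nat \<Rightarrow> ('a \<Rightarrow> 'a) \<Rightarrow> (nat \<Rightarrow> bool) \<Rightarrow> bool" where
  "approximates p d T a \<longleftrightarrow> (case prod_decode p of (i, k) \<Rightarrow>
     a i \<longrightarrow> norm (T (e i) - dense_seq d) \<le> (1/2) ^ k)"

text \<open>
  The Souslin scheme of the embedding relation: a full branch determines the embedding \<open>T\<close>, while a finite
  sequence \<open>s\<close> constrains \<open>T\<close> at finitely many vectors up to an error.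
\<close>

definition emb_tree :: "real \<Rightarrow> nat list \<Rightarrow> ((nat \<Rightarrow> bool) \<times> (nat \<Rightarrow> bool)) set" where
  "emb_tree K s = {(a, b). \<exists>T. embedding K {i. a i} {i. b i} T \<and>
     (\<forall>p<length s. approximates p (s ! p) T a)}"

lemma emb_tree_Nil: "emb_tree K [] = {(a, b). \<exists>T. embedding K {i. a i} {i. b i} T}"
  by (simp add: emb_tree_def)

lemma emb_tree_split: "emb_tree K s = (\<Union>d. emb_tree K (s @ [d]))"
proof
  show "emb_tree K s \<subseteq> (\<Union>d. emb_tree K (s @ [d]))"
  proof
    fix z assume z: "z \<in> emb_tree K s"
    obtain a b where ab: "z = (a, b)" by (cases z)
    obtain T where T: "embedding K {i. a i} {i. b i} T"
      "\<And>p. p < length s \<Longrightarrow> approximates p (s ! p) T a"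
      using z unfolding ab emb_tree_def by blast
    obtain i k where ik: "prod_decode (length s) = (i, k)" by fastforce
    obtain d where "norm (T (e i) - dense_seq d) \<le> (1/2) ^ k"
      using dense_seq_approx[of "(1/2) ^ k"] by (metis half_gt_zero_iff zero_less_one zero_less_power)
    then have d: "approximates (length s) d T a" by (simp add: approximates_def ik)
    have "(a, b) \<in> emb_tree K (s @ [d])"
      unfolding emb_tree_def using T d by (auto simp: nth_append less_Suc_eq intro!: exI[of _ T])
    then show "z \<in> (\<Union>d. emb_tree K (s @ [d]))" using ab by blast
  qed
  show "(\<Union>d. emb_tree K (s @ [d])) \<subseteq> emb_tree K s"
    unfolding emb_tree_def by (auto simp: nth_append less_Suc_eq)
qed

text \<open>
  A point in the closures along a branch is the limit of pairs \<open>(a' n, b' n)\<close> with embeddings \<open>T n\<close> that are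
  compatible with longer and longer parts of the branch. On each \<open>e i\<close> the \<open>T n\<close> converge, because they are
  eventually within \<open>(1/2) ^ k\<close> of the same point, for every \<open>k\<close>. Their limit on the span extends to the
  closure, and the norm bounds and the vanishing of the coordinates outside \<open>b\<close> pass to the limit.
\<close>

lemma emb_tree_limit:
  assumes K: "K \<ge> 0"
  shows "(\<Inter>n. closure (emb_tree K (map \<sigma> [0..<n]))) \<subseteq> emb_tree K []"
proof
  fix z assume z: "z \<in> (\<Inter>n. closure (emb_tree K (map \<sigma> [0..<n])))"
  obtain a b where ab: "z = (a, b)" by (cases z)
  have "\<exists>a' b' T. a' \<in> cylinder (map a [0..<n]) \<and> b' \<in> cylinder (map b [0..<n]) \<and>
     embedding K {i. a' i} {i. b' i} T \<and> (\<forall>p<n. approximates p (\<sigma> p) T a')" for n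
  proof -
    have "open (cylinder (map a [0..<n]) \<times> cylinder (map b [0..<n]))" by (intro open_Times open_cylinder)
    moreover have "z \<in> cylinder (map a [0..<n]) \<times> cylinder (map b [0..<n])" by (simp add: ab in_cylinder_map)
    moreover have "z \<in> closure (emb_tree K (map \<sigma> [0..<n]))" using z by blast
    ultimately have "cylinder (map a [0..<n]) \<times> cylinder (map b [0..<n]) \<inter> emb_tree K (map \<sigma> [0..<n]) \<noteq> {}"
      using open_Int_closure_eq_empty by blast
    then obtain a' b' where a'b': "a' \<in> cylinder (map a [0..<n])" "b' \<in> cylinder (map b [0..<n])"
      "(a', b') \<in> emb_tree K (map \<sigma> [0..<n])" by blast
    then obtain T where "embedding K {i. a' i} {i. b' i} T" "\<forall>p<n. approximates p (\<sigma> p) T a'"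
      unfolding emb_tree_def by auto
    then show ?thesis using a'b' by blast
  qed
  then obtain a' b' T where cylinder: "\<And>n. a' n \<in> cylinder (map a [0..<n])" "\<And>n. b' n \<in> cylinder (map b [0..<n])"
    and emb: "\<And>n. embedding K {i. a' n i} {i. b' n i} (T n)"
    and near: "\<And>n p. p < n \<Longrightarrow> approximates p (\<sigma> p) (T n) (a' n)"
    by metis
  have agree: "a' n i = a i" "b' n i = b i" if "i < n" for n i
    using cylinder[of n] that by (auto simp: cylinder_def)
  have lin: "linear_on_set (Y {i. a' n i}) (T n)" and into: "T n ` Y {i. a' n i} \<subseteq> Y {i. b' n i}"
    and bounds: "\<And>x. x \<in> Y {i. a' n i} \<Longrightarrow> norm (T n x) \<le> K * norm x"
      "\<And>x. x \<in> Y {i. a' n i} \<Longrightarrow> norm x \<le> K * norm (T n x)" for n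
    using emb[of n] by (auto simp: embedding_def)
  define V where "V = span (e ` {i. a i})"
  define G where "G = {v. (\<forall>\<^sub>F n in sequentially. v \<in> Y {i. a' n i}) \<and> convergent (\<lambda>n. T n v)}"
  have ev_add: "\<forall>\<^sub>F n in sequentially. T n (x + y) = T n x + T n y"
    if "x \<in> G" "y \<in> G" for x y
  proof -
    have "\<forall>\<^sub>F n in sequentially. x \<in> Y {i. a' n i} \<and> y \<in> Y {i. a' n i}"
      using that by (auto simp: G_def intro: eventually_conj)
    then show ?thesis by (rule eventually_mono) (use linear_on_set_add[OF lin] in auto)
  qed
  have ev_scale: "\<forall>\<^sub>F n in sequentially. T n (c *\<^sub>R x) = c *\<^sub>R T n x" if "x \<in> G" for c x
  proof -
    have "\<forall>\<^sub>F n in sequentially. x \<in> Y {i. a' n i}" using that by (auto simp: G_def)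
    then show ?thesis by (rule eventually_mono) (use linear_on_set_scale[OF lin] in auto)
  qed
  have e_G: "e i \<in> G" if i: "a i" for i
  proof -
    have ai: "a' n i" if "i < n" for n using agree(1)[OF that] i by simp
    have "Cauchy (\<lambda>n. T n (e i))"
    proof (rule metric_CauchyI)
      fix \<epsilon> :: real assume "\<epsilon> > 0"
      then obtain k where k: "(1/2::real) ^ k < \<epsilon> / 2"
        using real_arch_pow_inv[of "\<epsilon> / 2" "1/2"] by auto
      define p where "p = prod_encode (i, k)"
      have nr: "dist (T n (e i)) (dense_seq (\<sigma> p)) \<le> (1/2) ^ k" if "n > max i p" for n
        using near[of p n] ai[of n] that by (simp add: approximates_def p_def dist_norm)
      have "dist (T m (e i)) (T n (e i)) < \<epsilon>" if "m \<ge> Suc (max i p)" "n \<ge> Suc (max i p)" for m n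
        using nr[of m] nr[of n] that k dist_triangle2[of "T m (e i)" "T n (e i)" "dense_seq (\<sigma> p)"] by linarith
      then show "\<exists>M. \<forall>m\<ge>M. \<forall>n\<ge>M. dist (T m (e i)) (T n (e i)) < \<epsilon>" by blast
    qed
    then have "convergent (\<lambda>n. T n (e i))" by (simp add: Cauchy_convergent_iff)
    moreover have "\<forall>\<^sub>F n in sequentially. e i \<in> Y {i. a' n i}"
      using eventually_gt_at_top[of i] by eventually_elim (simp add: e_in_Y ai)
    ultimately show ?thesis by (simp add: G_def)
  qed
  have sub_G: "subspace G"
  proof (rule subspaceI)
    have "T n 0 = 0" for n by (rule linear_on_set_zero[OF lin subspace_Y])
    then show "0 \<in> G" by (simp add: G_def subspace_0[OF subspace_Y] convergent_const)
  next
    fix x y assume xy: "x \<in> G" "y \<in> G"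
    then have "\<forall>\<^sub>F n in sequentially. x \<in> Y {i. a' n i} \<and> y \<in> Y {i. a' n i}"
      by (auto simp: G_def intro: eventually_conj)
    then have "\<forall>\<^sub>F n in sequentially. x + y \<in> Y {i. a' n i}"
      by (rule eventually_mono) (auto intro: subspace_add[OF subspace_Y])
    moreover have "convergent (\<lambda>n. T n x + T n y)" using xy by (auto simp: G_def intro: convergent_add)
    then have "convergent (\<lambda>n. T n (x + y))" using convergent_cong[OF ev_add[OF xy]] by simp
    ultimately show "x + y \<in> G" by (simp add: G_def)
  next
    fix c x assume x: "x \<in> G"
    then have "\<forall>\<^sub>F n in sequentially. x \<in> Y {i. a' n i}" by (auto simp: G_def)
    then have "\<forall>\<^sub>F n in sequentially. c *\<^sub>R x \<in> Y {i. a' n i}"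
      by (rule eventually_mono) (auto intro: subspace_scale[OF subspace_Y])
    moreover have "convergent (\<lambda>n. c *\<^sub>R T n x)"
      using x by (auto simp: G_def convergent_def intro: tendsto_scaleR[OF tendsto_const])
    then have "convergent (\<lambda>n. T n (c *\<^sub>R x))" using convergent_cong[OF ev_scale[OF x]] by simp
    ultimately show "c *\<^sub>R x \<in> G" by (simp add: G_def)
  qed
  have VG: "V \<subseteq> G" unfolding V_def by (intro span_minimal sub_G) (use e_G in auto)
  define T0 where "T0 v = lim (\<lambda>n. T n v)" for v
  have T0: "(\<lambda>n. T n v) \<longlonglongrightarrow> T0 v" and ev: "\<forall>\<^sub>F n in sequentially. v \<in> Y {i. a' n i}" if "v \<in> V" for v
    using VG that by (auto simp: G_def T0_def convergent_LIMSEQ_iff)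
  have V: "subspace V" by (simp add: V_def)
  have lin0: "linear_on_set V T0"
    unfolding linear_on_set_def
  proof safe
    fix x y assume xy: "x \<in> V" "y \<in> V"
    have "(\<lambda>n. T n (x + y)) \<longlonglongrightarrow> T0 x + T0 y"
      by (rule Lim_transform_eventually[OF tendsto_add[OF T0[OF xy(1)] T0[OF xy(2)]]],
          rule eventually_mono[OF ev_add[of x y]]) (use xy VG in auto)
    then show "T0 (x + y) = T0 x + T0 y" using T0[OF subspace_add[OF V xy]] LIMSEQ_unique by blast
  next
    fix c x assume x: "x \<in> V"
    have "(\<lambda>n. T n (c *\<^sub>R x)) \<longlonglongrightarrow> c *\<^sub>R T0 x"
      by (rule Lim_transform_eventually[OF tendsto_scaleR[OF tendsto_const T0[OF x]]],
          rule eventually_mono[OF ev_scale[of x c]]) (use x VG in auto)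
    then show "T0 (c *\<^sub>R x) = c *\<^sub>R T0 x" using T0[OF subspace_scale[OF V x]] LIMSEQ_unique by blast
  qed
  have up0: "norm (T0 x) \<le> K * norm x" if "x \<in> V" for x
    by (rule tendsto_upperbound[OF tendsto_norm[OF T0[OF that]]])
       (use bounds(1) in \<open>auto intro: eventually_mono[OF ev[OF that]]\<close>)
  have low0: "norm x \<le> K * norm (T0 x)" if "x \<in> V" for x
    by (rule tendsto_lowerbound[OF tendsto_mult[OF tendsto_const tendsto_norm[OF T0[OF that]]]])
       (use bounds(2) in \<open>auto intro: eventually_mono[OF ev[OF that]]\<close>)
  have into0: "T0 x \<in> Y {i. b i}" if x: "x \<in> V" for x
    unfolding in_Y
  proof (intro allI impI)
    fix j assume j: "j \<notin> {i. b i}"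
    have "\<forall>\<^sub>F n in sequentially. \<phi> j (T n x) = 0"
      using ev[OF x] eventually_gt_at_top[of j]
    proof eventually_elim
      case (elim n)
      then have "T n x \<in> Y {i. b' n i}" using into by blast
      then show ?case using agree(2)[OF elim(2)] j by (simp add: in_Y)
    qed
    then have "(\<lambda>n. \<phi> j (T n x)) \<longlonglongrightarrow> 0" by (rule tendsto_eventually)
    then show "\<phi> j (T0 x) = 0" using coord_tendsto[OF T0[OF x]] LIMSEQ_unique by blast
  qed
  obtain g where g: "linear_on_set (closure V) g" "\<And>x. x \<in> closure V \<Longrightarrow> norm (g x) \<le> K * norm x"
    "\<And>x. x \<in> closure V \<Longrightarrow> norm x \<le> K * norm (g x)" "g ` closure V \<subseteq> closure (T0 ` V)"
    using extend_embedding_to_closure[OF V lin0 up0 low0 K] by metis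
  have "closure (T0 ` V) \<subseteq> Y {i. b i}" using into0 by (intro closure_minimal closed_Y) auto
  moreover have "closure V = Y {i. a i}" by (simp add: V_def Y_eq_closure_span)
  ultimately have "embedding K {i. a i} {i. b i} g" using g by (auto simp: embedding_def)
  then show "z \<in> emb_tree K []" by (auto simp: emb_tree_Nil ab)
qed

text \<open>
  If \<open>b\<close> misses infinitely many of the finite sets \<open>J i\<close> of indices whose block is in \<open>I i\<close>, then tightness
  forbids an embedding. The \<open>b\<close> that meet all \<open>J i\<close> with \<open>i \<ge> m\<close> form a closed set, and it has no interior
  since a condition on finitely many coordinates does not concern \<open>J i\<close> for large \<open>i\<close>.
\<close>

lemma tight_imp_meagre:
  assumes tight: "tight_in Z F" and e_F: "\<And>j. e j \<in> F (blk j)" and fin: "\<And>n. finite {j. blk j = n}"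
  shows "meagre {b. embeds Z (Y {i. b i})}"
proof -
  obtain I where I: "\<And>i. \<exists>a b. a \<le> b \<and> I i = {a..b::nat}"
    and I_less: "\<And>i m n. m \<in> I i \<Longrightarrow> n \<in> I (Suc i) \<Longrightarrow> m < n"
    and no_emb: "\<And>A. infinite A \<Longrightarrow> \<not> embeds Z (closed_span F (- (\<Union>i\<in>A. I i)))"
    using tight unfolding tight_in_def by metis
  have I_fin: "finite (I i)" and I_ne: "I i \<noteq> {}" for i using I[of i] by auto
  have I_ge: "i \<le> n" if "n \<in> I i" for i n
    using that
  proof (induction i arbitrary: n)
    case (Suc i)
    obtain m where "m \<in> I i" using I_ne by blast
    then show ?case using Suc.IH[of m] I_less[of m i n] Suc.prems by linarith
  qed simp
  define J where "J i = {j. blk j \<in> I i}" for i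
  have J_fin: "finite (J i)" for i
  proof -
    have "J i = (\<Union>n\<in>I i. {j. blk j = n})" by (auto simp: J_def)
    then show ?thesis using I_fin fin by auto
  qed
  define E where "E m = {b :: nat \<Rightarrow> bool. \<forall>i\<ge>m. \<exists>j\<in>J i. b j}" for m :: nat
  have "meagre (E m)" for m
  proof (rule meagre_closed)
    have "E m = (\<Inter>i\<in>{m..}. \<Union>j\<in>J i. (\<lambda>b. b j) -` {True})" by (auto simp: E_def)
    moreover have "closed ((\<lambda>b :: nat \<Rightarrow> bool. b j) -` {True})" for j
      by (intro closed_vimage closed_singleton continuous_on_product_coordinates)
    ultimately show "closed (E m)" using J_fin by (auto intro!: closed_INT closed_UN)
    show "interior (E m) = {}"
    proof (rule ccontr)
      assume "interior (E m) \<noteq> {}"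
      then obtain a where "a \<in> interior (E m)" by blast
      then obtain n where n: "cylinder (map a [0..<n]) \<subseteq> E m"
        using open_contains_cylinder[OF open_interior, of a "E m"] interior_subset[of "E m"] by blast
      define b where "b i = (i < n \<and> a i)" for i
      have "b \<in> cylinder (map a [0..<n])" by (simp add: cylinder_def b_def)
      then have bE: "b \<in> E m" using n by blast
      (* The sum is a bound for the blocks of all indices below n. *)
      define i where "i = max m (Suc (\<Sum>j<n. blk j))"
      have "m \<le> i" by (simp add: i_def)
      then obtain j where j: "j \<in> J i" "b j" using bE unfolding E_def by blast
      then have "i \<le> blk j" "j < n" using I_ge by (auto simp: J_def b_def)
      moreover have "blk j \<le> (\<Sum>j<n. blk j)" using \<open>j < n\<close> by (intro member_le_sum) auto
      ultimately show False by (simp add: i_def)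
    qed
  qed
  then have "meagre (\<Union>m. E m)" by (intro meagre_UN) auto
  then show ?thesis
  proof (rule meagre_mono)
    show "{b. embeds Z (Y {i. b i})} \<subseteq> (\<Union>m. E m)"
    proof
      fix b assume b: "b \<in> {b. embeds Z (Y {i. b i})}"
      show "b \<in> (\<Union>m. E m)"
      proof (rule ccontr)
        assume "b \<notin> (\<Union>m. E m)"
        then have "\<forall>m. \<exists>i\<ge>m. i \<in> {i. \<forall>j\<in>J i. \<not> b j}" by (auto simp: E_def)
        then have inf: "infinite {i. \<forall>j\<in>J i. \<not> b j}" by (rule infinite_nat_iff_unbounded_le[THEN iffD2])
        have "e ` {i. b i} \<subseteq> (\<Union>n\<in>- (\<Union>i\<in>{i. \<forall>j\<in>J i. \<not> b j}. I i). F n)"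
          using e_F by (fastforce simp: J_def)
        then have "Y {i. b i} \<subseteq> closed_span F (- (\<Union>i\<in>{i. \<forall>j\<in>J i. \<not> b j}. I i))"
          unfolding Y_eq_closure_span closed_span_def by (intro closure_mono span_mono)
        then show False using embeds_mono no_emb[OF inf] b by blast
      qed
    qed
  qed
qed

text \<open>
  For each of the open sets that make up \<open>H\<close>, a finite condition \<open>a\<close> below \<open>n\<close> is first extended by ones. The
  resulting space has finite codimension and therefore belongs to \<open>H\<close>, and by
  \<open>ellentuck_open_locally_determined\<close> finitely many of these ones keep the space in the open set.
\<close>

lemma D_family_residual:
  assumes H: "D_family H" and X: "UNIV \<in> H"
  shows "meagre {a. Y {i. a i} \<notin> H}"
proof -
  obtain \<U> where \<U>: "countable \<U>" "\<And>U. U \<in> \<U> \<Longrightarrow> openin ellentuck U" "\<Inter>\<U> = H"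
  proof -
    have "(countable intersection_of openin ellentuck) H"
      using H by (simp add: D_family_def gdelta_in_alt)
    then obtain \<U> where "countable \<U>" "\<U> \<subseteq> Collect (openin ellentuck)" "\<Inter>\<U> = H"
      unfolding intersection_of_def by blast
    then show ?thesis by (intro that[of \<U>]) auto
  qed
  have cofinite: "Y A \<in> H" if A: "{n..} \<subseteq> A" for n A
  proof -
    define G where "G = span (e ` {..<n})"
    have G: "fin_dim G" unfolding fin_dim_def G_def by blast
    have "infinite A" using A infinite_Ici[of n] finite_subset by blast
    then have YA: "Y A \<in> Sub_inf" using Y_infinite_dim Y_in_Sub by (auto simp: Sub_inf_def)
    have "x \<in> {y + f | y f. y \<in> Y A \<and> f \<in> G}" for x
    proof -
      define f where "f = (\<Sum>i<n. \<phi> i x *\<^sub>R e i)"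
      have f: "f \<in> G" unfolding f_def G_def by (intro span_sum span_scale span_base) auto
      have "\<phi> j (x - f) = 0" if "j < n" for j
        using that by (simp add: f_def coord_diff coord_finite_sum)
      moreover have "j < n" if "j \<notin> A" for j using A that by (meson atLeast_iff not_le subsetD)
      ultimately have "x - f \<in> Y A" by (simp add: in_Y)
      then show ?thesis using f by (intro CollectI exI[of _ "x - f"] exI[of _ f]) simp
    qed
    then have sum: "{y + f | y f. y \<in> Y A \<and> f \<in> G} = UNIV" by blast
    have "Y A \<in> H \<longleftrightarrow> {y + f | y f. y \<in> Y A \<and> f \<in> G} \<in> H"
      using H YA G unfolding D_family_def by blast
    then show ?thesis unfolding sum using X by simp
  qed
  have "meagre {a. Y {i. a i} \<notin> U}" if U: "U \<in> \<U>" for U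
  proof -
    define W where "W = \<Union>{cylinder s | s. \<forall>a\<in>cylinder s. Y {i. a i} \<in> U}"
    have "meagre (- W)"
    proof (rule meagre_closed)
      have "open W" unfolding W_def using open_cylinder by (intro open_Union) auto
      then show "closed (- W)" by auto
      show "interior (- W) = {}"
      proof (rule ccontr)
        assume "interior (- W) \<noteq> {}"
        then obtain a where "a \<in> interior (- W)" by blast
        then obtain n where n: "cylinder (map a [0..<n]) \<subseteq> - W"
          using open_contains_cylinder[OF open_interior, of a "- W"] interior_subset[of "- W"] by blast
        define a' where "a' i = (i < n \<longrightarrow> a i)" for i
        have "a' \<in> cylinder (map a [0..<n])" by (simp add: cylinder_def a'_def)
        then have a'W: "a' \<notin> W" using n by blast
        have "Y {i. a' i} \<in> H" by (rule cofinite[of n]) (auto simp: a'_def)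
        then have "Y {i. a' i} \<in> U" using \<U>(3) U by blast
        then obtain N where N: "\<And>B. B \<subseteq> {i. a' i} \<Longrightarrow> {i. a' i} \<inter> {..<N} \<subseteq> B \<Longrightarrow> Y B \<in> U"
          using ellentuck_open_locally_determined[OF \<U>(2)[OF U]] by blast
        define s where "s = map a' [0..<max n N]"
        have "Y {i. b i} \<in> U" if "b \<in> cylinder s" for b
        proof (rule N)
          have b: "b i = a' i" if "i < max n N" for i
            using \<open>b \<in> cylinder s\<close> that by (simp add: s_def cylinder_def del: max_less_iff_conj)
          show "{i. b i} \<subseteq> {i. a' i}"
          proof safe
            fix i assume "b i"
            then show "a' i" using b[of i] by (cases "i < n") (auto simp: a'_def)
          qed
          show "{i. a' i} \<inter> {..<N} \<subseteq> {i. b i}" using b by auto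
        qed
        moreover have "a' \<in> cylinder s" unfolding s_def by (rule in_cylinder_map)
        ultimately have "a' \<in> W" by (auto simp: W_def)
        then show False using a'W by simp
      qed
    qed
    moreover have "{a. Y {i. a i} \<notin> U} \<subseteq> - W" by (auto simp: W_def)
    ultimately show ?thesis by (rule meagre_mono)
  qed
  then have "meagre (\<Union>U\<in>\<U>. {a. Y {i. a i} \<notin> U})" by (intro meagre_UN \<U>(1))
  then show ?thesis by (rule meagre_mono) (use \<U>(3) in auto)
qed

theorem embeds_meagre:
  assumes H: "D_family H" "UNIV \<in> H" and tight: "\<And>Z. Z \<in> H \<Longrightarrow> tight_in Z F"
    and e_F: "\<And>j. e j \<in> F (blk j)" and fin: "\<And>n. finite {j. blk j = n}"
  shows "meagre {(a, b). embeds (Y {i. a i}) (Y {i. b i})}"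
proof -
  have "meagre (emb_tree (real n) [])" for n
  proof (rule souslin_meagre_if_sections_meagre[where C = "emb_tree (real n)"])
    show "emb_tree (real n) s = (\<Union>d. emb_tree (real n) (s @ [d]))" for s by (rule emb_tree_split)
    show "(\<Inter>m. closure (emb_tree (real n) (map \<sigma> [0..<m]))) \<subseteq> emb_tree (real n) []" for \<sigma>
      by (rule emb_tree_limit) simp
    have "meagre {b. (a, b) \<in> emb_tree (real n) []}" if "Y {i. a i} \<in> H" for a
      by (rule meagre_mono[OF tight_imp_meagre[OF tight[OF that] e_F fin]])
         (auto simp: emb_tree_Nil intro: embedding_imp_embeds)
    then show "meagre {a. \<not> meagre {b. (a, b) \<in> emb_tree (real n) []}}"
      by (intro meagre_mono[OF D_family_residual[OF H]]) auto
  qed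
  then have "meagre (\<Union>n. emb_tree (real n) [])" by (intro meagre_UN) auto
  then show ?thesis
  proof (rule meagre_mono)
    show "{(a, b). embeds (Y {i. a i}) (Y {i. b i})} \<subseteq> (\<Union>n. emb_tree (real n) [])"
    proof clarify
      fix a b assume "embeds (Y {i. a i}) (Y {i. b i})"
      then obtain n T where "embedding (real n) {i. a i} {i. b i} T" using embeds_imp_embedding by blast
      then have "(a, b) \<in> emb_tree (real n) []" unfolding emb_tree_Nil by blast
      then show "(a, b) \<in> (\<Union>n. emb_tree (real n) [])" by blast
    qed
  qed
qed

end

section \<open>Ergodicity from tightness\<close>

context strong_mbasis
begin

text \<open>
  The linear operator that sends \<open>e i\<close> to \<open>e (\<pi> i)\<close> for \<open>i \<in> A0\<close> and fixes the other basis vectors.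
\<close>

definition relocate :: "nat set \<Rightarrow> (nat \<Rightarrow> nat) \<Rightarrow> 'a \<Rightarrow> 'a" where
  "relocate A0 \<pi> x = x - (\<Sum>i\<in>A0. \<phi> i x *\<^sub>R e i) + (\<Sum>i\<in>A0. \<phi> i x *\<^sub>R e (\<pi> i))"

lemma bounded_linear_relocate: "bounded_linear (relocate A0 \<pi>)"
  unfolding relocate_def
  by (intro bounded_linear_add bounded_linear_sub bounded_linear_ident bounded_linear_sum
      bounded_linear_compose[OF bounded_linear_scaleR_left bounded_linear_coord])

lemma relocate_coords:
  assumes x: "x \<in> Y A" and \<pi>: "inj_on \<pi> (A \<inter> {..<n})" "\<pi> ` (A \<inter> {..<n}) \<subseteq> {..<n}"
  shows "i \<in> A \<inter> {..<n} \<Longrightarrow> \<phi> (\<pi> i) (relocate (A \<inter> {..<n}) \<pi> x) = \<phi> i x"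
    and "j < n \<Longrightarrow> j \<notin> \<pi> ` (A \<inter> {..<n}) \<Longrightarrow> \<phi> j (relocate (A \<inter> {..<n}) \<pi> x) = 0"
    and "n \<le> j \<Longrightarrow> \<phi> j (relocate (A \<inter> {..<n}) \<pi> x) = \<phi> j x"
proof -
  let ?A0 = "A \<inter> {..<n}"
  have fin: "finite ?A0" by simp
  have s1: "(if j \<in> ?A0 then \<phi> j x else 0) = (if j < n then \<phi> j x else 0)" for j
    using x by (auto simp: in_Y)
  have eq: "\<phi> j (relocate ?A0 \<pi> x) =
      \<phi> j x - (if j < n then \<phi> j x else 0) + (\<Sum>i\<in>?A0. \<phi> i x * \<phi> j (e (\<pi> i)))" for j
    unfolding relocate_def coord_add coord_diff coord_finite_sum[OF fin] s1
    by (simp add: coord_sum coord_scaleR)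
  have s2: "(\<Sum>i\<in>?A0. \<phi> i x * \<phi> j (e (\<pi> i))) = 0" if "j \<notin> \<pi> ` ?A0" for j
    using that by (intro sum.neutral) (auto simp: biorthogonal)
  show "\<phi> j (relocate ?A0 \<pi> x) = 0" if "j < n" "j \<notin> \<pi> ` ?A0"
    using that by (simp add: eq s2)
  show "\<phi> j (relocate ?A0 \<pi> x) = \<phi> j x" if "n \<le> j"
  proof -
    have "j \<notin> \<pi> ` ?A0" using \<pi>(2) that by (meson lessThan_iff not_le subsetD)
    then show ?thesis using that by (simp add: eq s2)
  qed
  show "\<phi> (\<pi> i) (relocate ?A0 \<pi> x) = \<phi> i x" if i: "i \<in> ?A0"
  proof -
    have "(\<Sum>k\<in>?A0. \<phi> k x * \<phi> (\<pi> i) (e (\<pi> k))) = (\<Sum>k\<in>?A0. if k = i then \<phi> i x else 0)"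
      using \<pi>(1) i by (intro sum.cong) (auto simp: biorthogonal inj_on_eq_iff)
    also have "\<dots> = \<phi> i x" using fin i by simp
    finally have s3: "(\<Sum>k\<in>?A0. \<phi> k x * \<phi> (\<pi> i) (e (\<pi> k))) = \<phi> i x" .
    have "\<pi> i < n" using \<pi>(2) i by blast
    then show ?thesis by (simp add: eq s3)
  qed
qed

lemma relocate_in_Y:
  assumes x: "x \<in> Y A" and \<pi>: "bij_betw \<pi> (A \<inter> {..<n}) (B \<inter> {..<n})"
    and agree: "\<And>i. i \<ge> n \<Longrightarrow> i \<in> A \<longleftrightarrow> i \<in> B"
  shows "relocate (A \<inter> {..<n}) \<pi> x \<in> Y B"
  unfolding in_Y
proof (intro allI impI)
  have \<pi>': "inj_on \<pi> (A \<inter> {..<n})" "\<pi> ` (A \<inter> {..<n}) = B \<inter> {..<n}" using \<pi> by (auto simp: bij_betw_def)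
  then have sub: "\<pi> ` (A \<inter> {..<n}) \<subseteq> {..<n}" by auto
  note coords = relocate_coords[OF x \<pi>'(1) sub]
  fix j assume j: "j \<notin> B"
  show "\<phi> j (relocate (A \<inter> {..<n}) \<pi> x) = 0"
  proof (cases "j < n")
    case True
    then show ?thesis using coords(2)[of j] j \<pi>'(2) by simp
  next
    case False
    then have "j \<notin> A" using agree[of j] j by simp
    then show ?thesis using coords(3)[of j] False x by (simp add: in_Y)
  qed
qed

lemma relocate_inverse:
  assumes x: "x \<in> Y A" and \<pi>: "bij_betw \<pi> (A \<inter> {..<n}) (B \<inter> {..<n})"
    and \<sigma>: "bij_betw \<sigma> (B \<inter> {..<n}) (A \<inter> {..<n})" and inv: "\<And>i. i \<in> A \<inter> {..<n} \<Longrightarrow> \<sigma> (\<pi> i) = i"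
    and agree: "\<And>i. i \<ge> n \<Longrightarrow> i \<in> A \<longleftrightarrow> i \<in> B"
  shows "relocate (B \<inter> {..<n}) \<sigma> (relocate (A \<inter> {..<n}) \<pi> x) = x"
proof -
  have \<pi>': "inj_on \<pi> (A \<inter> {..<n})" "\<pi> ` (A \<inter> {..<n}) = B \<inter> {..<n}" using \<pi> by (auto simp: bij_betw_def)
  have \<sigma>': "inj_on \<sigma> (B \<inter> {..<n})" "\<sigma> ` (B \<inter> {..<n}) = A \<inter> {..<n}" using \<sigma> by (auto simp: bij_betw_def)
  let ?y = "relocate (A \<inter> {..<n}) \<pi> x"
  have "\<pi> ` (A \<inter> {..<n}) \<subseteq> {..<n}" using \<pi>'(2) by auto
  note cx = relocate_coords[OF x \<pi>'(1) this]
  have "\<sigma> ` (B \<inter> {..<n}) \<subseteq> {..<n}" using \<sigma>'(2) by auto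
  note cy = relocate_coords[OF relocate_in_Y[OF x \<pi> agree] \<sigma>'(1) this]
  have "\<phi> j (relocate (B \<inter> {..<n}) \<sigma> ?y) = \<phi> j x" for j
  proof -
    consider "n \<le> j" | "j < n" "j \<notin> A" | "j \<in> A \<inter> {..<n}" by fastforce
    then show ?thesis
    proof cases
      case 1
      then show ?thesis using cx(3)[of j] cy(3)[of j] by simp
    next
      case 2
      then show ?thesis using cy(2)[of j] \<sigma>'(2) x by (simp add: in_Y)
    next
      case 3
      then have "\<pi> j \<in> B \<inter> {..<n}" using \<pi>'(2) by blast
      then show ?thesis using cy(1)[of "\<pi> j"] cx(1)[OF 3] inv[OF 3] by simp
    qed
  qed
  then have "\<phi> j (relocate (B \<inter> {..<n}) \<sigma> ?y - x) = 0" for j by (simp add: coord_diff)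
  then show ?thesis using coords_zero_imp_zero eq_iff_diff_eq_0 by blast
qed

text \<open>
  Relocating along a bijection between the two finite parts is inverted by relocating along its inverse.
\<close>

lemma isomorphic_of_finite_change:
  assumes agree: "\<And>i. i \<ge> n \<Longrightarrow> i \<in> A \<longleftrightarrow> i \<in> B"
    and card: "card (A \<inter> {..<n}) = card (B \<inter> {..<n})"
  shows "isomorphic (Y A) (Y B)"
proof -
  obtain \<pi> where \<pi>: "bij_betw \<pi> (A \<inter> {..<n}) (B \<inter> {..<n})"
    using finite_same_card_bij[OF _ _ card] by auto
  define \<sigma> where "\<sigma> = inv_into (A \<inter> {..<n}) \<pi>"
  have \<sigma>: "bij_betw \<sigma> (B \<inter> {..<n}) (A \<inter> {..<n})" unfolding \<sigma>_def by (rule bij_betw_inv_into[OF \<pi>])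
  have \<sigma>\<pi>: "\<sigma> (\<pi> i) = i" if "i \<in> A \<inter> {..<n}" for i
    unfolding \<sigma>_def by (rule bij_betw_inv_into_left[OF \<pi> that])
  have \<pi>\<sigma>: "\<pi> (\<sigma> j) = j" if "j \<in> B \<inter> {..<n}" for j
    unfolding \<sigma>_def by (rule bij_betw_inv_into_right[OF \<pi> that])
  have agree': "\<And>i. i \<ge> n \<Longrightarrow> i \<in> B \<longleftrightarrow> i \<in> A" using agree by blast
  let ?T = "relocate (A \<inter> {..<n}) \<pi>" and ?S = "relocate (B \<inter> {..<n}) \<sigma>"
  have ST: "?S (?T x) = x" if "x \<in> Y A" for x by (rule relocate_inverse[OF that \<pi> \<sigma> \<sigma>\<pi> agree])
  have TS: "?T (?S x) = x" if "x \<in> Y B" for x by (rule relocate_inverse[OF that \<sigma> \<pi> \<pi>\<sigma> agree'])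
  have TY: "?T x \<in> Y B" if "x \<in> Y A" for x by (rule relocate_in_Y[OF that \<pi> agree])
  have SY: "?S x \<in> Y A" if "x \<in> Y B" for x by (rule relocate_in_Y[OF that \<sigma> agree'])
  obtain K where K: "\<And>x. norm (?T x) \<le> K * norm x"
    using bounded_linear.bounded[OF bounded_linear_relocate[of "A \<inter> {..<n}" \<pi>]] by (auto simp: mult.commute)
  obtain L where L: "\<And>x. norm (?S x) \<le> L * norm x"
    using bounded_linear.bounded[OF bounded_linear_relocate[of "B \<inter> {..<n}" \<sigma>]] by (auto simp: mult.commute)
  have "isomorphism_on (Y A) norm (Y B) norm ?T"
  proof (rule isomorphism_onI[OF subspace_Y])
    show "linear_on_set (Y A) ?T"
      by (rule linear_on_set_linear) (rule bounded_linear.linear[OF bounded_linear_relocate])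
    show "?T ` Y A = Y B"
    proof
      show "?T ` Y A \<subseteq> Y B" using TY by blast
      show "Y B \<subseteq> ?T ` Y A" using TS SY by (metis image_eqI subsetI)
    qed
    show "norm (?T x) \<le> K * norm x" for x by (rule K)
    show "norm x \<le> L * norm (?T x)" if "x \<in> Y A" for x using L[of "?T x"] ST[OF that] by simp
  qed
  then show ?thesis unfolding isomorphic_def by blast
qed

text \<open>
  This writes the generators of the Effros structure through countably many finite conditions on \<open>A\<close>.
\<close>

lemma Y_meets_open:
  assumes U: "open U"
  shows "Y A \<inter> U \<noteq> {} \<longleftrightarrow> (\<exists>J. finite J \<and> J \<subseteq> A \<and> Y J \<inter> U \<noteq> {})"
proof
  assume "Y A \<inter> U \<noteq> {}"
  then have "span (e ` A) \<inter> U \<noteq> {}"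
    unfolding Y_eq_closure_span using open_Int_closure_eq_empty[OF U] by (simp add: Int_commute)
  then obtain x where x: "x \<in> span (e ` A)" "x \<in> U" by blast
  obtain N where "x \<in> Y (A \<inter> {..<N})" by (rule span_e_finite_support[OF x(1)])
  then show "\<exists>J. finite J \<and> J \<subseteq> A \<and> Y J \<inter> U \<noteq> {}"
    using x(2) by (intro exI[of _ "A \<inter> {..<N}"]) auto
next
  assume "\<exists>J. finite J \<and> J \<subseteq> A \<and> Y J \<inter> U \<noteq> {}"
  then obtain J where "J \<subseteq> A" "Y J \<inter> U \<noteq> {}" by blast
  then show "Y A \<inter> U \<noteq> {}" using Y_mono[of J A] by blast
qed

lemma measurable_Y:
  assumes g: "\<And>j. Measurable.pred M (\<lambda>x. g x j)"
  shows "(\<lambda>x. Y {j. g x j}) \<in> measurable M effros"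
  unfolding effros_def
proof (rule measurable_measure_of)
  show "{{Y \<in> Sub. Y \<inter> U \<noteq> {}} |U. open U} \<subseteq> Pow Sub" by auto
  show "(\<lambda>x. Y {j. g x j}) \<in> space M \<rightarrow> Sub" using Y_in_Sub by auto
  fix S :: "'a set set" assume "S \<in> {{Y \<in> Sub. Y \<inter> U \<noteq> {}} |U. open U}"
  then obtain U where U: "open U" "S = {Y \<in> Sub. Y \<inter> U \<noteq> {}}" by blast
  define \<J> where "\<J> = {J :: nat set. finite J \<and> Y J \<inter> U \<noteq> {}}"
  have "(\<lambda>x. Y {j. g x j}) -` S \<inter> space M = (\<Union>J\<in>\<J>. {x \<in> space M. \<forall>j\<in>J. g x j})"
  proof (rule set_eqI)
    fix x
    have "x \<in> (\<lambda>x. Y {j. g x j}) -` S \<inter> space M \<longleftrightarrow> x \<in> space M \<and> Y {j. g x j} \<inter> U \<noteq> {}"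
      using Y_in_Sub U(2) by auto
    also have "\<dots> \<longleftrightarrow> x \<in> space M \<and> (\<exists>J. finite J \<and> J \<subseteq> {j. g x j} \<and> Y J \<inter> U \<noteq> {})"
      using Y_meets_open[OF U(1), of "{j. g x j}"] by blast
    also have "\<dots> \<longleftrightarrow> x \<in> (\<Union>J\<in>\<J>. {x \<in> space M. \<forall>j\<in>J. g x j})" by (auto simp: \<J>_def)
    finally show "x \<in> (\<lambda>x. Y {j. g x j}) -` S \<inter> space M \<longleftrightarrow> x \<in> (\<Union>J\<in>\<J>. {x \<in> space M. \<forall>j\<in>J. g x j})" .
  qed
  also have "\<dots> \<in> sets M"
  proof (rule sets.countable_UN'')
    show "countable \<J>"
      by (rule countable_subset[OF _ countable_Collect_finite]) (auto simp: \<J>_def)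
    show "{x \<in> space M. \<forall>j\<in>J. g x j} \<in> sets M" if "J \<in> \<J>" for J
    proof (rule sets.sets_Collect_finite_All)
      show "finite J" using that by (simp add: \<J>_def)
      show "{x \<in> space M. g x j} \<in> sets M" if "j \<in> J" for j using g[of j] by (simp add: pred_def)
    qed
  qed
  finally show "(\<lambda>x. Y {j. g x j}) -` S \<inter> space M \<in> sets M" .
qed

end

lemma finitely_determined_pred:
  fixes P :: "(nat \<Rightarrow> bool) \<Rightarrow> bool"
  assumes P: "\<And>x y. (\<And>j. j \<le> i \<Longrightarrow> x j = y j) \<Longrightarrow> P x = P y"
  shows "Measurable.pred (Pi\<^sub>M UNIV (\<lambda>_. count_space UNIV)) P"
proof -
  let ?M = "Pi\<^sub>M UNIV (\<lambda>_. count_space UNIV) :: (nat \<Rightarrow> bool) measure"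
  have single: "{x \<in> space ?M. x j = c} \<in> sets ?M" for j c
  proof -
    have "(\<lambda>x. x j) -` {c} \<inter> space ?M \<in> sets ?M"
      by (rule measurable_sets[OF measurable_component_singleton]) auto
    also have "(\<lambda>x. x j) -` {c} \<inter> space ?M = {x \<in> space ?M. x j = c}" by auto
    finally show ?thesis .
  qed
  define \<S> where "\<S> = {s :: bool list. length s = Suc i \<and> P (\<lambda>j. s ! j)}"
  have "{x \<in> space ?M. P x} = (\<Union>s\<in>\<S>. {x \<in> space ?M. \<forall>j\<in>{..i}. x j = s ! j})"
  proof (rule set_eqI)
    fix x :: "nat \<Rightarrow> bool"
    have sp: "x \<in> space ?M" by (simp add: space_PiM)
    show "x \<in> {x \<in> space ?M. P x} \<longleftrightarrow> x \<in> (\<Union>s\<in>\<S>. {x \<in> space ?M. \<forall>j\<in>{..i}. x j = s ! j})"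
    proof
      assume "x \<in> {x \<in> space ?M. P x}"
      then have Px: "P x" by simp
      define s where "s = map x [0..<Suc i]"
      have s: "s ! j = x j" if "j \<le> i" for j using that by (simp add: s_def del: upt_Suc)
      have "P (\<lambda>j. s ! j)" using P[of "\<lambda>j. s ! j" x] s Px by simp
      then have "s \<in> \<S>" by (simp add: \<S>_def s_def)
      then show "x \<in> (\<Union>s\<in>\<S>. {x \<in> space ?M. \<forall>j\<in>{..i}. x j = s ! j})" using s sp by auto
    next
      assume "x \<in> (\<Union>s\<in>\<S>. {x \<in> space ?M. \<forall>j\<in>{..i}. x j = s ! j})"
      then obtain s where s: "s \<in> \<S>" "\<And>j. j \<le> i \<Longrightarrow> x j = s ! j" by auto
      then show "x \<in> {x \<in> space ?M. P x}" using P[of x "\<lambda>j. s ! j"] sp by (simp add: \<S>_def)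
    qed
  qed
  also have "\<dots> \<in> sets ?M"
  proof (rule sets.countable_UN'')
    show "{x \<in> space ?M. \<forall>j\<in>{..i}. x j = s ! j} \<in> sets ?M" for s
      by (rule sets.sets_Collect_finite_All) (use single in auto)
  qed auto
  finally show ?thesis by (simp add: pred_def)
qed

text \<open>
  Two isomorphic spaces embed into each other, so \<open>f x\<close> and \<open>f y\<close> are not isomorphic when \<open>(g x, g y)\<close> is
  outside the embedding relation.
\<close>

theorem D_family_tight_imp_ergodic:
  fixes H :: "'a::banach set set"
  assumes H: "D_family H" "H_tight H"
  shows "ergodic TYPE('a)"
proof -
  obtain F where X: "UNIV \<in> H" and F: "is_FDD F" and tight: "\<And>Z. Z \<in> H \<Longrightarrow> tight_in Z F"
    using H(2) unfolding H_tight_def by blast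
  obtain e \<phi> blk where basis: "strong_mbasis e \<phi>" and e_F: "\<And>j. e j \<in> F (blk j)"
    and fin: "\<And>n. finite {j. blk j = n}"
    using FDD_strong_mbasis[OF F] by metis
  interpret strong_mbasis e \<phi> by (rule basis)
  obtain g where g_det: "\<And>x y i. (\<And>j. j \<le> i \<Longrightarrow> x j = y j) \<Longrightarrow> g x i = g y i"
    and g_E0: "\<And>x y. E0 x y \<Longrightarrow> \<exists>n. (\<forall>i\<ge>n. g x i = g y i) \<and> card {i. i < n \<and> g x i} = card {i. i < n \<and> g y i}"
    and g_not: "\<And>x y. \<not> E0 x y \<Longrightarrow> (g x, g y) \<notin> {(a, b). embeds (Y {i. a i}) (Y {i. b i})}"
    using meagre_E0_antihomomorphism[OF embeds_meagre[OF H(1) X tight e_F fin]] by blast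
  define f where "f x = Y {i. g x i}" for x
  have "f \<in> measurable (Pi\<^sub>M UNIV (\<lambda>_. count_space UNIV)) effros"
    unfolding f_def by (intro measurable_Y finitely_determined_pred g_det)
  moreover have "E0 x y \<longleftrightarrow> isomorphic (f x) (f y)" for x y
  proof
    assume "E0 x y"
    then obtain n where n: "\<And>i. i \<ge> n \<Longrightarrow> g x i = g y i" "card {i. i < n \<and> g x i} = card {i. i < n \<and> g y i}"
      using g_E0 by blast
    have "{i. g z i} \<inter> {..<n} = {i. i < n \<and> g z i}" for z by auto
    then show "isomorphic (f x) (f y)"
      unfolding f_def using n by (intro isomorphic_of_finite_change[of n]) auto
  next
    assume "isomorphic (f x) (f y)"
    then obtain T where T: "isomorphism_on (f x) norm (f y) norm T" by (auto simp: isomorphic_def)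
    then have "T ` f x = f y" by (simp add: isomorphism_on_def bij_betw_def)
    then have "embeds (f x) (f y)" unfolding embeds_def using T by (intro exI[of _ T]) simp
    then show "E0 x y" using g_not[of x y] by (auto simp: f_def)
  qed
  moreover have "separable_space (euclidean :: 'a topology)"
  proof -
    obtain C :: "'a set" where "countable C" "closure C = UNIV" by (rule countable_dense_set)
    then show ?thesis unfolding separable_space_def by (intro exI[of _ C]) simp
  qed
  ultimately show ?thesis unfolding ergodic_def by blast
qed

section \<open>The large subspaces of a degree\<close>

lemma fin_dim_subset:
  assumes "fin_dim F" "subspace Y" "Y \<subseteq> F"
  shows "fin_dim Y"
proof -
  obtain C where C: "finite C" "F = span C" using assms(1) by (auto simp: fin_dim_def)
  obtain B where B: "B \<subseteq> Y" "independent B" "Y \<subseteq> span B" by (rule maximal_independent_subset)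
  have "B \<subseteq> span C" using B(1) assms(3) C(2) by blast
  then have "finite B" using independent_span_bound[OF C(1) B(2)] by blast
  moreover have "span B = Y" using B assms(2) by (intro antisym span_minimal) auto
  ultimately show ?thesis unfolding fin_dim_def by blast
qed

text \<open>
  Riesz's lemma with a functional: the Hahn-Banach functional that attains the distance to \<open>F\<close> is almost
  normed by a vector of \<open>Y\<close> almost orthogonal to \<open>F\<close>. The constant \<open>2\<close> does not depend on \<open>F\<close>.
\<close>

lemma riesz_functional:
  fixes Y :: "'a::real_normed_vector set"
  assumes Y: "subspace Y" "\<not> fin_dim Y" and F: "fin_dim F" "F \<subseteq> Y"
  obtains y and \<psi> :: "'a \<Rightarrow> real" where "y \<in> Y" "norm y = 1" "bounded_linear \<psi>" "\<psi> y = 1"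
    "\<And>x. x \<in> F \<Longrightarrow> \<psi> x = 0" "\<And>x. \<bar>\<psi> x\<bar> \<le> 2 * norm x"
proof -
  have sF: "subspace F" and cF: "closed F" by (rule fin_dim_subspace[OF F(1)], rule fin_dim_closed[OF F(1)])
  have "Y \<noteq> F" using Y(2) F(1) by blast
  then obtain y0 where y0: "y0 \<in> Y" "y0 \<notin> F" using F(2) by blast
  obtain f :: "'a \<Rightarrow> real" where f: "bounded_linear f" "\<And>x. \<bar>f x\<bar> \<le> norm x"
    "\<And>x. x \<in> F \<Longrightarrow> f x = 0" "f y0 = infdist y0 F"
    using functional_attaining_distance[OF sF, of y0] by metis
  have ne: "F \<noteq> {}" using subspace_0[OF sF] by blast
  have pos: "infdist y0 F > 0" by (rule infdist_pos_not_in_closed[OF cF ne y0(2)])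
  have "\<exists>z\<in>F. dist y0 z < 2 * infdist y0 F"
  proof (rule ccontr)
    assume "\<not> ?thesis"
    then have "2 * infdist y0 F \<le> infdist y0 F"
      unfolding infdist_notempty[OF ne] by (intro cINF_greatest[OF ne]) (auto simp: not_less)
    then show False using pos by simp
  qed
  then obtain z where z: "z \<in> F" "norm (y0 - z) < 2 * infdist y0 F" by (auto simp: dist_norm)
  interpret f: bounded_linear f by (rule f(1))
  define y1 where "y1 = y0 - z"
  have y1: "y1 \<in> Y" "y1 \<noteq> 0" "f y1 = infdist y0 F"
    using y0 z F(2) f(3)[OF z(1)] f(4) subspace_diff[OF Y(1)] by (auto simp: y1_def f.diff)
  define y where "y = y1 /\<^sub>R norm y1"
  have fy: "f y > 1 / 2"
    using z(2) y1 pos by (simp add: y_def f.scaleR y1_def[symmetric] field_simps)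
  have "bounded_linear (\<lambda>x. f x / f y)"
    by (rule bounded_linear_compose[OF bounded_linear_divide f(1)])
  moreover have "\<bar>f x / f y\<bar> \<le> 2 * norm x" for x
  proof -
    have "\<bar>f x / f y\<bar> = \<bar>f x\<bar> / f y" using fy by simp
    also have "\<dots> \<le> norm x / (1 / 2)" using f(2)[of x] fy by (intro frac_le) auto
    finally show ?thesis by simp
  qed
  moreover have "y \<in> Y" "norm y = 1"
    using y1 subspace_scale[OF Y(1)] by (auto simp: y_def)
  ultimately show ?thesis
    using that[of y "\<lambda>x. f x / f y"] f(3) fy by simp
qed

lemma banach_on_Sub:
  fixes V :: "'a::banach set"
  assumes "V \<in> Sub"
  shows "banach_on V norm"
proof -
  have V: "subspace V" "closed V" using assms by (auto simp: Sub_def)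
  have "\<exists>x\<in>V. (\<lambda>n. norm (\<sigma> n - x)) \<longlonglongrightarrow> 0"
    if \<sigma>: "\<forall>n. \<sigma> n \<in> V" "\<forall>e>0. \<exists>n0. \<forall>m\<ge>n0. \<forall>n\<ge>n0. norm (\<sigma> m - \<sigma> n) < e" for \<sigma> :: "nat \<Rightarrow> 'a"
  proof -
    have "Cauchy \<sigma>" using \<sigma>(2) by (simp add: Cauchy_def dist_norm)
    then obtain x where x: "\<sigma> \<longlonglongrightarrow> x" using Cauchy_convergent_iff convergent_def by blast
    have "x \<in> V" using closed_sequentially[OF V(2) _ x] \<sigma>(1) by blast
    moreover have "(\<lambda>n. norm (\<sigma> n - x)) \<longlonglongrightarrow> 0" using x by (intro tendsto_norm_zero LIM_zero)
    ultimately show ?thesis by blast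
  qed
  then show ?thesis using V(1) by (simp add: banach_on_def norm_triangle_ineq)
qed

lemma approx_pair_Sub: "V \<in> Sub \<Longrightarrow> fin_dim F \<Longrightarrow> F \<subseteq> V \<Longrightarrow> approx_pair V norm F"
  by (simp add: approx_pair_def banach_on_Sub)

context
  fixes d :: "'a::banach set \<Rightarrow> ('a \<Rightarrow> real) \<Rightarrow> 'a set \<Rightarrow> real" and \<kappa> :: "real \<Rightarrow> real \<Rightarrow> real"
  assumes approx_pair_nonneg: "\<And>V N F. approx_pair V N F \<Longrightarrow> 0 \<le> d V N F"
    and modulus_mono: "\<And>s s' t t'. 1 \<le> s \<Longrightarrow> s \<le> s' \<Longrightarrow> 0 \<le> t \<Longrightarrow> t \<le> t' \<Longrightarrow> \<kappa> s t \<le> \<kappa> s' t'"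
    and modulus_tendsto: "\<And>t. 0 \<le> t \<Longrightarrow> ((\<lambda>s. \<kappa> s t) \<longlongrightarrow> t) (at_right 1)"
    and modulus_morphism: "\<And>V N F W M G S T. approx_pair V N F \<Longrightarrow> approx_pair W M G \<Longrightarrow>
          morphism V N F W M G S T \<Longrightarrow> d W M G \<le> \<kappa> (morphism_norm V N M G S T) (d V N F)"
begin

lemma degree_nonneg: "V \<in> Sub \<Longrightarrow> fin_dim F \<Longrightarrow> F \<subseteq> V \<Longrightarrow> 0 \<le> d V norm F"
  by (rule approx_pair_nonneg[OF approx_pair_Sub])

text \<open>
  The defining inequality of a degree with bounds for the two operators in place of their norms. The lower
  bound on the norm of the morphism, needed for monotonicity, holds because \<open>T \<circ> S\<close> is the identity.
\<close>

lemma degree_le_modulus: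
  assumes V: "V \<in> Sub" "fin_dim F" "F \<subseteq> V" and W: "W \<in> Sub" "fin_dim G" "G \<subseteq> W"
    and S: "linear_on_set G S" "S ` G \<subseteq> F" "\<And>x. x \<in> G \<Longrightarrow> norm (S x) \<le> s * norm x"
    and T: "linear_on_set V T" "T ` V \<subseteq> W" "\<And>x. x \<in> V \<Longrightarrow> norm (T x) \<le> t * norm x"
    and TS: "\<And>x. x \<in> G \<Longrightarrow> T (S x) = x" and st: "0 \<le> s" "0 \<le> t" "1 \<le> s * t"
    and D: "d V norm F \<le> D"
  shows "d W norm G \<le> \<kappa> (s * t) D"
proof -
  have sub: "subspace G" "subspace V" using fin_dim_subspace[OF W(2)] V(1) by (auto simp: Sub_def)
  have mor: "morphism V norm F W norm G S T"
    unfolding morphism_def using S T TS by (auto intro!: bounded_linear_onI)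
  have bound: "1 \<le> morphism_norm V norm norm G S T \<and> morphism_norm V norm norm G S T \<le> s * t"
  proof (cases "G = {0}")
    case True
    then show ?thesis using st by (simp add: morphism_norm_def)
  next
    case False
    let ?s = "opnorm_on G norm norm S" and ?t = "opnorm_on V norm norm T"
    obtain g where g: "g \<in> G" "g \<noteq> 0" using False subspace_0[OF sub(1)] by blast
    have Sg: "S g \<in> V" using S(2) V(3) g(1) by blast
    have nS: "norm (S g) \<le> ?s * norm g" by (rule opnorm_on_bound[OF S(3) g(1)])
    have nT: "norm (T (S g)) \<le> ?t * norm (S g)" by (rule opnorm_on_bound[OF T(3) Sg])
    have "T 0 = 0" by (rule linear_on_set_zero[OF T(1) sub(2)])
    then have "S g \<noteq> 0" using TS[OF g(1)] g(2) by auto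
    then have "0 < ?s * norm g" using nS by (meson less_le_trans zero_less_norm_iff)
    then have s0: "0 < ?s" by (rule zero_less_mult_pos2) (use g(2) in simp)
    have "0 < ?t * norm (S g)" using nT TS[OF g(1)] g(2) by (metis less_le_trans zero_less_norm_iff)
    then have t0: "0 < ?t" by (rule zero_less_mult_pos2) (use \<open>S g \<noteq> 0\<close> in simp)
    have "norm g \<le> ?t * (?s * norm g)"
      using nT TS[OF g(1)] mult_left_mono[OF nS less_imp_le[OF t0]] by simp
    then have "1 \<le> ?s * ?t" using g(2) by (simp add: mult.commute mult.left_commute)
    moreover have "?s \<le> s" using g(1) st S(3) by (intro opnorm_on_le) auto
    moreover have "?t \<le> t" using Sg st T(3) by (intro opnorm_on_le) auto
    ultimately show ?thesis
      using False st s0 t0 by (auto simp: morphism_norm_def intro!: mult_mono)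
  qed
  have "d W norm G \<le> \<kappa> (morphism_norm V norm norm G S T) (d V norm F)"
    by (rule modulus_morphism[OF approx_pair_Sub[OF V] approx_pair_Sub[OF W] mor])
  also have "\<dots> \<le> \<kappa> (s * t) D"
    using bound degree_nonneg[OF V] D by (intro modulus_mono) auto
  finally show ?thesis .
qed

lemma d_small_iff: "d_small d V norm \<longleftrightarrow> (\<exists>D\<ge>0. \<forall>F. fin_dim F \<and> F \<subseteq> V \<longrightarrow> d V norm F \<le> D)"
proof
  assume "d_small d V norm"
  then obtain D where "\<And>F. fin_dim F \<Longrightarrow> F \<subseteq> V \<Longrightarrow> d V norm F \<le> D"
    unfolding d_small_def bdd_above_def by blast
  then show "\<exists>D\<ge>0. \<forall>F. fin_dim F \<and> F \<subseteq> V \<longrightarrow> d V norm F \<le> D"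
    by (intro exI[of _ "max 0 D"]) (auto simp: le_max_iff_disj)
next
  assume "\<exists>D\<ge>0. \<forall>F. fin_dim F \<and> F \<subseteq> V \<longrightarrow> d V norm F \<le> D"
  then show "d_small d V norm" unfolding d_small_def bdd_above_def by blast
qed

text \<open>
  The identity of \<open>V\<close> is a morphism from \<open>(V, V)\<close> to each \<open>(V, F)\<close>.
\<close>

lemma fin_dim_d_small:
  assumes "fin_dim V"
  shows "d_small d V norm"
proof -
  have V: "V \<in> Sub" by (rule fin_dim_in_Sub[OF assms])
  have "d V norm F \<le> \<kappa> (1 * 1) (d V norm V)" if F: "fin_dim F" "F \<subseteq> V" for F
    by (rule degree_le_modulus[OF V assms _ V F, where S = "\<lambda>x. x" and T = "\<lambda>x. x"])
       (use F in \<open>auto simp: linear_on_set_def\<close>)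
  then show ?thesis unfolding d_small_def bdd_above_def by blast
qed

lemma span_insert_eq:
  assumes "subspace Y"
  shows "span (insert g Y) = {x. \<exists>c. x - c *\<^sub>R g \<in> Y}"
  using span_breakdown_eq[of _ g Y] assms by (auto simp: span_eq_iff[THEN iffD2])

text \<open>
  Smallness passes to \<open>Y\<close> along the projection of \<open>span (insert g Y)\<close> onto \<open>Y\<close>. For the converse, let \<open>F\<close> be
  finite-dimensional and \<open>F0\<close> its projection to \<open>Y\<close>. A unit vector \<open>y\<close> of \<open>Y\<close> far from \<open>F0\<close> takes the place
  of \<open>g\<close>: the operator \<open>S\<close> exchanges \<open>g\<close> for \<open>y\<close> on \<open>F\<close>, and \<open>T\<close> exchanges \<open>y\<close> for \<open>g\<close> and fixes \<open>F0\<close>.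
  Their norms depend on \<open>g\<close> and \<open>Y\<close> but not on \<open>F\<close>.
\<close>

lemma d_small_span_insert:
  assumes Y: "Y \<in> Sub_inf" and g: "g \<notin> Y"
  shows "d_small d (span (insert g Y)) norm \<longleftrightarrow> d_small d Y norm"
proof -
  have SubY: "Y \<in> Sub" and sY: "subspace Y" and cY: "closed Y" and infY: "\<not> fin_dim Y"
    using Y by (auto simp: Sub_inf_def Sub_def)
  define W where "W = span (insert g Y)"
  have sW: "subspace W" by (simp add: W_def)
  have SubW: "W \<in> Sub" unfolding W_def Sub_def using closed_span_insert[OF sY cY] by simp
  have YW: "Y \<subseteq> W" and gW: "g \<in> W" unfolding W_def by (auto intro: span_base)
  obtain \<theta> :: "'a \<Rightarrow> real" where \<theta>: "bounded_linear \<theta>" "\<And>x. x \<in> Y \<Longrightarrow> \<theta> x = 0" "\<theta> g = 1"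
    using separating_functional[OF sY cY g] by metis
  interpret \<theta>: bounded_linear \<theta> by (rule \<theta>(1))
  obtain C where C: "C > 0" "\<And>x. \<bar>\<theta> x\<bar> \<le> C * norm x"
    using \<theta>.pos_bounded by (auto simp: mult.commute)
  have proj: "x - \<theta> x *\<^sub>R g \<in> Y" if x: "x \<in> W" for x
  proof -
    obtain c where c: "x - c *\<^sub>R g \<in> Y" using x span_insert_eq[OF sY, of g] by (auto simp: W_def)
    then have "\<theta> (x - c *\<^sub>R g) = 0" by (rule \<theta>(2))
    then have "\<theta> x = c" by (simp add: \<theta>.diff \<theta>.scaleR \<theta>(3))
    then show ?thesis using c by simp
  qed
  have lin_proj: "linear (\<lambda>x. x - \<theta> x *\<^sub>R g)"
    by (rule linearI) (auto simp: \<theta>.add \<theta>.scaleR algebra_simps)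
  have norm_proj: "norm (x + \<theta> x *\<^sub>R v) \<le> (1 + C * norm v) * norm x" for x v
  proof -
    have "norm (x + \<theta> x *\<^sub>R v) \<le> norm x + \<bar>\<theta> x\<bar> * norm v"
      using norm_triangle_ineq[of x "\<theta> x *\<^sub>R v"] by simp
    also have "\<bar>\<theta> x\<bar> * norm v \<le> C * norm x * norm v" using C(2)[of x] by (rule mult_right_mono) simp
    finally show ?thesis by (simp add: algebra_simps)
  qed
  have "d_small d Y norm" if "d_small d W norm"
  proof -
    obtain D where D: "\<And>F. fin_dim F \<Longrightarrow> F \<subseteq> W \<Longrightarrow> d W norm F \<le> D" using \<open>d_small d W norm\<close> d_small_iff by blast
    have "d Y norm F \<le> \<kappa> (1 * (1 + C * norm g)) D" if F: "fin_dim F" "F \<subseteq> Y" for F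
    proof (rule degree_le_modulus[OF SubW F(1) _ SubY F, where S = "\<lambda>x. x" and T = "\<lambda>x. x - \<theta> x *\<^sub>R g"])
      show "linear_on_set W (\<lambda>x. x - \<theta> x *\<^sub>R g)" by (rule linear_on_set_linear[OF lin_proj])
      show "norm (x - \<theta> x *\<^sub>R g) \<le> (1 + C * norm g) * norm x" for x
        using norm_proj[of x "- g"] by simp
      show "x - \<theta> x *\<^sub>R g = x" if "x \<in> F" for x using \<theta>(2) F(2) that by auto
      show "(\<lambda>x. x - \<theta> x *\<^sub>R g) ` W \<subseteq> Y" using proj by blast
      show "d W norm F \<le> D" using D F YW by blast
    qed (use F YW C(1) in \<open>auto simp: linear_on_set_def\<close>)
    then show ?thesis unfolding d_small_def bdd_above_def by blast
  qed
  moreover have "d_small d W norm" if "d_small d Y norm"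
  proof -
    obtain D where D: "\<And>F. fin_dim F \<Longrightarrow> F \<subseteq> Y \<Longrightarrow> d Y norm F \<le> D" using \<open>d_small d Y norm\<close> d_small_iff by blast
    define s t where "s = 1 + C * (1 + norm g)" and "t = 1 + 2 * (norm g + 1)"
    have st: "1 \<le> s" "1 \<le> t" using C(1) by (auto simp: s_def t_def)
    have "d W norm F \<le> \<kappa> (s * t) D" if F: "fin_dim F" "F \<subseteq> W" for F
    proof -
      define F0 where "F0 = (\<lambda>x. x - \<theta> x *\<^sub>R g) ` F"
      have F0: "fin_dim F0" "F0 \<subseteq> Y"
        unfolding F0_def using F proj linear_on_set_image_fin_dim[OF linear_on_set_linear[OF lin_proj] subspace_UNIV F(1)]
        by auto
      obtain y and \<psi> :: "'a \<Rightarrow> real" where y: "y \<in> Y" "norm y = 1" and \<psi>: "bounded_linear \<psi>" "\<psi> y = 1"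
        "\<And>x. x \<in> F0 \<Longrightarrow> \<psi> x = 0" "\<And>x. \<bar>\<psi> x\<bar> \<le> 2 * norm x"
        using riesz_functional[OF sY infY F0] by metis
      interpret \<psi>: bounded_linear \<psi> by (rule \<psi>(1))
      define S where "S x = x + \<theta> x *\<^sub>R (y - g)" for x
      define T where "T x = x + \<psi> x *\<^sub>R (g - y)" for x
      have linS: "linear S" by (rule linearI) (auto simp: S_def \<theta>.add \<theta>.scaleR algebra_simps)
      have linT: "linear T" by (rule linearI) (auto simp: T_def \<psi>.add \<psi>.scaleR algebra_simps)
      have normS: "norm (S x) \<le> s * norm x" for x
      proof -
        have "norm (S x) \<le> (1 + C * norm (y - g)) * norm x" unfolding S_def by (rule norm_proj)
        also have "\<dots> \<le> s * norm x"
          using norm_triangle_ineq4[of y g] y(2) C(1)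
          unfolding s_def by (intro mult_right_mono add_left_mono mult_left_mono) auto
        finally show ?thesis .
      qed
      have normT: "norm (T x) \<le> t * norm x" for x
      proof -
        have "norm (T x) \<le> norm x + \<bar>\<psi> x\<bar> * norm (g - y)"
          unfolding T_def using norm_triangle_ineq[of x "\<psi> x *\<^sub>R (g - y)"] by simp
        also have "\<bar>\<psi> x\<bar> * norm (g - y) \<le> (2 * norm x) * (norm g + 1)"
          using \<psi>(4)[of x] norm_triangle_ineq4[of g y] y(2) by (intro mult_mono) auto
        finally show ?thesis by (simp add: t_def algebra_simps)
      qed
      have S_eq: "S x = (x - \<theta> x *\<^sub>R g) + \<theta> x *\<^sub>R y" for x by (simp add: S_def algebra_simps)
      have SY: "S x \<in> Y" if "x \<in> F" for x
        unfolding S_eq using proj F(2) that y(1) by (intro subspace_add[OF sY] subspace_scale[OF sY]) auto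
      have TS: "T (S x) = x" if "x \<in> F" for x
      proof -
        have "x - \<theta> x *\<^sub>R g \<in> F0" using that by (auto simp: F0_def)
        then have "\<psi> (S x) = \<theta> x" unfolding S_eq by (simp only: \<psi>.add \<psi>.scaleR \<psi>(2,3)) simp
        then show ?thesis by (simp add: T_def S_def algebra_simps)
      qed
      have SF: "fin_dim (S ` F)"
        by (rule linear_on_set_image_fin_dim[OF linear_on_set_linear[OF linS] subspace_UNIV F(1)]) simp
      show ?thesis
      proof (rule degree_le_modulus[OF SubY SF _ SubW F, where S = S and T = T])
        show "S ` F \<subseteq> Y" using SY by blast
        show "d Y norm (S ` F) \<le> D" using D[OF SF] SY by blast
        show "T ` Y \<subseteq> W"
          unfolding T_def using YW gW y(1) sW
          by (auto intro!: subspace_add subspace_scale subspace_diff)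
        show "1 \<le> s * t" using st mult_mono[of 1 s 1 t] by simp
      qed (use linS linT normS normT TS st in \<open>auto intro: linear_on_set_linear\<close>)
    qed
    then show ?thesis unfolding d_small_def bdd_above_def by blast
  qed
  ultimately show ?thesis unfolding W_def by blast
qed

lemma d_large_finite_change:
  assumes Y: "Y \<in> Sub_inf" and B: "finite B"
  shows "{y + f | y f. y \<in> Y \<and> f \<in> span B} \<in> Sub_inf \<and>
         (d_small d {y + f | y f. y \<in> Y \<and> f \<in> span B} norm \<longleftrightarrow> d_small d Y norm)"
  using B
proof (induction B)
  case empty
  then show ?case using Y by simp
next
  case (insert b B)
  let ?W = "\<lambda>B. {y + f | y f. y \<in> Y \<and> f \<in> span B}"
  have sub: "subspace (?W B)" and cl: "closed (?W B)" using insert.IH by (auto simp: Sub_inf_def Sub_def)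
  have eq: "?W (insert b B) = span (insert b (?W B))"
  proof (intro set_eqI iffI)
    fix x assume "x \<in> ?W (insert b B)"
    then obtain y f k where y: "x = y + f" "y \<in> Y" "f - k *\<^sub>R b \<in> span B"
      using span_breakdown_eq[of _ b B] by blast
    then have "x - k *\<^sub>R b \<in> ?W B" by (intro CollectI exI[of _ y] exI[of _ "f - k *\<^sub>R b"]) simp
    then show "x \<in> span (insert b (?W B))" unfolding span_insert_eq[OF sub] by blast
  next
    fix x assume "x \<in> span (insert b (?W B))"
    then obtain k y f where y: "x - k *\<^sub>R b = y + f" "y \<in> Y" "f \<in> span B"
      unfolding span_insert_eq[OF sub] by blast
    have "f + k *\<^sub>R b \<in> span (insert b B)"
      using y(3) by (intro span_add span_scale span_base[of b] subsetD[OF span_mono[of B "insert b B"] y(3)]) auto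
    moreover have "x = y + (f + k *\<^sub>R b)" using y(1) by (simp add: algebra_simps)
    ultimately show "x \<in> ?W (insert b B)" using y(2) by blast
  qed
  have "\<not> fin_dim (span (insert b (?W B)))"
    using fin_dim_subset[OF _ sub] insert.IH span_superset[of "insert b (?W B)"]
    by (auto simp: Sub_inf_def)
  then have "span (insert b (?W B)) \<in> Sub_inf"
    using closed_span_insert[OF sub cl] by (simp add: Sub_inf_def Sub_def)
  moreover have "d_small d (span (insert b (?W B))) norm \<longleftrightarrow> d_small d (?W B) norm"
  proof (cases "b \<in> ?W B")
    case True
    then have "insert b (?W B) = ?W B" by (rule insert_absorb)
    moreover have "span (?W B) = ?W B" using sub by (rule span_eq_iff[THEN iffD2])
    ultimately show ?thesis by (simp only:)
  next
    case False
    then show ?thesis by (rule d_small_span_insert[OF conjunct1[OF insert.IH]])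
  qed
  ultimately show ?case unfolding eq using conjunct2[OF insert.IH] by (simp only: conj_ac)
qed

text \<open>
  If \<open>T\<close> maps \<open>Z'\<close> onto \<open>Z\<close> and is \<open>\<epsilon>\<close>-close to the identity, then \<open>T\<close> and its inverse form a morphism from
  \<open>(Z, T F)\<close> to \<open>(Y, F)\<close> of norm at most \<open>(1 + \<epsilon>) / (1 - \<epsilon>)\<close>. For \<open>\<epsilon>\<close> small enough, \<open>d Z (T F) \<le> k\<close> would
  force \<open>d Y F\<close> below its actual value.
\<close>

lemma ellentuck_open_degree_gt:
  "openin ellentuck {Y \<in> Sub. \<exists>F. fin_dim F \<and> F \<subseteq> Y \<and> d Y norm F > real k}" (is "openin _ ?U")
proof (subst openin_subopen, intro ballI)
  fix Y assume "Y \<in> ?U"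
  then obtain F where Y: "Y \<in> Sub" and F: "fin_dim F" "F \<subseteq> Y" "d Y norm F > real k" by blast
  have "\<forall>\<^sub>F s in at_right 1. \<kappa> s (real k) < d Y norm F"
    using modulus_tendsto[of "real k"] F(3) by (intro order_tendstoD(2)[where a = "d Y norm F"]) auto
  then obtain b where b: "b > 1" "\<And>s. 1 < s \<Longrightarrow> s < b \<Longrightarrow> \<kappa> s (real k) < d Y norm F"
    unfolding eventually_at_right_field by blast
  define \<epsilon> where "\<epsilon> = min (1/2) ((b - 1) / 8)"
  have "\<epsilon> \<le> (b - 1) / 8" unfolding \<epsilon>_def by (rule min.cobounded2)
  then have \<epsilon>: "0 < \<epsilon>" "\<epsilon> \<le> 1/2" "8 * \<epsilon> \<le> b - 1" using b(1) by (auto simp: \<epsilon>_def)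
  define s where "s = (1 + \<epsilon>) * (1 / (1 - \<epsilon>))"
  have "s - 1 = 2 * \<epsilon> / (1 - \<epsilon>)" using \<epsilon> by (simp add: s_def field_simps)
  also have "\<dots> \<le> 2 * \<epsilon> / (1 / 2)" using \<epsilon> by (intro divide_left_mono) auto
  finally have "s < b" using \<epsilon> by simp
  moreover have "1 < s" using \<epsilon> by (simp add: s_def field_simps)
  ultimately have s: "\<kappa> s (real k) < d Y norm F" "1 < s" using b(2) by auto
  have "ellentuck_nbhd F Y \<epsilon> \<subseteq> ?U"
  proof
    fix Z assume "Z \<in> ellentuck_nbhd F Y \<epsilon>"
    then obtain Z' T where Z: "Z \<in> Sub" "Z' \<in> Sub" "F \<subseteq> Z'" "Z' \<subseteq> Y" and iso: "isomorphism_on Z' norm Z norm T"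
      and op: "opnorm_on Z' norm norm (\<lambda>z. T z - z) < \<epsilon>"
      unfolding ellentuck_nbhd_def by blast
    have T: "linear_on_set Z' T" "T ` Z' = Z" "inj_on T Z'"
      using isomorphism_onE[OF iso] by metis+
    have sub: "subspace Z'" using Z(2) by (simp add: Sub_def)
    have near: "norm (T z - z) \<le> \<epsilon> * norm z" if "z \<in> Z'" for z
    proof -
      have "norm (T z - z) \<le> opnorm_on Z' norm norm (\<lambda>z. T z - z) * norm z"
        by (rule isomorphism_on_distance(1)[OF iso sub that])
      also have "\<dots> \<le> \<epsilon> * norm z" using op by (intro mult_right_mono) auto
      finally show ?thesis .
    qed
    have TF: "fin_dim (T ` F)" by (rule linear_on_set_image_fin_dim[OF T(1) sub F(1) Z(3)])
    define S where "S = the_inv_into Z' T"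
    have S_eq: "S (T x) = x" if "x \<in> Z'" for x unfolding S_def by (rule the_inv_into_f_f[OF T(3) that])
    have TS: "S z \<in> Z'" "T (S z) = z" if "z \<in> Z" for z
      using that T(2) S_eq by auto
    have linS: "linear_on_set Z S"
      using iso unfolding isomorphism_on_def bounded_linear_on_def linear_on_set_def S_def by blast
    have "d Y norm F \<le> \<kappa> s D" if "d Z norm (T ` F) \<le> D" for D
      unfolding s_def
    proof (rule degree_le_modulus[OF Z(1) TF _ Y F(1,2), where S = T and T = S])
      show "linear_on_set F T" by (rule linear_on_set_mono[OF T(1) Z(3)])
      show "norm (T x) \<le> (1 + \<epsilon>) * norm x" if "x \<in> F" for x
        using near[of x] that Z(3) norm_triangle_ineq[of "T x - x" x] by (auto simp: algebra_simps)
      show "norm (S z) \<le> 1 / (1 - \<epsilon>) * norm z" if "z \<in> Z" for z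
        using near[OF TS(1)[OF that]] TS(2)[OF that] \<epsilon> norm_triangle_ineq4[of z "z - S z"]
        by (simp add: field_simps)
      show "1 \<le> (1 + \<epsilon>) * (1 / (1 - \<epsilon>))" using s(2) by (simp add: s_def)
      show "S (T x) = x" if "x \<in> F" for x using S_eq Z(3) that by blast
      show "T ` F \<subseteq> Z" using T(2) Z(3) by blast
      show "S ` Z \<subseteq> Y" using TS(1) Z(4) by blast
    qed (use linS \<epsilon> that in auto)
    then have "\<not> d Z norm (T ` F) \<le> real k" using s(1) by (metis not_less)
    then show "Z \<in> ?U" using Z(1) TF T(2) Z(3) by (auto intro!: exI[of _ "T ` F"])
  qed
  moreover have "openin ellentuck (ellentuck_nbhd F Y \<epsilon>)"
    unfolding ellentuck_def using Y F \<epsilon>(1) by (intro topology_generated_by_Basis) blast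
  moreover have "Y \<in> ellentuck_nbhd F Y \<epsilon>"
  proof -
    have sY: "subspace Y" using Y by (simp add: Sub_def)
    have "isomorphism_on Y norm Y norm (\<lambda>z. z)"
      by (rule isomorphism_onI[OF sY, where K = 1 and L = 1]) (auto simp: linear_on_set_def)
    moreover have "opnorm_on Y norm norm (\<lambda>z. z - z :: 'a) \<le> 0"
      using subspace_0[OF sY] by (intro opnorm_on_le) auto
    ultimately show ?thesis unfolding ellentuck_nbhd_def using Y F(2) \<epsilon>(1)
      by (intro CollectI conjI bexI[of _ Y] exI[of _ "\<lambda>z. z"]) auto
  qed
  ultimately show "\<exists>V. openin ellentuck V \<and> Y \<in> V \<and> V \<subseteq> ?U" by blast
qed

lemma D_family_d_large_subspaces: "D_family (d_large_subspaces d)"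
proof -
  let ?H = "d_large_subspaces d"
  define U where "U k = {Y \<in> Sub. \<exists>F. fin_dim F \<and> F \<subseteq> Y \<and> d Y norm F > real k}" for k
  have U: "openin ellentuck (U k)" for k unfolding U_def by (rule ellentuck_open_degree_gt)
  have H: "?H = (\<Inter>k. U k)"
  proof (intro set_eqI iffI)
    fix Y assume Y: "Y \<in> ?H"
    show "Y \<in> (\<Inter>k. U k)"
    proof
      fix k
      have "\<not> (\<forall>F. fin_dim F \<and> F \<subseteq> Y \<longrightarrow> d Y norm F \<le> real k)"
        using Y d_small_iff[of Y] of_nat_0_le_iff[of k] unfolding d_large_subspaces_def by blast
      then show "Y \<in> U k" using Y by (auto simp: U_def d_large_subspaces_def Sub_inf_def not_le)
    qed
  next
    fix Y assume Y: "Y \<in> (\<Inter>k. U k)"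
    have "\<not> d_small d Y norm"
    proof
      assume "d_small d Y norm"
      then obtain D where D: "\<And>F. fin_dim F \<Longrightarrow> F \<subseteq> Y \<Longrightarrow> d Y norm F \<le> D" using d_small_iff by blast
      obtain k :: nat where "D \<le> real k" using real_arch_simple by blast
      then have "\<not> (\<exists>F. fin_dim F \<and> F \<subseteq> Y \<and> d Y norm F > real k)" using D by (meson not_le order_trans)
      then show False using Y unfolding U_def by blast
    qed
    moreover from this have "\<not> fin_dim Y" using fin_dim_d_small by blast
    ultimately show "Y \<in> ?H" using Y by (auto simp: d_large_subspaces_def Sub_inf_def U_def)
  qed
  have "gdelta_in ellentuck ?H"
    unfolding gdelta_in_alt
  proof
    show "?H \<subseteq> topspace ellentuck" using H openin_subset[OF U[of 0]] by blast
    show "(countable intersection_of openin ellentuck) ?H"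
      unfolding intersection_of_def using U H by (intro exI[of _ "range U"]) auto
  qed
  moreover have "Y \<in> ?H \<longleftrightarrow> {y + f | y f. y \<in> Y \<and> f \<in> F} \<in> ?H" if Y: "Y \<in> Sub_inf" and F: "fin_dim F" for Y F
  proof -
    obtain B where "finite B" "F = span B" using F by (auto simp: fin_dim_def)
    then show ?thesis using d_large_finite_change[OF Y] Y unfolding d_large_subspaces_def by blast
  qed
  ultimately show ?thesis unfolding D_family_def by (auto simp: d_large_subspaces_def)
qed

end

theorem D_family_d_large:
  assumes "is_degree d"
  shows "D_family (d_large_subspaces d)"
proof -
  from assms obtain \<kappa> :: "real \<Rightarrow> real \<Rightarrow> real" where
    "\<forall>V N F. approx_pair V N F \<longrightarrow> 0 \<le> d V N F"
    "\<forall>s s' t t'. 1 \<le> s \<and> s \<le> s' \<and> 0 \<le> t \<and> t \<le> t' \<longrightarrow> \<kappa> s t \<le> \<kappa> s' t'"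
    "\<forall>t\<ge>0. ((\<lambda>s. \<kappa> s t) \<longlongrightarrow> t) (at_right 1)"
    "\<forall>V N F W M G S T. approx_pair V N F \<and> approx_pair W M G \<and> morphism V N F W M G S T \<longrightarrow>
       d W M G \<le> \<kappa> (morphism_norm V N M G S T) (d V N F)"
    unfolding is_degree_def by (elim conjE exE) (rule that)
  then show ?thesis by (intro D_family_d_large_subspaces[of d \<kappa>]) blast+
qed

section \<open>The two criteria\<close>

theorem theorem5p16:
  assumes infinite_dimensional: "\<not> fin_dim (UNIV :: 'a::banach set)"
  shows "(\<forall>H :: 'a set set. D_family H \<and> H_tight H \<and> iso_invariant H \<longrightarrow> ergodic TYPE('a)) \<and>
         (\<forall>d :: 'a set \<Rightarrow> ('a \<Rightarrow> real) \<Rightarrow> 'a set \<Rightarrow> real.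
            is_degree d \<and> d_tight d \<longrightarrow> ergodic TYPE('a))"
  using D_family_tight_imp_ergodic D_family_d_large by (auto simp: d_tight_def)

end
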